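(* Let $(\Omega,\mathcal{A},T,\mu,\mathcal{F},\|\cdot\|,\chi)$ fulfill Property $\mathfrak{D}$ and let $F(x)=\mu(\chi\le x)$. Then there exists a constant $W>0$ such that the following holds for every $\epsilon\in(0,1/4)$ and every sequence $(f_n)_{n\in\mathbb{N}}$ of positive real numbers tending to infinity ($W$ does not depend on $\epsilon$ or $(f_n)$). Put $$a_n:=n\,(1-F(f_n)),\qquad d_n:=n\int_0^{f_n}x\,\mathrm{d}F(x),\qquad n\in\mathbb{N}.$$ If $$\lim_{n\to\infty}\frac{f_n}{d_n}\cdot\max\left\{a_n^{1/2+\epsilon}(\log\log n)^{1/2-\epsilon},\ \log n\right\}=0,$$ then, with $$b_n:=\left\lceil a_n+W\cdot\max\left\{a_n^{1/2+\epsilon}(\log\log n)^{1/2-\epsilon},\ \log\log n\right\}\right\rceil ,$$ we have $$\lim_{n\to\infty}\frac{\mathsf{S}_n^{b_n}\chi}{d_n}=1\quad\mu\text{-almost surely.}$$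
   Context: Transfer operator. For a non-singular transformation $T$ of a probability space $(\Omega,\mathcal{A},\mu)$, $\widehat T:\mathcal{L}^1\to\mathcal{L}^1$ is the unique operator with $\int \widehat T f\cdot g\,\mathrm{d}\mu=\int f\cdot g\circ T\,\mathrm{d}\mu$ for all $f\in\mathcal{L}^1$, $g\in\mathcal{L}^\infty$. $|\cdot|_\infty$ is the $\mathcal{L}^\infty$ norm. Spectral gap. A bounded linear operator $U$ on a Banach space has a spectral gap if $U=\lambda P+N$ with $\lambda\in\mathbb{C}$ and $P,N$ bounded linear operators such that $P^2=P$, $\dim \mathrm{Im}(P)=1$, $\rho(N)<|\lambda|$ ($\rho$ = spectral radius), and $PN=NP=0$. Property $\mathfrak{C}$. Let $\mathcal{F}$ be a subset of the measurable functions forming a Banach algebra with respect to a norm $\|\cdot\|$. $(\Omega,\mathcal{A},T,\mu,\mathcal{F},\|\cdot\|)$ has Property $\mathfrak{C}$ if: $\mu$ is a $T$-invariant, mixing probability measure; $\mathcal{F}$ contains the constant functions and $\|f\|\ge|f|_\infty$ for all $f\in\mathcal{F}$; there is $K_0>0$ with $\|\widehat T f\|\le K_0\|f\|$ for all $f\in\mathcal{F}$; $\widehat T$ has a spectral gap on $\mathcal{F}$ with respect to $\|\cdot\|$. Property $\mathfrak{D}$. Let $\chi:\Omega\to\mathbb{R}_{\ge0}$ be measurable and ${}^{\ell}\chi:=\chi\cdot\mathbb{1}_{\{\chi\le\ell\}}$ for $\ell\ge0$. $(\Omega,\mathcal{A},T,\mu,\mathcal{F},\|\cdot\|,\chi)$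 has Property $\mathfrak{D}$ if $(\Omega,\mathcal{A},T,\mu,\mathcal{F},\|\cdot\|)$ has Property $\mathfrak{C}$ and there are $K_1,K_2>0$ such that for all $\ell>0$: $\|{}^{\ell}\chi\|\le K_1\ell$ and $\|\mathbb{1}_{\{\chi>\ell\}}\|\le K_2$. Trimmed sums. For each $n$ (and each point of $\Omega$) choose a permutation $\sigma$ of $\{0,\dots,n-1\}$ with $\chi\circ T^{\sigma(0)}\ge\chi\circ T^{\sigma(1)}\ge\dots\ge\chi\circ T^{\sigma(n-1)}$; for $b_n\in\mathbb{N}_0$ put $\mathsf{S}_n^{b_n}\chi:=\sum_{k=b_n}^{n-1}\chi\circ T^{\sigma(k)}$, i.e. the Birkhoff sum with the $b_n$ largest terms removed. Expressions with $\log\log n$ are considered for $n\ge3$. *)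

theory Defs
  imports "HOL-Probability.Probability" "HOL-Combinatorics.Permutations"
begin

section \<open>Mixing systems and the transfer operator\<close>

definition invariant_prob :: "'a measure \<Rightarrow> ('a \<Rightarrow> 'a) \<Rightarrow> bool" where
  "invariant_prob M T \<longleftrightarrow> prob_space M \<and> T \<in> measurable M M \<and> distr M M T = M"

definition mixing :: "'a measure \<Rightarrow> ('a \<Rightarrow> 'a) \<Rightarrow> bool" where
  "mixing M T \<longleftrightarrow> (\<forall>A \<in> sets M. \<forall>B \<in> sets M.
     (\<lambda>n. measure M (A \<inter> ((T ^^ n) -` B \<inter> space M))) \<longlonglongrightarrow> measure M A * measure M B)"

definition L_infty_norm :: "'a measure \<Rightarrow> ('a \<Rightarrow> complex) \<Rightarrow> ereal" where
  "L_infty_norm M f = esssup M (\<lambda>x. ereal (cmod (f x)))"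

definition L_infty :: "'a measure \<Rightarrow> ('a \<Rightarrow> complex) set" where
  "L_infty M = {g \<in> borel_measurable M. L_infty_norm M g < \<infinity>}"

definition is_transfer ::
    "'a measure \<Rightarrow> ('a \<Rightarrow> 'a) \<Rightarrow> ('a \<Rightarrow> complex) \<Rightarrow> ('a \<Rightarrow> complex) \<Rightarrow> bool" where
  "is_transfer M T f h \<longleftrightarrow> integrable M h \<and>
     (\<forall>g \<in> L_infty M. (LINT x|M. h x * g x) = (LINT x|M. f x * g (T x)))"

text \<open>For integrable \<open>f\<close> the function characterised by \<open>is_transfer\<close> exists and is unique up to
  null sets (if \<open>T\<close> is non-singular); the choice below picks some representative of its class.\<close>

definition transfer_op ::
    "'a measure \<Rightarrow> ('a \<Rightarrow> 'a) \<Rightarrow> ('a \<Rightarrow> complex) \<Rightarrow> ('a \<Rightarrow> complex)" where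
  "transfer_op M T f = (SOME h. is_transfer M T f h)"


section \<open>Banach algebras of measurable functions\<close>

text \<open>As for the Lebesgue spaces, elements of the Banach algebra are classes of functions modulo
  almost everywhere equality.  The algebra is represented by the set \<open>\<F>\<close> of all representatives
  of its members, and its norm by a function \<open>nrm\<close> on representatives, so that equality
  of elements becomes equality almost everywhere.  The scalar field is \<open>\<complex>\<close>.\<close>

abbreviation ae_eq :: "'a measure \<Rightarrow> ('a \<Rightarrow> complex) \<Rightarrow> ('a \<Rightarrow> complex) \<Rightarrow> bool" where
  "ae_eq M f g \<equiv> (AE x in M. f x = g x)"

definition banach_algebra ::
    "'a measure \<Rightarrow> ('a \<Rightarrow> complex) set \<Rightarrow> (('a \<Rightarrow> complex) \<Rightarrow> real) \<Rightarrow> bool" where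
  "banach_algebra M \<F> nrm \<longleftrightarrow>
     \<F> \<subseteq> borel_measurable M \<and>
     (\<forall>f \<in> \<F>. \<forall>g \<in> borel_measurable M. ae_eq M f g \<longrightarrow> g \<in> \<F>) \<and>
     (\<lambda>x. 0) \<in> \<F> \<and>
     (\<forall>f \<in> \<F>. \<forall>g \<in> \<F>. (\<lambda>x. f x + g x) \<in> \<F>) \<and>
     (\<forall>c. \<forall>f \<in> \<F>. (\<lambda>x. c * f x) \<in> \<F>) \<and>
     (\<forall>f \<in> \<F>. \<forall>g \<in> \<F>. (\<lambda>x. f x * g x) \<in> \<F>) \<and>
     (\<forall>f \<in> \<F>. 0 \<le> nrm f) \<and>
     (\<forall>f \<in> \<F>. nrm f = 0 \<longleftrightarrow> ae_eq M f (\<lambda>x. 0)) \<and>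
     (\<forall>f \<in> \<F>. \<forall>g \<in> \<F>. nrm (\<lambda>x. f x + g x) \<le> nrm f + nrm g) \<and>
     (\<forall>c. \<forall>f \<in> \<F>. nrm (\<lambda>x. c * f x) = cmod c * nrm f) \<and>
     (\<forall>f \<in> \<F>. \<forall>g \<in> \<F>. nrm (\<lambda>x. f x * g x) \<le> nrm f * nrm g) \<and>
     (\<forall>u :: nat \<Rightarrow> 'a \<Rightarrow> complex. (\<forall>n. u n \<in> \<F>) \<and>
        (\<forall>e>0. \<exists>N. \<forall>m\<ge>N. \<forall>n\<ge>N. nrm (\<lambda>x. u m x - u n x) < e) \<longrightarrow>
        (\<exists>f \<in> \<F>. (\<lambda>n. nrm (\<lambda>x. u n x - f x)) \<longlonglongrightarrow> 0))"


section \<open>Bounded operators and the spectral gap\<close>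

definition bounded_op ::
    "'a measure \<Rightarrow> ('a \<Rightarrow> complex) set \<Rightarrow> (('a \<Rightarrow> complex) \<Rightarrow> real) \<Rightarrow>
     (('a \<Rightarrow> complex) \<Rightarrow> ('a \<Rightarrow> complex)) \<Rightarrow> bool" where
  "bounded_op M \<F> nrm U \<longleftrightarrow>
     (\<forall>f \<in> \<F>. U f \<in> \<F>) \<and>
     (\<forall>f \<in> \<F>. \<forall>g \<in> \<F>. ae_eq M (U (\<lambda>x. f x + g x)) (\<lambda>x. U f x + U g x)) \<and>
     (\<forall>c. \<forall>f \<in> \<F>. ae_eq M (U (\<lambda>x. c * f x)) (\<lambda>x. c * U f x)) \<and>
     (\<exists>C. \<forall>f \<in> \<F>. nrm (U f) \<le> C * nrm f)"

definition op_spectrum ::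
    "'a measure \<Rightarrow> ('a \<Rightarrow> complex) set \<Rightarrow> (('a \<Rightarrow> complex) \<Rightarrow> real) \<Rightarrow>
     (('a \<Rightarrow> complex) \<Rightarrow> ('a \<Rightarrow> complex)) \<Rightarrow> complex set" where
  "op_spectrum M \<F> nrm U = {z. \<not> (\<exists>R. bounded_op M \<F> nrm R \<and>
     (\<forall>f \<in> \<F>. ae_eq M (R (\<lambda>x. z * f x - U f x)) f \<and>
               ae_eq M (\<lambda>x. z * R f x - U (R f) x) f))}"

definition op_spectral_radius ::
    "'a measure \<Rightarrow> ('a \<Rightarrow> complex) set \<Rightarrow> (('a \<Rightarrow> complex) \<Rightarrow> real) \<Rightarrow>
     (('a \<Rightarrow> complex) \<Rightarrow> ('a \<Rightarrow> complex)) \<Rightarrow> ereal" where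
  "op_spectral_radius M \<F> nrm U = (SUP z \<in> op_spectrum M \<F> nrm U. ereal (cmod z))"

text \<open>One-dimensionality: the image of \<open>\<F>\<close> under \<open>P\<close> has a basis with one element.\<close>

definition image_dim_one ::
    "'a measure \<Rightarrow> ('a \<Rightarrow> complex) set \<Rightarrow> (('a \<Rightarrow> complex) \<Rightarrow> ('a \<Rightarrow> complex)) \<Rightarrow> bool" where
  "image_dim_one M \<F> P \<longleftrightarrow>
     (\<exists>f0 \<in> \<F>. \<not> ae_eq M (P f0) (\<lambda>x. 0) \<and>
        (\<forall>f \<in> \<F>. \<exists>c. ae_eq M (P f) (\<lambda>x. c * P f0 x)))"

definition spectral_gap ::
    "'a measure \<Rightarrow> ('a \<Rightarrow> complex) set \<Rightarrow> (('a \<Rightarrow> complex) \<Rightarrow> real) \<Rightarrow>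
     (('a \<Rightarrow> complex) \<Rightarrow> ('a \<Rightarrow> complex)) \<Rightarrow> bool" where
  "spectral_gap M \<F> nrm U \<longleftrightarrow> bounded_op M \<F> nrm U \<and>
     (\<exists>ev P N. bounded_op M \<F> nrm P \<and> bounded_op M \<F> nrm N \<and>
        (\<forall>f \<in> \<F>. ae_eq M (U f) (\<lambda>x. ev * P f x + N f x)) \<and>
        (\<forall>f \<in> \<F>. ae_eq M (P (P f)) (P f)) \<and>
        image_dim_one M \<F> P \<and>
        op_spectral_radius M \<F> nrm N < ereal (cmod ev) \<and>
        (\<forall>f \<in> \<F>. ae_eq M (P (N f)) (\<lambda>x. 0)) \<and>
        (\<forall>f \<in> \<F>. ae_eq M (N (P f)) (\<lambda>x. 0)))"


section \<open>Properties C and D\<close>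

definition property_C ::
    "'a measure \<Rightarrow> ('a \<Rightarrow> 'a) \<Rightarrow> ('a \<Rightarrow> complex) set \<Rightarrow> (('a \<Rightarrow> complex) \<Rightarrow> real) \<Rightarrow> bool" where
  "property_C M T \<F> nrm \<longleftrightarrow>
     invariant_prob M T \<and> mixing M T \<and>
     banach_algebra M \<F> nrm \<and>
     (\<forall>c. (\<lambda>x. c) \<in> \<F>) \<and>
     (\<forall>f \<in> \<F>. L_infty_norm M f \<le> ereal (nrm f)) \<and>
     (\<exists>K0>0. \<forall>f \<in> \<F>. transfer_op M T f \<in> \<F> \<and> nrm (transfer_op M T f) \<le> K0 * nrm f) \<and>
     spectral_gap M \<F> nrm (transfer_op M T)"

definition truncated :: "('a \<Rightarrow> real) \<Rightarrow> real \<Rightarrow> 'a \<Rightarrow> real" where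
  "truncated chi l x = chi x * indicator {y. chi y \<le> l} x"

definition property_D ::
    "'a measure \<Rightarrow> ('a \<Rightarrow> 'a) \<Rightarrow> ('a \<Rightarrow> complex) set \<Rightarrow> (('a \<Rightarrow> complex) \<Rightarrow> real) \<Rightarrow>
     ('a \<Rightarrow> real) \<Rightarrow> bool" where
  "property_D M T \<F> nrm chi \<longleftrightarrow>
     property_C M T \<F> nrm \<and>
     chi \<in> borel_measurable M \<and> (\<forall>x \<in> space M. 0 \<le> chi x) \<and>
     (\<exists>K1>0. \<exists>K2>0. \<forall>l>0.
        (\<lambda>x. complex_of_real (truncated chi l x)) \<in> \<F> \<and>
        nrm (\<lambda>x. complex_of_real (truncated chi l x)) \<le> K1 * l \<and>
        (indicator {y. chi y > l} :: 'a \<Rightarrow> complex) \<in> \<F> \<and>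
        nrm (indicator {y. chi y > l}) \<le> K2)"


section \<open>Distribution function and trimmed sums\<close>

definition dist_fun :: "'a measure \<Rightarrow> ('a \<Rightarrow> real) \<Rightarrow> real \<Rightarrow> real" where
  "dist_fun M chi x = measure M {\<omega> \<in> space M. chi \<omega> \<le> x}"

definition ordering_perm :: "('a \<Rightarrow> 'a) \<Rightarrow> ('a \<Rightarrow> real) \<Rightarrow> nat \<Rightarrow> 'a \<Rightarrow> (nat \<Rightarrow> nat) \<Rightarrow> bool" where
  "ordering_perm T chi n x \<sigma> \<longleftrightarrow> \<sigma> permutes {..<n} \<and>
     (\<forall>i j. i \<le> j \<and> j < n \<longrightarrow> chi ((T ^^ \<sigma> j) x) \<le> chi ((T ^^ \<sigma> i) x))"

text \<open>An ordering permutation always exists, and the sum does not depend on the chosen one.\<close>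

definition trimmed_sum :: "('a \<Rightarrow> 'a) \<Rightarrow> ('a \<Rightarrow> real) \<Rightarrow> nat \<Rightarrow> nat \<Rightarrow> 'a \<Rightarrow> real" where
  "trimmed_sum T chi b n x =
     (let \<sigma> = (SOME \<sigma>. ordering_perm T chi n x \<sigma>) in \<Sum>k = b..<n. chi ((T ^^ \<sigma> k) x))"

end

(* A trimmed sum differs from the Birkhoff sum of the truncation of chi at f n by at most
   (b n - N) f n, where N is the number of terms exceeding f n, as soon as N <= b n. So one needs
   a law of large numbers for the truncated sums, and N = a n up to W times the maximum in b n.
   Both rest on the exponential bound P(|S_n X - n p| >= t) <= 2 exp (B s^2 n p - s t / 2) for
   0 <= X <= 1 with mean p and norm at most K, with B and the range of s depending only on K.
   It comes from iterating the weighted transfer operator f |-> transfer ((1 + s X) f) and the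
   decay r^k of the powers of its non-leading part, which follows from the spectral radius being
   less than 1 there.
   For the truncated sums Borel-Cantelli over n is enough, because d n / f n grows faster than ln n.
   The counts fluctuate only on the scale ln ln n; there the indices in [2^j, 2^(j+1)) are grouped
   into classes with nearly equal n and nearly equal exceedance probability, monotonicity in n
   and in the level reduces each class to its extreme members, and Borel-Cantelli runs over j. *)

theory Submission
  imports Defs "HOL-Real_Asymp.Real_Asymp"
begin

section \<open>Operators on Banach algebras of functions\<close>

text \<open>The spectral radius is a supremum over the spectrum, hence a statement about resolvents
  only. Decay of powers is extracted by averaging resolvents over roots of unity, a discrete
  substitute for the Cauchy integral. The weight 1 + s X replaces exp (s X) because it is affine in
  X: one multiplication in the algebra suffices, and only the norm of X enters. A quadratic term B
  s^2 n p, rather than B s^2 n, is essential: it keeps the bound sharp when p is small, as for the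
  exceedances of high levels. The exponents of the theorem come from m^(1/2 + \<epsilon>) L = (m
  L)^(1/2 + \<epsilon>) L^(1/2 - \<epsilon>), with L = ln j and m L the order of the mean count on a
  class. Taking s proportional to m^(\<epsilon> - 1/2) turns both terms of the tail exponent into
  multiples of L m^(2 \<epsilon>), which leaves W free of \<epsilon>. Since f is not assumed
  monotone, the number of classes to be considered in a block is exponential in j; the positive
  power m^(2 \<epsilon>) pays for them.\<close>

locale fun_algebra =
  fixes M :: "'a measure" and \<F> :: "('a \<Rightarrow> complex) set" and nrm :: "('a \<Rightarrow> complex) \<Rightarrow> real"
  assumes algebra: "banach_algebra M \<F> nrm"
begin

lemma borel [measurable_dest]: "f \<in> \<F> \<Longrightarrow> f \<in> borel_measurable M"
  using algebra unfolding banach_algebra_def by blast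

lemma zero_closed: "(\<lambda>x. 0) \<in> \<F>"
  using algebra unfolding banach_algebra_def by blast

lemma add_closed: "f \<in> \<F> \<Longrightarrow> g \<in> \<F> \<Longrightarrow> (\<lambda>x. f x + g x) \<in> \<F>"
  using algebra unfolding banach_algebra_def by blast

lemma scale_closed: "f \<in> \<F> \<Longrightarrow> (\<lambda>x. c * f x) \<in> \<F>"
  using algebra unfolding banach_algebra_def by blast

lemma mult_closed: "f \<in> \<F> \<Longrightarrow> g \<in> \<F> \<Longrightarrow> (\<lambda>x. f x * g x) \<in> \<F>"
  using algebra unfolding banach_algebra_def by blast

lemma nrm_nonneg: "f \<in> \<F> \<Longrightarrow> 0 \<le> nrm f"
  using algebra unfolding banach_algebra_def by blast

lemma nrm_eq_0: "f \<in> \<F> \<Longrightarrow> nrm f = 0 \<longleftrightarrow> ae_eq M f (\<lambda>x. 0)"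
  using algebra unfolding banach_algebra_def by blast

lemma nrm_add: "f \<in> \<F> \<Longrightarrow> g \<in> \<F> \<Longrightarrow> nrm (\<lambda>x. f x + g x) \<le> nrm f + nrm g"
  using algebra unfolding banach_algebra_def by blast

lemma nrm_scale: "f \<in> \<F> \<Longrightarrow> nrm (\<lambda>x. c * f x) = cmod c * nrm f"
  using algebra unfolding banach_algebra_def by blast

lemma nrm_mult: "f \<in> \<F> \<Longrightarrow> g \<in> \<F> \<Longrightarrow> nrm (\<lambda>x. f x * g x) \<le> nrm f * nrm g"
  using algebra unfolding banach_algebra_def by blast

lemma diff_closed: "f \<in> \<F> \<Longrightarrow> g \<in> \<F> \<Longrightarrow> (\<lambda>x. f x - g x) \<in> \<F>"
  using add_closed[of f "\<lambda>x. (-1) * g x"] scale_closed[of g "-1"] by simp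

lemma sum_closed: "(\<And>k. k \<in> I \<Longrightarrow> f k \<in> \<F>) \<Longrightarrow> (\<lambda>x. \<Sum>k\<in>I. f k x) \<in> \<F>"
  by (induction I rule: infinite_finite_induct) (auto simp: zero_closed intro!: add_closed)

lemma nrm_zero: "nrm (\<lambda>x. 0) = 0"
  using nrm_eq_0[OF zero_closed] by simp

lemma nrm_sum: "(\<And>k. k \<in> I \<Longrightarrow> f k \<in> \<F>) \<Longrightarrow> nrm (\<lambda>x. \<Sum>k\<in>I. f k x) \<le> (\<Sum>k\<in>I. nrm (f k))"
proof (induction I rule: infinite_finite_induct)
  case (insert a I)
  then show ?case
    using nrm_add[of "f a" "\<lambda>x. \<Sum>k\<in>I. f k x"] sum_closed[of I f] by fastforce
qed (auto simp: nrm_zero)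

lemma nrm_le_ae:
  assumes "f \<in> \<F>" "g \<in> \<F>" "ae_eq M f g"
  shows "nrm f \<le> nrm g"
proof -
  have "nrm (\<lambda>x. f x - g x) = 0"
    using assms by (subst nrm_eq_0) (auto intro: diff_closed)
  moreover have "nrm f \<le> nrm (\<lambda>x. f x - g x) + nrm g"
    using nrm_add[of "\<lambda>x. f x - g x" g] assms diff_closed by simp
  ultimately show ?thesis by simp
qed

lemma nrm_cong:
  assumes "f \<in> \<F>" "g \<in> \<F>" "ae_eq M f g"
  shows "nrm f = nrm g"
proof (rule antisym)
  show "nrm f \<le> nrm g" by (rule nrm_le_ae[OF assms])
  have "ae_eq M g f" using assms(3) by eventually_elim simp
  then show "nrm g \<le> nrm f" by (rule nrm_le_ae[OF assms(2,1)])
qed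

lemma nrm_triangle3:
  assumes "f \<in> \<F>" "g \<in> \<F>" "h \<in> \<F>"
  shows "nrm (\<lambda>x. f x - h x) \<le> nrm (\<lambda>x. f x - g x) + nrm (\<lambda>x. g x - h x)"
  using nrm_add[OF diff_closed[OF assms(1,2)] diff_closed[OF assms(2,3)]] by simp

lemma nrm_diff_commute:
  assumes "f \<in> \<F>" "g \<in> \<F>"
  shows "nrm (\<lambda>x. f x - g x) = nrm (\<lambda>x. g x - f x)"
  using nrm_scale[OF diff_closed[OF assms], of "-1"] by simp

lemma nrm_triangle_sub:
  assumes "f \<in> \<F>" "g \<in> \<F>"
  shows "nrm f \<le> nrm g + nrm (\<lambda>x. f x - g x)"
  using nrm_add[OF assms(2) diff_closed[OF assms]] by simp

end

locale fun_operator = fun_algebra +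
  fixes N :: "('a \<Rightarrow> complex) \<Rightarrow> 'a \<Rightarrow> complex"
  assumes bounded: "bounded_op M \<F> nrm N"
begin

lemma op_closed: "f \<in> \<F> \<Longrightarrow> N f \<in> \<F>"
  using bounded unfolding bounded_op_def by blast

lemma op_add: "f \<in> \<F> \<Longrightarrow> g \<in> \<F> \<Longrightarrow> ae_eq M (N (\<lambda>x. f x + g x)) (\<lambda>x. N f x + N g x)"
  using bounded unfolding bounded_op_def by blast

lemma op_scale: "f \<in> \<F> \<Longrightarrow> ae_eq M (N (\<lambda>x. c * f x)) (\<lambda>x. c * N f x)"
  using bounded unfolding bounded_op_def by blast

lemma op_bound: obtains C where "C > 0" "\<And>f. f \<in> \<F> \<Longrightarrow> nrm (N f) \<le> C * nrm f"
proof -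
  obtain C where C: "\<forall>f \<in> \<F>. nrm (N f) \<le> C * nrm f"
    using bounded unfolding bounded_op_def by blast
  show thesis
  proof
    show "\<bar>C\<bar> + 1 > 0" by simp
    fix f assume f: "f \<in> \<F>"
    have "C * nrm f \<le> (\<bar>C\<bar> + 1) * nrm f" using nrm_nonneg[OF f] by (intro mult_right_mono) auto
    then show "nrm (N f) \<le> (\<bar>C\<bar> + 1) * nrm f" using C f by force
  qed
qed

text \<open>Boundedness makes an operator on representatives descend to the quotient by null sets: f
  - g has norm 0, so its image has norm 0.\<close>

lemma op_cong:
  assumes "f \<in> \<F>" "g \<in> \<F>" "ae_eq M f g"
  shows "ae_eq M (N f) (N g)"
proof -
  obtain C where C: "C > 0" "\<And>f. f \<in> \<F> \<Longrightarrow> nrm (N f) \<le> C * nrm f" using op_bound by blast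
  have d: "(\<lambda>x. f x - g x) \<in> \<F>" by (intro diff_closed assms)
  then have "nrm (\<lambda>x. f x - g x) = 0" using assms(3) by (subst nrm_eq_0) auto
  then have "nrm (N (\<lambda>x. f x - g x)) = 0" using C(2)[OF d] nrm_nonneg[OF op_closed[OF d]] by simp
  then have "ae_eq M (N (\<lambda>x. f x - g x)) (\<lambda>x. 0)" using nrm_eq_0[OF op_closed[OF d]] by simp
  moreover have "ae_eq M (N (\<lambda>x. (f x - g x) + g x)) (\<lambda>x. N (\<lambda>x. f x - g x) x + N g x)"
    by (rule op_add[OF d assms(2)])
  ultimately show ?thesis by eventually_elim simp
qed

lemma op_diff:
  assumes "f \<in> \<F>" "g \<in> \<F>"
  shows "ae_eq M (N (\<lambda>x. f x - g x)) (\<lambda>x. N f x - N g x)"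
  using op_add[OF diff_closed[OF assms] assms(2)] by eventually_elim simp

lemma op_zero: "ae_eq M (N (\<lambda>x. 0)) (\<lambda>x. 0)"
  using op_scale[OF zero_closed, of 0] by simp

lemma op_sum:
  assumes "\<And>k. k \<in> I \<Longrightarrow> f k \<in> \<F>"
  shows "ae_eq M (N (\<lambda>x. \<Sum>k\<in>I. c k * f k x)) (\<lambda>x. \<Sum>k\<in>I. c k * N (f k) x)"
  using assms
proof (induction I rule: infinite_finite_induct)
  case (insert a I)
  have s: "(\<lambda>x. \<Sum>k\<in>I. c k * f k x) \<in> \<F>" using insert.prems by (intro sum_closed scale_closed) auto
  have a: "f a \<in> \<F>" using insert.prems by simp
  have "ae_eq M (N (\<lambda>x. c a * f a x + (\<Sum>k\<in>I. c k * f k x)))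
     (\<lambda>x. N (\<lambda>x. c a * f a x) x + N (\<lambda>x. \<Sum>k\<in>I. c k * f k x) x)"
    by (rule op_add[OF scale_closed[OF a] s])
  moreover have "ae_eq M (N (\<lambda>x. \<Sum>k\<in>I. c k * f k x)) (\<lambda>x. \<Sum>k\<in>I. c k * N (f k) x)"
    using insert by auto
  moreover note op_scale[OF a, of "c a"]
  ultimately have "ae_eq M (N (\<lambda>x. c a * f a x + (\<Sum>k\<in>I. c k * f k x)))
     (\<lambda>x. c a * N (f a) x + (\<Sum>k\<in>I. c k * N (f k) x))"
    by eventually_elim simp
  then show ?case using insert.hyps by simp
qed (auto simp: op_zero)

lemma pow_closed: "f \<in> \<F> \<Longrightarrow> (N ^^ k) f \<in> \<F>"
  by (induction k) (auto simp: op_closed)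

lemma pow_cong:
  assumes "f \<in> \<F>" "g \<in> \<F>" "ae_eq M f g"
  shows "ae_eq M ((N ^^ k) f) ((N ^^ k) g)"
proof (induction k)
  case (Suc k)
  then show ?case
    using op_cong[OF pow_closed[OF assms(1)] pow_closed[OF assms(2)]] by simp
qed (simp add: assms(3))

lemma bounded_pow: "bounded_op M \<F> nrm (N ^^ k)"
proof (induction k)
  case 0
  have "\<exists>C. \<forall>f \<in> \<F>. nrm f \<le> C * nrm f" by (rule exI[of _ 1]) simp
  then show ?case unfolding bounded_op_def by simp
next
  case (Suc k)
  interpret P: fun_operator M \<F> nrm "N ^^ k" by unfold_locales (rule Suc)
  obtain C where C: "C > 0" "\<And>f. f \<in> \<F> \<Longrightarrow> nrm (N f) \<le> C * nrm f" using op_bound by blast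
  obtain D where D: "D > 0" "\<And>f. f \<in> \<F> \<Longrightarrow> nrm ((N ^^ k) f) \<le> D * nrm f" using P.op_bound by blast
  show ?case unfolding bounded_op_def funpow.simps o_def
  proof (intro conjI ballI allI exI[of _ "C * D"])
    fix f assume f: "f \<in> \<F>"
    show "N ((N ^^ k) f) \<in> \<F>" by (intro op_closed P.op_closed f)
    show "nrm (N ((N ^^ k) f)) \<le> C * D * nrm f"
      using order_trans[OF C(2)[OF P.op_closed[OF f]] mult_left_mono[OF D(2)[OF f] less_imp_le[OF C(1)]]]
      by (simp add: mult.assoc)
    fix c
    show "ae_eq M (N ((N ^^ k) (\<lambda>x. c * f x))) (\<lambda>x. c * N ((N ^^ k) f) x)"
      using op_cong[OF P.op_closed[OF scale_closed[OF f]] scale_closed[OF P.op_closed[OF f]] P.op_scale[OF f], of c]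
        op_scale[OF P.op_closed[OF f], of c] by eventually_elim simp
  next
    fix f g assume f: "f \<in> \<F>" and g: "g \<in> \<F>"
    show "ae_eq M (N ((N ^^ k) (\<lambda>x. f x + g x))) (\<lambda>x. N ((N ^^ k) f) x + N ((N ^^ k) g) x)"
      using op_cong[OF P.op_closed[OF add_closed[OF f g]] add_closed[OF P.op_closed[OF f] P.op_closed[OF g]] P.op_add[OF f g]]
        op_add[OF P.op_closed[OF f] P.op_closed[OF g]] by eventually_elim simp
  qed
qed

end

section \<open>The spectral radius controls powers\<close>

lemma sum_roots_unity_power:
  assumes "0 < k" "k < m"
  shows "(\<Sum>j<m. (cis (2 * pi / real m) ^ j) ^ k) = 0"
proof -
  define z where "z = cis (2 * pi / real m)"
  have m: "m > 0" using assms by simp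
  have pow: "z ^ i = cis (2 * pi * real i / real m)" for i
    unfolding z_def by (simp add: Complex.DeMoivre mult_ac)
  have "z ^ k \<noteq> z ^ 0"
    using inj_onD[OF bij_betw_imp_inj_on[OF Complex.bij_betw_roots_unity[OF m]], of k 0] assms m
    unfolding pow by auto
  moreover have "z ^ m = 1" using m by (simp add: pow)
  then have "(z ^ k) ^ m = 1" by (metis power_mult mult.commute power_one)
  ultimately have "(\<Sum>j<m. (z ^ k) ^ j) = 0"
    by (simp add: sum_gp_strict)
  then show ?thesis by (simp add: z_def power_mult[symmetric] mult.commute)
qed

lemma cis_root_power:
  assumes "m > 0"
  shows "(cis (2 * pi / real m) ^ j) ^ m = 1"
proof -
  have "cis (2 * pi / real m) ^ m = 1"
    using assms by (simp add: Complex.DeMoivre)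
  then show ?thesis by (metis mult.commute power_mult power_one)
qed

text \<open>Discrete Cauchy formula: the mean of a polynomial of degree below m over the m-th roots
  of unity is its constant term, because the sums of the k-th powers vanish for 0 < k < m.\<close>

lemma mean_roots_unity:
  fixes a :: "nat \<Rightarrow> complex"
  assumes m: "m > 0"
  shows "(\<Sum>j<m. 1 / of_nat m * (\<Sum>k<m. (w * cis (2 * pi / real m) ^ j) ^ k * a k)) = a 0"
proof -
  let ?z = "cis (2 * pi / real m)"
  have "(\<Sum>j<m. 1 / of_nat m * (\<Sum>k<m. (w * ?z ^ j) ^ k * a k))
      = (\<Sum>k<m. (1 / of_nat m * w ^ k * a k) * (\<Sum>j<m. (?z ^ j) ^ k))"
    unfolding sum_distrib_left by (subst sum.swap) (simp add: power_mult_distrib mult_ac)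
  also have "\<dots> = (\<Sum>k<m. if k = 0 then a 0 else 0)"
    by (intro sum.cong refl) (use m in \<open>auto simp: sum_roots_unity_power\<close>)
  also have "\<dots> = a 0" using m by simp
  finally show ?thesis .
qed

context fun_operator
begin

lemma nrm_mean:
  assumes "m > 0" "\<And>j. j < m \<Longrightarrow> u j \<in> \<F>" "\<And>j. j < m \<Longrightarrow> nrm (u j) \<le> B"
  shows "nrm (\<lambda>x. \<Sum>j<m. 1 / of_nat m * u j x) \<le> B"
proof -
  have "nrm (\<lambda>x. \<Sum>j<m. 1 / of_nat m * u j x) \<le> (\<Sum>j<m. nrm (\<lambda>x. 1 / of_nat m * u j x))"
    using assms by (intro nrm_sum scale_closed) auto
  also have "\<dots> = (\<Sum>j<m. 1 / real m * nrm (u j))"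
    using assms by (intro sum.cong refl) (subst nrm_scale, auto simp: norm_divide)
  also have "\<dots> \<le> (\<Sum>j<m. 1 / real m * B)"
    using assms by (intro sum_mono mult_left_mono) auto
  finally show ?thesis using assms(1) by simp
qed

text \<open>The spectral parameter is inverted, w = 1 / z: the region |z| >= r beyond the spectrum
  becomes the disc |w| <= 1 / r, with w = 0 included, and so becomes compact.\<close>

lemma resolvent_exists:
  assumes rho: "op_spectral_radius M \<F> nrm N < ereal r" and r: "0 < r" and w: "cmod w * r \<le> 1"
  obtains c where "c > 0" "\<And>h. h \<in> \<F> \<Longrightarrow> nrm h \<le> c * nrm (\<lambda>x. h x - w * N h x)"
    "\<And>f. f \<in> \<F> \<Longrightarrow> \<exists>h\<in>\<F>. ae_eq M (\<lambda>x. h x - w * N h x) f"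
proof (cases "w = 0")
  case True
  then show thesis by (intro that[of 1]) auto
next
  case False
  define z where "z = 1 / w"
  have zw: "z * w = 1" "z \<noteq> 0" using False by (auto simp: z_def)
  have "r \<le> cmod z" using w False by (simp add: z_def norm_divide field_simps)
  then have "\<not> ereal (cmod z) \<le> op_spectral_radius M \<F> nrm N" using rho
    by (meson ereal_less_eq(3) leD order_trans)
  then have "z \<notin> op_spectrum M \<F> nrm N"
    unfolding op_spectral_radius_def by (auto intro: SUP_upper)
  then obtain R where R: "bounded_op M \<F> nrm R"
    and inv: "\<And>f. f \<in> \<F> \<Longrightarrow> ae_eq M (R (\<lambda>x. z * f x - N f x)) f"
      "\<And>f. f \<in> \<F> \<Longrightarrow> ae_eq M (\<lambda>x. z * R f x - N (R f) x) f"
    unfolding op_spectrum_def by blast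
  interpret R: fun_operator M \<F> nrm R by unfold_locales (rule R)
  obtain C where C: "C > 0" "\<And>f. f \<in> \<F> \<Longrightarrow> nrm (R f) \<le> C * nrm f" using R.op_bound by blast
  show thesis
  proof (rule that[of "C * cmod z"])
    show "C * cmod z > 0" using C zw by simp
    fix h assume h: "h \<in> \<F>"
    have d: "(\<lambda>x. h x - w * N h x) \<in> \<F>" by (intro diff_closed scale_closed op_closed h)
    have d': "(\<lambda>x. z * h x - N h x) \<in> \<F>" by (intro diff_closed scale_closed op_closed h)
    have "nrm h = nrm (R (\<lambda>x. z * h x - N h x))"
      using inv(1)[OF h] by (intro nrm_cong[symmetric] R.op_closed d' h)
    also have "\<dots> \<le> C * nrm (\<lambda>x. z * h x - N h x)" by (rule C(2)[OF d'])
    also have "(\<lambda>x. z * h x - N h x) = (\<lambda>x. z * (h x - w * N h x))"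
      using zw(1) by (auto simp: fun_eq_iff right_diff_distrib mult.assoc[symmetric])
    also have "C * nrm (\<lambda>x. z * (h x - w * N h x)) = C * cmod z * nrm (\<lambda>x. h x - w * N h x)"
      by (simp add: nrm_scale[OF d])
    finally show "nrm h \<le> C * cmod z * nrm (\<lambda>x. h x - w * N h x)" .
  next
    fix f assume f: "f \<in> \<F>"
    show "\<exists>h\<in>\<F>. ae_eq M (\<lambda>x. h x - w * N h x) f"
    proof
      show "(\<lambda>x. z * R f x) \<in> \<F>" by (intro scale_closed R.op_closed f)
      show "ae_eq M (\<lambda>x. z * R f x - w * N (\<lambda>x. z * R f x) x) f"
        using inv(2)[OF f] op_scale[OF R.op_closed[OF f], of z]
      proof eventually_elim
        case (elim x)
        have "w * (z * N (R f) x) = N (R f) x" using zw(1) by (metis mult.assoc mult.commute mult_1)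
        then show ?case using elim by (simp only:)
      qed
    qed
  qed
qed

text \<open>The estimate at w survives on a small disc around w with twice the constant; compactness
  of |w| <= 1 / r leaves finitely many such discs.\<close>

lemma resolvent_uniform_bound:
  assumes rho: "op_spectral_radius M \<F> nrm N < ereal r" and r: "0 < r"
  obtains c where "c > 0"
    "\<And>h w. h \<in> \<F> \<Longrightarrow> cmod w * r \<le> 1 \<Longrightarrow> nrm h \<le> c * nrm (\<lambda>x. h x - w * N h x)"
proof -
  obtain D where D: "D > 0" "\<And>f. f \<in> \<F> \<Longrightarrow> nrm (N f) \<le> D * nrm f" using op_bound by blast
  define K where "K = cball (0::complex) (1 / r)"
  have K: "w \<in> K \<longleftrightarrow> cmod w * r \<le> 1" for w using r by (simp add: K_def field_simps)
  have "\<exists>c>0. \<forall>h\<in>\<F>. nrm h \<le> c * nrm (\<lambda>x. h x - w * N h x)" if "w \<in> K" for w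
    using that K resolvent_exists[OF rho r, of w] by metis
  then obtain c where c: "\<And>w. w \<in> K \<Longrightarrow> c w > 0"
    "\<And>w h. w \<in> K \<Longrightarrow> h \<in> \<F> \<Longrightarrow> nrm h \<le> c w * nrm (\<lambda>x. h x - w * N h x)"
    by metis
  \<comment> \<open>With this radius the perturbation contributes c w * e w * D *
    \<open>nrm h\<close> = \<open>nrm h\<close> / 2, which the left side absorbs; hence the factor
    2.\<close>
  define e where "e w = 1 / (2 * c w * D)" for w
  have e: "e w > 0" if "w \<in> K" for w using c(1)[OF that] D(1) by (simp add: e_def)
  have loc: "nrm h \<le> 2 * c w * nrm (\<lambda>x. h x - w' * N h x)"
    if "w \<in> K" "w' \<in> ball w (e w)" "h \<in> \<F>" for w w' h
  proof -
    have [simp]: "N h \<in> \<F>" by (rule op_closed[OF that(3)])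
    have d: "(\<lambda>x. h x - w' * N h x) \<in> \<F>" by (intro diff_closed scale_closed that) simp
    have "nrm h \<le> c w * nrm (\<lambda>x. h x - w * N h x)" by (rule c(2)[OF that(1,3)])
    also have "(\<lambda>x. h x - w * N h x) = (\<lambda>x. (h x - w' * N h x) + (w' - w) * N h x)"
      by (auto simp: algebra_simps)
    also have "nrm \<dots> \<le> nrm (\<lambda>x. h x - w' * N h x) + nrm (\<lambda>x. (w' - w) * N h x)"
      by (intro nrm_add d scale_closed) simp
    also have "nrm (\<lambda>x. (w' - w) * N h x) = cmod (w' - w) * nrm (N h)" by (rule nrm_scale) simp
    also have "cmod (w' - w) * nrm (N h) \<le> e w * (D * nrm h)"
      using that(2) e[OF that(1)] by (intro mult_mono D that) (auto simp: dist_norm norm_minus_commute nrm_nonneg)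
    also have "c w * (nrm (\<lambda>x. h x - w' * N h x) + e w * (D * nrm h))
       = c w * nrm (\<lambda>x. h x - w' * N h x) + nrm h / 2"
      using c(1)[OF that(1)] D(1) by (simp add: e_def field_simps)
    finally show ?thesis using c(1)[OF that(1)] by (simp add: mult_left_mono)
  qed
  have "compact K" by (simp add: K_def)
  moreover have "K \<subseteq> (\<Union>w\<in>K. ball w (e w))" using e by force
  ultimately obtain K' where K': "K' \<subseteq> K" "finite K'" "K \<subseteq> (\<Union>w\<in>K'. ball w (e w))"
    by (auto elim: compactE_image[of K K "\<lambda>w. ball w (e w)"])
  show thesis
  \<comment> \<open>The sum over the finite subcover stands in for the maximum of its local
    constants.\<close>
  proof (rule that[of "1 + (\<Sum>w\<in>K'. 2 * c w)"])
    have nn: "(\<Sum>w\<in>K'. 2 * c w) \<ge> 0" using K'(1) c(1) by (intro sum_nonneg) force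
    then show "1 + (\<Sum>w\<in>K'. 2 * c w) > 0" by simp
    fix h w' assume h: "h \<in> \<F>" and "cmod w' * r \<le> 1"
    then obtain w where w: "w \<in> K'" "w' \<in> ball w (e w)" using K K'(3) by blast
    have "2 * c w \<le> (\<Sum>w\<in>K'. 2 * c w)"
      using K'(1,2) c(1) w(1) by (intro member_le_sum) (auto simp: less_imp_le subset_iff)
    moreover have "nrm h \<le> 2 * c w * nrm (\<lambda>x. h x - w' * N h x)"
      using loc[OF _ w(2) h] w(1) K'(1) by blast
    moreover have "0 \<le> nrm (\<lambda>x. h x - w' * N h x)"
      by (intro nrm_nonneg diff_closed scale_closed op_closed h)
    ultimately show "nrm h \<le> (1 + (\<Sum>w\<in>K'. 2 * c w)) * nrm (\<lambda>x. h x - w' * N h x)"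
      by (smt (verit) mult_right_mono)
  qed
qed

section \<open>Finite Neumann series and their means over roots of unity\<close>

definition geometric :: "nat \<Rightarrow> complex \<Rightarrow> ('a \<Rightarrow> complex) \<Rightarrow> 'a \<Rightarrow> complex" where
  "geometric m v h x = (\<Sum>k<m. v ^ k * (N ^^ k) h x)"

lemma geometric_closed: "h \<in> \<F> \<Longrightarrow> geometric m v h \<in> \<F>"
  unfolding geometric_def by (intro sum_closed scale_closed pow_closed)

lemma geometric_right:
  assumes "h \<in> \<F>"
  shows "ae_eq M (\<lambda>x. geometric m v h x - v * N (geometric m v h) x) (\<lambda>x. h x - v ^ m * (N ^^ m) h x)"
proof -
  have "ae_eq M (N (\<lambda>x. \<Sum>k<m. v ^ k * (N ^^ k) h x)) (\<lambda>x. \<Sum>k<m. v ^ k * N ((N ^^ k) h) x)"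
    by (rule op_sum) (rule pow_closed[OF assms])
  then show ?thesis
  proof eventually_elim
    case (elim x)
    have "(\<Sum>k<m. v ^ k * (N ^^ k) h x) - v * (\<Sum>k<m. v ^ k * N ((N ^^ k) h) x)
        = (\<Sum>k<m. v ^ k * (N ^^ k) h x - v ^ Suc k * (N ^^ Suc k) h x)"
      by (simp add: sum_subtractf sum_distrib_left mult_ac)
    also have "\<dots> = h x - v ^ m * (N ^^ m) h x"
      by (subst sum_lessThan_telescope') simp
    finally show ?case using elim by (simp add: geometric_def[abs_def])
  qed
qed

text \<open>Here u is known only through its equation, as for solutions supplied by the resolvent.
  Applying the finite Neumann series to that equation telescopes.\<close>

lemma geometric_left:
  assumes "u \<in> \<F>" "g \<in> \<F>" "ae_eq M (\<lambda>x. u x - v * N u x) g"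
  shows "ae_eq M (\<lambda>x. u x - v ^ m * (N ^^ m) u x) (geometric m v g)"
proof (induction m)
  case (Suc m)
  interpret P: fun_operator M \<F> nrm "N ^^ m" by unfold_locales (rule bounded_pow)
  have c: "(\<lambda>x. v * N u x) \<in> \<F>" by (intro scale_closed op_closed assms)
  have "(N ^^ m) (N u) = (N ^^ Suc m) u" by (simp add: funpow_swap1)
  then have "ae_eq M ((N ^^ m) (\<lambda>x. v * N u x)) (\<lambda>x. v * (N ^^ Suc m) u x)"
    using P.op_scale[OF op_closed[OF assms(1)], of v] by simp
  moreover have "ae_eq M ((N ^^ m) (\<lambda>x. u x - v * N u x)) ((N ^^ m) g)"
    by (intro P.op_cong assms diff_closed c)
  moreover have "ae_eq M ((N ^^ m) (\<lambda>x. u x - v * N u x)) (\<lambda>x. (N ^^ m) u x - (N ^^ m) (\<lambda>x. v * N u x) x)"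
    by (intro P.op_diff assms c)
  moreover note Suc
  ultimately show ?case
    by eventually_elim (simp add: geometric_def, simp add: algebra_simps)
qed (simp add: geometric_def[abs_def])

lemma mean_geometric:
  "m > 0 \<Longrightarrow> (\<Sum>j<m. 1 / of_nat m * geometric m (w * cis (2 * pi / real m) ^ j) h x) = h x"
  unfolding geometric_def by (subst mean_roots_unity) auto

text \<open>Convergence of t^m N^m to 0 in operator norm, written out with
  \<open>nrm\<close>.\<close>

definition pow_small :: "real \<Rightarrow> bool" where
  "pow_small t \<longleftrightarrow> (\<forall>\<eta>>0. \<exists>k0. \<forall>m\<ge>k0. \<forall>h\<in>\<F>. t ^ m * nrm ((N ^^ m) h) \<le> \<eta> * nrm h)"

text \<open>A fixed contraction factor for all large m already forces convergence to 0: writing m =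
  k0 + m' extracts one factor 1/3 per k0 powers.\<close>

lemma pow_smallI:
  assumes k: "\<And>m h. m \<ge> k0 \<Longrightarrow> h \<in> \<F> \<Longrightarrow> t ^ m * nrm ((N ^^ m) h) \<le> 1/3 * nrm h" and t: "t \<ge> 0"
  shows "pow_small t"
proof -
  \<comment> \<open>Positivity of i matters: i = 0 would claim that t^m N^m is nonexpansive for
    every m, including m < k0.\<close>
  have *: "\<forall>m\<ge>i * k0. \<forall>h\<in>\<F>. t ^ m * nrm ((N ^^ m) h) \<le> (1/3) ^ i * nrm h" if "i > 0" for i
    using that
  proof (induction i rule: nat_induct_non_zero)
    case 1
    then show ?case using k by simp
  next
    case (Suc i)
    show ?case
    proof (intro allI impI ballI)
      fix m h assume m: "Suc i * k0 \<le> m" and h: "h \<in> \<F>"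
      define m' where "m' = m - k0"
      have m': "m = k0 + m'" "i * k0 \<le> m'" using m by (auto simp: m'_def)
      have "t ^ m * nrm ((N ^^ m) h) = t ^ m' * (t ^ k0 * nrm ((N ^^ k0) ((N ^^ m') h)))"
        by (simp add: m'(1) funpow_add power_add)
      also have "\<dots> \<le> t ^ m' * (1/3 * nrm ((N ^^ m') h))"
        using t by (intro mult_left_mono k pow_closed h) auto
      also have "\<dots> = 1/3 * (t ^ m' * nrm ((N ^^ m') h))" by simp
      also have "\<dots> \<le> 1/3 * ((1/3) ^ i * nrm h)"
        using Suc.IH m'(2) h by (intro mult_left_mono) auto
      finally show "t ^ m * nrm ((N ^^ m) h) \<le> (1/3) ^ Suc i * nrm h" by simp
    qed
  qed
  show ?thesis unfolding pow_small_def
  proof (intro allI impI)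
    fix \<eta> :: real assume "\<eta> > 0"
    then obtain i where i: "(1/3::real) ^ i < \<eta>" using real_arch_pow_inv[of \<eta> "1/3"] by auto
    have "(1/3::real) ^ Suc i < \<eta>" by (rule order_le_less_trans[OF _ i]) simp
    then show "\<exists>k0. \<forall>m\<ge>k0. \<forall>h\<in>\<F>. t ^ m * nrm ((N ^^ m) h) \<le> \<eta> * nrm h"
      using *[of "Suc i"] nrm_nonneg
      by (intro exI[of _ "Suc i * k0"]) (smt (verit) mult_right_mono zero_less_Suc)
  qed
qed

text \<open>For \<open>m\<close>-th roots of unity \<open>z\<close>, the average of \<open>(1 - t z N)\<^sup>-\<^sup>1\<close> over \<open>z\<close> is
  \<open>(1 - t\<^sup>m N\<^sup>m)\<^sup>-\<^sup>1\<close>. A resolvent bound that is uniform on the disc makes this average Lipschitz in \<open>t\<close>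
  with a constant independent of \<open>m\<close>, so smallness of \<open>t\<^sup>m N\<^sup>m\<close> propagates over steps of a fixed length.\<close>

lemma pow_small_step:
  assumes rho: "op_spectral_radius M \<F> nrm N < ereal r" and r: "0 < r"
    and c: "c > 0" "\<And>h w. h \<in> \<F> \<Longrightarrow> cmod w * r \<le> 1 \<Longrightarrow> nrm h \<le> c * nrm (\<lambda>x. h x - w * N h x)"
    and D: "D > 0" "\<And>f. f \<in> \<F> \<Longrightarrow> nrm (N f) \<le> D * nrm f"
    and t: "0 \<le> t" "t * r \<le> 1" "0 \<le> t'" "t' * r \<le> 1" "c * c * D * \<bar>t' - t\<bar> \<le> 1/8"
    and small: "pow_small t"
  shows "pow_small t'"
proof -
  \<comment> \<open>The factor 1 / (8 c) is offset by the bound c * \<open>nrm g\<close> for the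
    averaged solution \<open>V\<close>, leaving 1/8.\<close>
  obtain k0 where k0: "\<And>m h. m \<ge> k0 \<Longrightarrow> h \<in> \<F> \<Longrightarrow> t ^ m * nrm ((N ^^ m) h) \<le> 1 / (8 * c) * nrm h"
    using small c(1) unfolding pow_small_def by (metis divide_pos_pos mult_pos_pos zero_less_numeral zero_less_one)
  show ?thesis
  proof (rule pow_smallI[OF _ t(3)])
    fix m h assume m: "m \<ge> Suc k0" and h: "h \<in> \<F>"
    have m0: "m > 0" using m by simp
    interpret P: fun_operator M \<F> nrm "N ^^ m" by unfold_locales (rule bounded_pow)
    define z where "z j = cis (2 * pi / real m) ^ j" for j
    have zm: "z j ^ m = 1" and cz: "cmod (z j) = 1" for j
      using cis_root_power[OF m0] by (auto simp: z_def norm_power)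
    \<comment> \<open>Since \<open>z j ^ m = 1\<close> for every j, the finite Neumann series at all
      the points t' z j solve their resolvent equations with one common right side g.\<close>
    define g where "g = (\<lambda>x. h x - of_real t' ^ m * (N ^^ m) h x)"
    have g: "g \<in> \<F>" unfolding g_def by (intro diff_closed scale_closed h P.op_closed)
    define u where "u j = geometric m (of_real t' * z j) h" for j
    have u: "u j \<in> \<F>" for j unfolding u_def by (rule geometric_closed[OF h])
    have ug: "ae_eq M (\<lambda>x. u j x - of_real t' * z j * N (u j) x) g" for j
      using geometric_right[OF h, of m "of_real t' * z j"]
      by (simp add: u_def g_def power_mult_distrib zm)
    \<comment> \<open>The same equations with t in place of t', solved by the resolvent. The
      difference u j - v j is driven by (t' - t) z j N (u j) and is therefore small.\<close>
    have "\<exists>v\<in>\<F>. ae_eq M (\<lambda>x. v x - of_real t * z j * N v x) g" for j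
      by (rule resolvent_exists[OF rho r, of "of_real t * z j"]) (use t cz g in \<open>auto simp: norm_mult\<close>)
    then obtain v where v: "\<And>j. v j \<in> \<F>" and vg: "\<And>j. ae_eq M (\<lambda>x. v j x - of_real t * z j * N (v j) x) g"
      by metis
    have nu: "nrm (u j) \<le> c * nrm g" for j
    proof -
      have "nrm (u j) \<le> c * nrm (\<lambda>x. u j x - of_real t' * z j * N (u j) x)"
        using t cz by (intro c u) (simp add: norm_mult)
      also have "nrm (\<lambda>x. u j x - of_real t' * z j * N (u j) x) = nrm g"
        by (intro nrm_cong diff_closed scale_closed op_closed u g ug)
      finally show ?thesis .
    qed
    have nv: "nrm (v j) \<le> c * nrm g" for j
    proof -
      have "nrm (v j) \<le> c * nrm (\<lambda>x. v j x - of_real t * z j * N (v j) x)"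
        using t cz by (intro c v) (simp add: norm_mult)
      also have "nrm (\<lambda>x. v j x - of_real t * z j * N (v j) x) = nrm g"
        by (intro nrm_cong diff_closed scale_closed op_closed v g vg)
      finally show ?thesis .
    qed
    have nuv: "nrm (\<lambda>x. u j x - v j x) \<le> 1/8 * nrm g" for j
    proof -
      let ?d = "\<lambda>x. u j x - v j x"
      have d: "?d \<in> \<F>" by (intro diff_closed u v)
      have "nrm ?d \<le> c * nrm (\<lambda>x. ?d x - of_real t * z j * N ?d x)"
        using t cz by (intro c d) (simp add: norm_mult)
      also have "nrm (\<lambda>x. ?d x - of_real t * z j * N ?d x) = nrm (\<lambda>x. (of_real (t' - t) * z j) * N (u j) x)"
      proof (intro nrm_cong diff_closed scale_closed op_closed d u v)
        show "ae_eq M (\<lambda>x. ?d x - of_real t * z j * N ?d x) (\<lambda>x. (of_real (t' - t) * z j) * N (u j) x)"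
          using op_diff[OF u v, of j j] ug[of j] vg[of j]
          by eventually_elim (simp, simp add: algebra_simps)
      qed
      also have "\<dots> = \<bar>t' - t\<bar> * nrm (N (u j))"
        by (subst nrm_scale) (auto simp: norm_mult cz op_closed u simp del: of_real_diff)
      also have "\<dots> \<le> \<bar>t' - t\<bar> * (D * (c * nrm g))"
        using D(1) by (intro mult_left_mono order_trans[OF D(2)[OF u] mult_left_mono[OF nu]]) auto
      also have "c * (\<bar>t' - t\<bar> * (D * (c * nrm g))) = (c * c * D * \<bar>t' - t\<bar>) * nrm g" by (simp add: mult_ac)
      also have "\<dots> \<le> 1/8 * nrm g" by (intro mult_right_mono t nrm_nonneg g)
      finally show ?thesis using c(1) by simp
    qed
    define V where "V = (\<lambda>x. \<Sum>j<m. 1 / of_nat m * v j x)"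
    have V: "V \<in> \<F>" unfolding V_def by (intro sum_closed scale_closed v)
    have hu: "h = (\<lambda>x. \<Sum>j<m. 1 / of_nat m * u j x)"
      using mean_geometric[OF m0, of "of_real t'" h] by (simp add: u_def z_def)
    have hV: "nrm (\<lambda>x. h x - V x) \<le> 1/8 * nrm g"
    proof -
      have eq: "(\<lambda>x. h x - V x) = (\<lambda>x. \<Sum>j<m. 1 / of_nat m * (u j x - v j x))"
        by (subst hu) (simp add: V_def sum_subtractf[symmetric] right_diff_distrib diff_divide_distrib)
      show ?thesis unfolding eq by (intro nrm_mean m0 diff_closed u v nuv)
    qed
    have nV: "nrm V \<le> c * nrm g" unfolding V_def by (intro nrm_mean m0 v nv)
    have "ae_eq M ((N ^^ m) V) (\<lambda>x. \<Sum>j<m. 1 / of_nat m * (N ^^ m) (v j) x)"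
      unfolding V_def by (intro P.op_sum v)
    moreover have "AE x in M. \<forall>j\<in>{..<m}. v j x - of_real t ^ m * (N ^^ m) (v j) x = geometric m (of_real t * z j) g x"
      using geometric_left[OF v g vg, of _ m]
      by (intro AE_finite_allI) (simp_all add: power_mult_distrib zm)
    ultimately have VG: "ae_eq M (\<lambda>x. V x - g x) (\<lambda>x. of_real t ^ m * (N ^^ m) V x)"
    proof eventually_elim
      case (elim x)
      have "g x = (\<Sum>j<m. 1 / of_nat m * geometric m (of_real t * z j) g x)"
        using mean_geometric[OF m0, of "of_real t" g x] by (simp add: z_def)
      also have "\<dots> = (\<Sum>j<m. 1 / of_nat m * (v j x - of_real t ^ m * (N ^^ m) (v j) x))"
        using elim(2) by (intro sum.cong) auto
      also have "\<dots> = V x - of_real t ^ m * (\<Sum>j<m. 1 / of_nat m * (N ^^ m) (v j) x)"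
        by (simp add: V_def right_diff_distrib sum_subtractf sum_distrib_left diff_divide_distrib mult_ac)
      finally show ?case using elim(1) by simp
    qed
    have "nrm (\<lambda>x. V x - g x) = nrm (\<lambda>x. of_real t ^ m * (N ^^ m) V x)"
      by (intro nrm_cong diff_closed scale_closed V g P.op_closed VG)
    also have "\<dots> = t ^ m * nrm ((N ^^ m) V)" using t(1) by (subst nrm_scale) (auto simp: P.op_closed V norm_power)
    also have "\<dots> \<le> 1 / (8 * c) * nrm V" using m by (intro k0 V) simp
    also have "\<dots> \<le> 1 / (8 * c) * (c * nrm g)" using c(1) by (intro mult_left_mono nV) auto
    finally have Vg: "nrm (\<lambda>x. V x - g x) \<le> 1/8 * nrm g" using c(1) by simp
    \<comment> \<open>The two errors of 1/8 add up. Then \<open>nrm g\<close> is at most 4/3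
      \<open>nrm h\<close>, so 1/4 becomes 1/3, the factor that \<open>pow_smallI\<close> asks for;
      and h - g is t'^m N^m h.\<close>
    have "nrm (\<lambda>x. h x - g x) \<le> 1/4 * nrm g"
      using nrm_triangle3[OF h V g] hV Vg by linarith
    moreover have "nrm g \<le> nrm h + nrm (\<lambda>x. h x - g x)"
      using nrm_triangle_sub[OF g h] nrm_diff_commute[OF g h] by simp
    ultimately have "nrm (\<lambda>x. h x - g x) \<le> 1/3 * nrm h" by simp
    moreover have "nrm (\<lambda>x. h x - g x) = t' ^ m * nrm ((N ^^ m) h)"
      using t(3) nrm_scale[OF P.op_closed[OF h], of "of_real t' ^ m"] by (simp add: g_def norm_power)
    ultimately show "t' ^ m * nrm ((N ^^ m) h) \<le> 1/3 * nrm h" by simp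
  qed
qed

text \<open>Smallness is trivial at t = 0 and is carried to t = 1 / r by finitely many steps of one
  length, as the resolvent constant is the same on the whole disc. At t = 1 / r it bounds the powers
  of N by r^m for all large m.\<close>

lemma spectral_radius_power_bound:
  assumes rho: "op_spectral_radius M \<F> nrm N < ereal r" and r: "0 < r"
  obtains C where "C > 0" "\<And>h m. h \<in> \<F> \<Longrightarrow> nrm ((N ^^ m) h) \<le> C * r ^ m * nrm h"
proof -
  obtain D where D: "D > 0" "\<And>f. f \<in> \<F> \<Longrightarrow> nrm (N f) \<le> D * nrm f" using op_bound by blast
  obtain c where c: "c > 0" "\<And>h w. h \<in> \<F> \<Longrightarrow> cmod w * r \<le> 1 \<Longrightarrow> nrm h \<le> c * nrm (\<lambda>x. h x - w * N h x)"
    using resolvent_uniform_bound[OF rho r] by blast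
  \<comment> \<open>Makes c c D \<delta> = 1/8, the largest step that \<open>pow_small_step\<close>
    admits.\<close>
  define \<delta> where "\<delta> = 1 / (8 * c * c * D)"
  have \<delta>: "\<delta> > 0" using c(1) D(1) by (simp add: \<delta>_def)
  have "pow_small (min (real i * \<delta>) (1 / r))" for i
  proof (induction i)
    case 0
    have "pow_small 0" by (rule pow_smallI[of 1]) (auto simp: nrm_nonneg power_0_left)
    then show ?case using r by simp
  next
    case (Suc i)
    let ?t = "min (real i * \<delta>) (1 / r)" and ?t' = "min (real (Suc i) * \<delta>) (1 / r)"
    have d: "\<bar>?t' - ?t\<bar> \<le> \<delta>" using \<delta> r by (auto simp: min_def algebra_simps)
    have "c * c * D * \<bar>?t' - ?t\<bar> \<le> c * c * D * \<delta>" using c(1) D(1) d by (intro mult_left_mono) auto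
    also have "\<dots> = 1/8" using c(1) D(1) by (simp add: \<delta>_def)
    finally have "c * c * D * \<bar>?t' - ?t\<bar> \<le> 1/8" .
    moreover have "?t * r \<le> 1" "?t' * r \<le> 1" "0 \<le> ?t" "0 \<le> ?t'"
      using r \<delta> by (auto simp: min_def field_simps)
    ultimately show ?case using pow_small_step[OF rho r c D _ _ _ _ _ Suc] by blast
  qed
  moreover obtain i where "1 / r < real i * \<delta>" using ex_less_of_nat_mult[OF \<delta>] by blast
  ultimately have "pow_small (1 / r)" by (metis min.absorb2 less_imp_le)
  then obtain k0 where k0: "\<And>m h. m \<ge> k0 \<Longrightarrow> h \<in> \<F> \<Longrightarrow> (1 / r) ^ m * nrm ((N ^^ m) h) \<le> 1 * nrm h"
    unfolding pow_small_def by (metis zero_less_one)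
  have DD: "nrm ((N ^^ m) h) \<le> D ^ m * nrm h" if "h \<in> \<F>" for m h
  proof (induction m)
    case (Suc m)
    have "nrm (N ((N ^^ m) h)) \<le> D * nrm ((N ^^ m) h)" by (intro D pow_closed that)
    also have "\<dots> \<le> D * (D ^ m * nrm h)" using D(1) Suc by (intro mult_left_mono) auto
    finally show ?case by (simp add: mult.assoc)
  qed simp
  \<comment> \<open>Covers the finitely many m < k0, for which only the crude bound D^m is at
    hand.\<close>
  define C where "C = 1 + (\<Sum>m<k0. (D / r) ^ m)"
  have s: "0 \<le> (\<Sum>m<k0. (D / r) ^ m)" using D(1) r by (intro sum_nonneg) auto
  show thesis
  proof (rule that[of C])
    show "C > 0" using s by (simp add: C_def)
    fix h m assume h: "h \<in> \<F>"
    have "nrm ((N ^^ m) h) \<le> r ^ m * (C * nrm h)"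
    proof (cases "m \<ge> k0")
      case True
      then have "nrm ((N ^^ m) h) \<le> r ^ m * nrm h"
        using k0[OF True h] r by (simp add: power_one_over field_simps)
      also have "\<dots> \<le> r ^ m * (C * nrm h)"
        using r s nrm_nonneg[OF h] by (intro mult_left_mono) (auto simp: C_def distrib_right)
      finally show ?thesis .
    next
      case False
      have "(D / r) ^ m \<le> (\<Sum>m<k0. (D / r) ^ m)"
        using False D(1) r by (intro member_le_sum) auto
      then have "(D / r) ^ m \<le> C" by (simp add: C_def)
      then have "D ^ m \<le> r ^ m * C" using r by (simp add: power_divide field_simps)
      then have "D ^ m * nrm h \<le> r ^ m * C * nrm h" by (intro mult_right_mono nrm_nonneg h)
      then show ?thesis using DD[OF h, of m] by (simp add: mult.assoc)
    qed
    then show "nrm ((N ^^ m) h) \<le> C * r ^ m * nrm h" by (simp add: mult_ac)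
  qed
qed

end

section \<open>The transfer operator and its spectral gap\<close>

lemma L_infty_bounded:
  assumes "g \<in> borel_measurable M" "AE x in M. cmod (g x) \<le> C"
  shows "g \<in> L_infty M"
proof -
  have "esssup M (\<lambda>x. ereal (cmod (g x))) \<le> ereal C"
    by (rule esssup_I) (use assms in auto)
  then have "L_infty_norm M g < \<infinity>"
    unfolding L_infty_norm_def by (rule order_le_less_trans) simp
  then show ?thesis using assms(1) by (simp add: L_infty_def)
qed

lemma AE_le_L_infty_norm: "g \<in> borel_measurable M \<Longrightarrow> AE x in M. ereal (cmod (g x)) \<le> L_infty_norm M g"
  unfolding L_infty_norm_def by (rule esssup_AE)

lemma L_infty_AE_bound:
  assumes "g \<in> L_infty M"
  obtains C where "AE x in M. cmod (g x) \<le> C"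
proof -
  have g: "g \<in> borel_measurable M" "L_infty_norm M g < \<infinity>" using assms by (auto simp: L_infty_def)
  obtain C where C: "L_infty_norm M g \<le> ereal C"
    using g(2) by (cases "L_infty_norm M g") auto
  have "AE x in M. cmod (g x) \<le> C"
    using AE_le_L_infty_norm[OF g(1)] by eventually_elim (use C in \<open>metis ereal_less_eq(3) order_trans\<close>)
  then show thesis by (rule that)
qed

lemma integrable_mult_L_infty:
  fixes h :: "'a \<Rightarrow> complex"
  assumes "integrable M h" "g \<in> L_infty M"
  shows "integrable M (\<lambda>x. h x * g x)"
proof -
  obtain C where C: "AE x in M. cmod (g x) \<le> C" by (rule L_infty_AE_bound[OF assms(2)])
  have [measurable]: "g \<in> borel_measurable M" "h \<in> borel_measurable M" using assms by (auto simp: L_infty_def)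
  show ?thesis
  proof (rule Bochner_Integration.integrable_bound)
    show "integrable M (\<lambda>x. C * norm (h x))" using assms(1) by simp
    show "AE x in M. norm (h x * g x) \<le> norm (C * norm (h x))"
      using C
    proof eventually_elim
      case (elim x)
      have "norm (h x) * norm (g x) \<le> norm (h x) * \<bar>C\<bar>" using elim by (intro mult_left_mono) auto
      then show ?case by (simp add: norm_mult abs_mult mult.commute)
    qed
  qed simp
qed

text \<open>Testing against \<open>cnj (sgn h)\<close> turns \<open>is_transfer\<close> into a statement about the L1 norm of \<open>h\<close>.\<close>

lemma L_infty_cnj_sgn:
  fixes h :: "'a \<Rightarrow> complex"
  assumes [measurable]: "h \<in> borel_measurable M"
  shows "(\<lambda>x. cnj (sgn (h x))) \<in> L_infty M"
proof (rule L_infty_bounded[where C = 1])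
  have [measurable]: "cnj \<in> borel_measurable borel"
    by (intro borel_measurable_continuous_onI continuous_intros)
  have "(\<lambda>x. cnj (h x /\<^sub>R norm (h x))) \<in> borel_measurable M" by measurable
  then show "(\<lambda>x. cnj (sgn (h x))) \<in> borel_measurable M" by (simp only: sgn_div_norm)
qed (auto simp: norm_sgn)

lemma mult_cnj_sgn: "(z::complex) * cnj (sgn z) = of_real (cmod z)"
  by (simp add: sgn_eq complex_norm_square[symmetric] power2_eq_square)

lemma integral_cmod_eq:
  fixes h :: "'a \<Rightarrow> complex"
  shows "of_real (LINT x|M. cmod (h x)) = (LINT x|M. h x * cnj (sgn (h x)))"
  by (simp add: mult_cnj_sgn)

section \<open>The transfer operator of a measure preserving map\<close>

locale mpt = prob_space +
  fixes T :: "'a \<Rightarrow> 'a"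
  assumes T_measurable [measurable]: "T \<in> measurable M M" and T_distr: "distr M M T = M"
begin

lemma L_infty_compose:
  assumes "g \<in> L_infty M"
  shows "(\<lambda>x. g (T x)) \<in> L_infty M"
proof -
  obtain C where C: "AE x in M. cmod (g x) \<le> C" by (rule L_infty_AE_bound[OF assms])
  have [measurable]: "g \<in> borel_measurable M" using assms by (auto simp: L_infty_def)
  have "AE x in distr M M T. cmod (g x) \<le> C" using C unfolding T_distr .
  then have "AE x in M. cmod (g (T x)) \<le> C" by (subst (asm) AE_distr_iff) auto
  then show ?thesis by (intro L_infty_bounded) auto
qed

text \<open>h is the density, with respect to M, of the image under T of the measure with density u;
  invariance of M gives absolute continuity. The identity covers every measurable g, both integrals
  taking the default value 0 together.\<close>

lemma transfer_real_exists:
  fixes u :: "'a \<Rightarrow> real"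
  assumes u: "integrable M u" "\<And>x. u x \<ge> 0"
  obtains h :: "'a \<Rightarrow> real" where "integrable M h"
    "\<And>g :: 'a \<Rightarrow> complex. g \<in> borel_measurable M \<Longrightarrow>
      (LINT x|M. of_real (h x) * g x) = (LINT x|M. of_real (u x) * g (T x))"
proof -
  have [measurable]: "u \<in> borel_measurable M" using u by auto
  define \<nu> where "\<nu> = distr (density M (\<lambda>x. ennreal (u x))) M T"
  have sets: "sets \<nu> = sets M" by (simp add: \<nu>_def)
  have "absolutely_continuous M \<nu>"
    unfolding absolutely_continuous_def
  proof
    fix A assume "A \<in> null_sets M"
    then have A[measurable]: "A \<in> sets M" and z: "AE x in M. x \<notin> A"
      by (auto intro: AE_not_in)
    have "AE x in distr M M T. x \<notin> A" using z unfolding T_distr .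
    then have "AE x in M. T x \<notin> A" by (subst (asm) AE_distr_iff) auto
    then have "AE x in density M (\<lambda>x. ennreal (u x)). T x \<notin> A" by (subst AE_density) auto
    then have "AE x in \<nu>. x \<notin> A" unfolding \<nu>_def by (subst AE_distr_iff) auto
    then show "A \<in> null_sets \<nu>" using AE_iff_null_sets[of A \<nu>] A sets by auto
  qed
  then obtain H where H[measurable]: "H \<in> borel_measurable M" and eq: "density M H = \<nu>"
    using Radon_Nikodym[OF _ sets] by blast
  \<comment> \<open>\<open>enn2real\<close> sends infinity to 0, a change on a null set only, since
    \<open>H\<close> has finite integral.\<close>
  define h where "h x = enn2real (H x)" for x
  have [measurable]: "h \<in> borel_measurable M" unfolding h_def by measurable
  have "(\<integral>\<^sup>+x. H x \<partial>M) = emeasure \<nu> (space M)"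
    by (subst eq[symmetric]) (simp add: emeasure_density)
  also have "\<dots> = (\<integral>\<^sup>+x. ennreal (u x) \<partial>M)"
    using measurable_space[OF T_measurable]
    by (auto simp: \<nu>_def emeasure_distr emeasure_density indicator_def cong: nn_integral_cong intro!: nn_integral_cong)
  also have "\<dots> < \<infinity>" using u by (simp add: integrable_iff_bounded)
  finally have fin: "(\<integral>\<^sup>+x. H x \<partial>M) < \<infinity>" .
  then have "AE x in M. H x \<noteq> \<infinity>" by (intro nn_integral_noteq_infinite) auto
  then have Hh: "AE x in M. H x = ennreal (h x)"
    by eventually_elim (simp add: h_def top.not_eq_extremum)
  have hint: "integrable M h"
  proof (rule integrableI_nonneg)
    have "(\<integral>\<^sup>+x. ennreal (h x) \<partial>M) = (\<integral>\<^sup>+x. H x \<partial>M)"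
      using Hh by (intro nn_integral_cong_AE) auto
    then show "(\<integral>\<^sup>+x. ennreal (h x) \<partial>M) < \<infinity>" using fin by simp
  qed (auto simp: h_def)
  have "density M (\<lambda>x. ennreal (h x)) = density M H"
    using Hh by (intro density_cong) auto
  then have eq': "density M (\<lambda>x. ennreal (h x)) = \<nu>" using eq by simp
  show thesis
  proof (rule that[OF hint])
    fix g :: "'a \<Rightarrow> complex" assume [measurable]: "g \<in> borel_measurable M"
    have "(LINT x|M. of_real (h x) * g x) = (LINT x|density M (\<lambda>x. ennreal (h x)). g x)"
      by (subst integral_density) (auto simp: h_def scaleR_conv_of_real)
    also have "\<dots> = (LINT x|density M (\<lambda>x. ennreal (u x)). g (T x))"
      unfolding eq' \<nu>_def by (subst integral_distr) auto
    also have "\<dots> = (LINT x|M. of_real (u x) * g (T x))"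
      using u by (subst integral_density) (auto simp: scaleR_conv_of_real)
    finally show "(LINT x|M. of_real (h x) * g x) = (LINT x|M. of_real (u x) * g (T x))" .
  qed
qed

lemma is_transfer_lincomb:
  assumes "is_transfer M T f h" "is_transfer M T f' h'" "integrable M f" "integrable M f'"
  shows "is_transfer M T (\<lambda>x. f x + c * f' x) (\<lambda>x. h x + c * h' x)"
  unfolding is_transfer_def
proof (intro conjI ballI)
  have h: "integrable M h" "integrable M h'" using assms by (auto simp: is_transfer_def)
  then show "integrable M (\<lambda>x. h x + c * h' x)" by auto
  fix g assume g: "g \<in> L_infty M"
  note [simp] = integrable_mult_L_infty[OF h(1) g] integrable_mult_L_infty[OF h(2) g]
    integrable_mult_L_infty[OF assms(3) L_infty_compose[OF g]]
    integrable_mult_L_infty[OF assms(4) L_infty_compose[OF g]]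
  show "(LINT x|M. (h x + c * h' x) * g x) = (LINT x|M. (f x + c * f' x) * g (T x))"
    using assms(1,2) g by (simp add: is_transfer_def distrib_right mult.assoc)
qed

lemma transfer_exists:
  fixes f :: "'a \<Rightarrow> complex"
  assumes f: "integrable M f"
  shows "\<exists>h. is_transfer M T f h"
proof -
  have real: "\<exists>h. is_transfer M T (\<lambda>x. of_real (u x)) h"
    if u: "integrable M u" "\<And>x. u x \<ge> 0" for u :: "'a \<Rightarrow> real"
  proof -
    obtain h :: "'a \<Rightarrow> real" where h: "integrable M h" "\<And>g :: 'a \<Rightarrow> complex. g \<in> borel_measurable M \<Longrightarrow>
      (LINT x|M. of_real (h x) * g x) = (LINT x|M. of_real (u x) * g (T x))"
      using transfer_real_exists[OF u] by blast
    show ?thesis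
      by (rule exI[of _ "\<lambda>x. of_real (h x)"]) (use h in \<open>auto simp: is_transfer_def L_infty_def\<close>)
  qed
  define u where "u = [\<lambda>x. max 0 (Re (f x)), \<lambda>x. max 0 (- Re (f x)), \<lambda>x. max 0 (Im (f x)), \<lambda>x. max 0 (- Im (f x))]"
  have int: "integrable M (u ! i)" "\<And>x. (u ! i) x \<ge> 0" if "i < 4" for i
    using that f by (auto simp: u_def less_Suc_eq numeral_eq_Suc intro!: integrable_max)
  have "\<exists>h. \<forall>i<4. is_transfer M T (\<lambda>x. of_real ((u ! i) x)) (h i)"
    using real[OF int] by metis
  then obtain h where h: "\<And>i. i < 4 \<Longrightarrow> is_transfer M T (\<lambda>x. of_real ((u ! i) x)) (h i)" by blast
  have int': "integrable M (\<lambda>x. complex_of_real ((u ! i) x))" if "i < 4" for i using int[OF that] by simp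
  have t: "is_transfer M T (\<lambda>x. ((of_real ((u ! 0) x) + (-1) * of_real ((u ! 1) x)) + \<i> * of_real ((u ! 2) x)) + (-\<i>) * of_real ((u ! 3) x))
     (\<lambda>x. ((h 0 x + (-1) * h 1 x) + \<i> * h 2 x) + (-\<i>) * h 3 x)"
    by (intro is_transfer_lincomb h Bochner_Integration.integrable_add integrable_mult_right int') auto
  have "(\<lambda>x. ((of_real ((u ! 0) x) + (-1) * of_real ((u ! 1) x)) + \<i> * of_real ((u ! 2) x)) + (-\<i>) * of_real ((u ! 3) x)) = f"
    by (auto simp: u_def numeral_eq_Suc fun_eq_iff complex_eq_iff max_def)
  with t show ?thesis by auto
qed

lemma is_transfer_transfer_op: "integrable M f \<Longrightarrow> is_transfer M T f (transfer_op M T f)"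
  unfolding transfer_op_def using transfer_exists by (rule someI_ex)

lemma one_L_infty: "(\<lambda>x. 1) \<in> L_infty M"
  by (rule L_infty_bounded[of _ _ 1]) auto

lemma is_transfer_integral: "is_transfer M T f h \<Longrightarrow> (LINT x|M. h x) = (LINT x|M. f x)"
  using one_L_infty unfolding is_transfer_def by fastforce

text \<open>An L1 contraction confines eigenvalues with integrable eigenfunctions to the closed unit
  disc; this is what gives |ev| <= 1 for the leading eigenvalue of the spectral gap.\<close>

lemma is_transfer_L1:
  assumes "is_transfer M T f h" "integrable M f"
  shows "(LINT x|M. cmod (h x)) \<le> (LINT x|M. cmod (f x))"
proof -
  have h[measurable]: "integrable M h" "h \<in> borel_measurable M" using assms by (auto simp: is_transfer_def)
  let ?g = "\<lambda>x. cnj (sgn (h x))"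
  have g: "?g \<in> L_infty M" by (rule L_infty_cnj_sgn) measurable
  have "complex_of_real (LINT x|M. cmod (h x)) = (LINT x|M. f x * ?g (T x))"
    unfolding integral_cmod_eq
    using assms(1)[unfolded is_transfer_def, THEN conjunct2, THEN bspec, OF g] .
  then have "\<bar>LINT x|M. cmod (h x)\<bar> = cmod (LINT x|M. f x * ?g (T x))" by (metis norm_of_real real_norm_def)
  also have "\<dots> \<le> (LINT x|M. cmod (f x * ?g (T x)))" by (rule integral_norm_bound)
  also have "\<dots> \<le> (LINT x|M. cmod (f x))"
    using assms(2) integrable_mult_L_infty[OF assms(2) L_infty_compose[OF g]]
    by (intro integral_mono integrable_norm) (auto simp: norm_mult norm_sgn mult_left_le)
  finally show ?thesis by simp
qed

lemma is_transfer_unique: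
  assumes "is_transfer M T f h" "is_transfer M T f h'"
  shows "ae_eq M h h'"
proof -
  have h[measurable]: "integrable M h" "integrable M h'" using assms by (auto simp: is_transfer_def)
  let ?d = "\<lambda>x. h x - h' x"
  have g: "(\<lambda>x. cnj (sgn (?d x))) \<in> L_infty M" using h by (intro L_infty_cnj_sgn) auto
  have "complex_of_real (LINT x|M. cmod (?d x)) = (LINT x|M. h x * cnj (sgn (?d x))) - (LINT x|M. h' x * cnj (sgn (?d x)))"
    unfolding integral_cmod_eq left_diff_distrib
    by (rule Bochner_Integration.integral_diff) (rule integrable_mult_L_infty[OF _ g], rule h)+
  also have "\<dots> = 0" using assms g unfolding is_transfer_def by auto
  finally have "(LINT x|M. cmod (?d x)) = 0" by simp
  then have "AE x in M. cmod (?d x) = 0"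
    using h by (subst (asm) integral_nonneg_eq_0_iff_AE) auto
  then show ?thesis by eventually_elim simp
qed

lemma is_transfer_one: "is_transfer M T (\<lambda>x. 1) (\<lambda>x. 1)"
  unfolding is_transfer_def
proof (intro conjI ballI)
  fix g assume "g \<in> L_infty M"
  then have [measurable]: "g \<in> borel_measurable M" by (simp add: L_infty_def)
  have "(LINT x|distr M M T. g x) = (LINT x|M. g (T x))" by (rule integral_distr) auto
  then show "(LINT x|M. 1 * g x) = (LINT x|M. 1 * g (T x))" by (simp add: T_distr)
qed simp

end

section \<open>The spectral gap in explicit form\<close>

locale gap_system =
  fixes M :: "'a measure" and T :: "'a \<Rightarrow> 'a" and \<F> :: "('a \<Rightarrow> complex) set" and nrm :: "('a \<Rightarrow> complex) \<Rightarrow> real"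
  assumes propC: "property_C M T \<F> nrm"

sublocale gap_system \<subseteq> mpt M T
proof -
  interpret prob_space M using propC by (auto simp: property_C_def invariant_prob_def)
  show "mpt M T" using propC by unfold_locales (auto simp: property_C_def invariant_prob_def)
qed

sublocale gap_system \<subseteq> fun_operator M \<F> nrm "transfer_op M T"
  using propC by unfold_locales (auto simp: property_C_def spectral_gap_def)

context gap_system
begin

lemma const_closed: "(\<lambda>x. c) \<in> \<F>"
  using propC by (auto simp: property_C_def)

lemma AE_le_nrm:
  assumes "f \<in> \<F>"
  shows "AE x in M. cmod (f x) \<le> nrm f"
proof -
  have "L_infty_norm M f \<le> ereal (nrm f)" using propC assms by (auto simp: property_C_def)
  then show ?thesis using AE_le_L_infty_norm[OF borel[OF assms]]
    by (auto elim!: eventually_mono dest: order_trans)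
qed

lemma closed_L_infty: "f \<in> \<F> \<Longrightarrow> f \<in> L_infty M"
  by (rule L_infty_bounded[OF borel AE_le_nrm])

lemma closed_integrable: "f \<in> \<F> \<Longrightarrow> integrable M f"
  by (rule integrable_const_bound[OF AE_le_nrm borel])

lemma integral_le_nrm:
  assumes "f \<in> \<F>"
  shows "cmod (LINT x|M. f x) \<le> nrm f"
proof -
  have "cmod (LINT x|M. f x) \<le> (LINT x|M. cmod (f x))" by (rule integral_norm_bound)
  also have "\<dots> \<le> (LINT x|M. nrm f)"
    using AE_le_nrm[OF assms] closed_integrable[OF assms] by (intro integral_mono_AE) auto
  finally show ?thesis by (simp add: prob_space)
qed

lemma transfer_closed: "f \<in> \<F> \<Longrightarrow> is_transfer M T f (transfer_op M T f)"
  by (intro is_transfer_transfer_op closed_integrable)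

lemma integral_transfer: "f \<in> \<F> \<Longrightarrow> (LINT x|M. transfer_op M T f x) = (LINT x|M. f x)"
  by (intro is_transfer_integral transfer_closed)

lemma transfer_op_one: "ae_eq M (transfer_op M T (\<lambda>x. 1)) (\<lambda>x. 1)"
  by (intro is_transfer_unique[OF transfer_closed is_transfer_one] const_closed)

lemma not_ae_one_zero: "\<not> ae_eq M (\<lambda>x. 1) (\<lambda>x. 0)"
proof
  assume "ae_eq M (\<lambda>x. 1) (\<lambda>x. 0)"
  then have "AE x in M. False" by eventually_elim simp
  then show False by simp
qed

text \<open>The abstract decomposition ev P + N is made explicit: ev = 1, and P f is the constant
  whose value is the integral of f. This comes from two invariances, of the constant 1 and of the
  integral, combined with the decay of the powers of N, which excludes nonzero fixed points of N and
  makes its range have integral 0.\<close>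

lemma transfer_decomposition:
  obtains N C r where "bounded_op M \<F> nrm N"
    "\<And>f. f \<in> \<F> \<Longrightarrow> ae_eq M (transfer_op M T f) (\<lambda>x. (LINT x|M. f x) + N f x)"
    "ae_eq M (N (\<lambda>x. 1)) (\<lambda>x. 0)" "0 < r" "r < 1" "0 < C"
    "\<And>f k. f \<in> \<F> \<Longrightarrow> nrm ((N ^^ k) f) \<le> C * r ^ k * nrm f"
proof -
  let ?U = "transfer_op M T"
  obtain ev P N where P: "bounded_op M \<F> nrm P" and N: "bounded_op M \<F> nrm N"
    and U: "\<And>f. f \<in> \<F> \<Longrightarrow> ae_eq M (?U f) (\<lambda>x. ev * P f x + N f x)"
    and PP: "\<And>f. f \<in> \<F> \<Longrightarrow> ae_eq M (P (P f)) (P f)" and dim: "image_dim_one M \<F> P"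
    and rho: "op_spectral_radius M \<F> nrm N < ereal (cmod ev)"
    and PN: "\<And>f. f \<in> \<F> \<Longrightarrow> ae_eq M (P (N f)) (\<lambda>x. 0)"
    and NP: "\<And>f. f \<in> \<F> \<Longrightarrow> ae_eq M (N (P f)) (\<lambda>x. 0)"
    using propC unfolding property_C_def spectral_gap_def by blast
  interpret P: fun_operator M \<F> nrm P by unfold_locales (rule P)
  interpret N: fun_operator M \<F> nrm N by unfold_locales (rule N)
  obtain f0 where f0: "f0 \<in> \<F>" "\<not> ae_eq M (P f0) (\<lambda>x. 0)"
    and dim: "\<And>f. f \<in> \<F> \<Longrightarrow> \<exists>c. ae_eq M (P f) (\<lambda>x. c * P f0 x)"
    using dim unfolding image_dim_one_def by blast
  define e where "e = P f0"
  have e: "e \<in> \<F>" unfolding e_def by (rule P.op_closed[OF f0(1)])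
  \<comment> \<open>e lies in the image of P, so P e = e and N e = 0.\<close>
  have "ae_eq M (?U e) (\<lambda>x. ev * e x)"
    using U[OF e] PP[OF f0(1)] NP[OF f0(1)] unfolding e_def by eventually_elim simp
  then have "(LINT x|M. cmod (?U e x)) = (LINT x|M. cmod ev * cmod (e x))"
    using borel[OF e] borel[OF op_closed[OF e]] by (intro integral_cong_AE) (auto simp: norm_mult)
  then have "cmod ev * (LINT x|M. cmod (e x)) \<le> 1 * (LINT x|M. cmod (e x))"
    using is_transfer_L1[OF transfer_closed[OF e] closed_integrable[OF e]] by simp
  moreover have "(LINT x|M. cmod (e x)) \<noteq> 0"
    using f0(2) closed_integrable[OF e] by (subst integral_nonneg_eq_0_iff_AE) (auto simp: e_def)
  then have "(LINT x|M. cmod (e x)) > 0" by (simp add: order_less_le)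
  ultimately have "cmod ev \<le> 1" by simp
  \<comment> \<open>The maximum with 0 yields r > 0 even when the radius is 0, or is -infinity as
    the supremum over an empty spectrum.\<close>
  then have "max (op_spectral_radius M \<F> nrm N) 0 < 1"
    using rho by (auto simp: max_def intro: order_less_le_trans simp flip: one_ereal_def)
  then obtain r' where r': "max (op_spectral_radius M \<F> nrm N) 0 < ereal r'" "ereal r' < 1"
    using ereal_dense2 by blast
  define r where "r = r'"
  have r: "op_spectral_radius M \<F> nrm N < ereal r" "0 < r" "r < 1"
    using r' by (auto simp: r_def)
  obtain C where C: "C > 0" "\<And>f k. f \<in> \<F> \<Longrightarrow> nrm ((N ^^ k) f) \<le> C * r ^ k * nrm f"
    using N.spectral_radius_power_bound[OF r(1,2)] by metis
  have fixed_zero: "ae_eq M h (\<lambda>x. 0)" if h: "h \<in> \<F>" "ae_eq M (N h) h" for h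
  proof -
    have "ae_eq M ((N ^^ k) h) h" for k
    proof (induction k)
      case (Suc k)
      have "ae_eq M (N ((N ^^ k) h)) (N h)" by (intro N.op_cong N.pow_closed h Suc)
      with h(2) show ?case unfolding funpow.simps o_def by eventually_elim simp
    qed simp
    then have *: "nrm h = nrm ((N ^^ k) h)" for k
      by (intro nrm_cong[symmetric] N.pow_closed h)
    have "(\<lambda>k. C * r ^ k * nrm h) \<longlonglongrightarrow> C * 0 * nrm h"
      using r by (intro tendsto_intros LIMSEQ_realpow_zero) auto
    moreover have "\<forall>k. nrm h \<le> C * r ^ k * nrm h" using C(2)[OF h(1)] * by metis
    ultimately have "nrm h \<le> 0" by (intro LIMSEQ_le_const) auto
    then show ?thesis using nrm_nonneg[OF h(1)] nrm_eq_0[OF h(1)] by simp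
  qed
  let ?o = "\<lambda>x::'a. 1::complex"
  note o = const_closed[of 1] and op = P.op_closed[OF const_closed[of 1]] and on = N.op_closed[OF const_closed[of 1]]
  have P1: "\<not> ae_eq M (P ?o) (\<lambda>x. 0)"
  proof
    assume "ae_eq M (P ?o) (\<lambda>x. 0)"
    then have "ae_eq M (N ?o) ?o" using U[OF o] transfer_op_one by eventually_elim simp
    then show False using fixed_zero[OF o] not_ae_one_zero by blast
  qed
  have "ev = 1"
  proof -
    \<comment> \<open>P applied to 1 = ev P 1 + N 1 gives P 1 = ev P 1, by P P = P and P N =
      0.\<close>
    have "ae_eq M (P ?o) (P (\<lambda>x. ev * P ?o x + N ?o x))"
      by (intro P.op_cong o add_closed scale_closed op on)
         (use U[OF o] transfer_op_one in eventually_elim, simp)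
    moreover note P.op_add[OF scale_closed[OF op] on, of ev] P.op_scale[OF op, of ev] PP[OF o] PN[OF o]
    ultimately have "AE x in M. (1 - ev) * P ?o x = 0"
      by eventually_elim (simp add: algebra_simps)
    then show ?thesis using P1 by auto
  qed
  have N1': "ae_eq M (N ?o) (\<lambda>x. 1 - P ?o x)"
    using U[OF o] transfer_op_one by eventually_elim (simp add: \<open>ev = 1\<close> eq_diff_eq add.commute)
  \<comment> \<open>N 1 = 1 - P 1 and N P = 0 give N (N 1) = N 1, a fixed point.\<close>
  have N1: "ae_eq M (N ?o) (\<lambda>x. 0)"
  proof (rule fixed_zero[OF on])
    have "ae_eq M (N (N ?o)) (N (\<lambda>x. 1 - P ?o x))"
      by (intro N.op_cong on diff_closed o op N1')
    with N.op_diff[OF o op] NP[OF o] show "ae_eq M (N (N ?o)) (N ?o)"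
      by eventually_elim simp
  qed
  have P1': "ae_eq M (P ?o) ?o"
    using N1 N1' by eventually_elim simp
  obtain c1 where c1: "ae_eq M (P ?o) (\<lambda>x. c1 * e x)" using dim[OF o] unfolding e_def by blast
  have "c1 \<noteq> 0" using c1 P1 by auto
  \<comment> \<open>1 = P 1 lies in the one-dimensional image, so that image consists of
    constants.\<close>
  have Pc: "\<exists>c. ae_eq M (P f) (\<lambda>x. c)" if f: "f \<in> \<F>" for f
  proof -
    obtain c where c: "ae_eq M (P f) (\<lambda>x. c * e x)" using dim[OF f] unfolding e_def by blast
    have "ae_eq M (P f) (\<lambda>x. c / c1)"
      using c c1 P1' by eventually_elim (use \<open>c1 \<noteq> 0\<close> in \<open>auto simp: field_simps\<close>)
    then show ?thesis by blast
  qed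
  \<comment> \<open>On the range of N the transfer operator acts as N, by P N = 0, and it preserves
    integrals. So all N^k f with k >= 1 have the same integral, while their norms tend to 0.\<close>
  have intN: "(LINT x|M. N f x) = 0" if f: "f \<in> \<F>" for f
  proof -
    have *: "(LINT x|M. N f x) = (LINT x|M. (N ^^ Suc k) f x)" for k
    proof (induction k)
      case (Suc k)
      let ?h = "(N ^^ Suc k) f"
      have h: "?h \<in> \<F>" by (rule N.pow_closed[OF f])
      have "ae_eq M (P ?h) (\<lambda>x. 0)" using PN[OF N.pow_closed[OF f, of k]] by simp
      then have "ae_eq M (?U ?h) (N ?h)" using U[OF h] by eventually_elim simp
      then have "(LINT x|M. ?U ?h x) = (LINT x|M. N ?h x)"
        by (intro integral_cong_AE borel op_closed N.op_closed h)
      then show ?case using Suc integral_transfer[OF h] by simp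
    qed simp
    have "(\<lambda>k. C * r ^ Suc k * nrm f) \<longlonglongrightarrow> C * 0 * nrm f"
      using r by (intro tendsto_intros LIMSEQ_Suc LIMSEQ_realpow_zero) auto
    moreover have "\<forall>k. cmod (LINT x|M. N f x) \<le> C * r ^ Suc k * nrm f"
      using order_trans[OF integral_le_nrm[OF N.pow_closed[OF f]] C(2)[OF f]] * by metis
    ultimately have "cmod (LINT x|M. N f x) \<le> 0" by (intro LIMSEQ_le_const) auto
    then show ?thesis by simp
  qed
  have "ae_eq M (?U f) (\<lambda>x. (LINT x|M. f x) + N f x)" if f: "f \<in> \<F>" for f
  proof -
    obtain c where c: "ae_eq M (P f) (\<lambda>x. c)" using Pc[OF f] by blast
    have eq: "ae_eq M (?U f) (\<lambda>x. c + N f x)" using c U[OF f] by eventually_elim (simp add: \<open>ev = 1\<close>)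
    have "(LINT x|M. f x) = (LINT x|M. c + N f x)"
      unfolding integral_transfer[OF f, symmetric]
      using borel[OF N.op_closed[OF f]] borel[OF op_closed[OF f]] eq by (intro integral_cong_AE) auto
    also have "\<dots> = c" using intN[OF f] closed_integrable[OF N.op_closed[OF f]] by (simp add: prob_space)
    finally show ?thesis using eq by simp
  qed
  then show thesis using that[OF N _ N1 r(2,3) C(1)] C(2) by metis
qed

text \<open>Duality repeated n times: the innermost step is peeled off, and the remaining product of
  \<phi> along the orbit serves as a bounded test function. Hence the induction leaves f
  arbitrary.\<close>

lemma integral_weighted_transfer:
  assumes \<phi>: "\<phi> \<in> \<F>" and f: "f \<in> \<F>"
  shows "(LINT x|M. ((\<lambda>f. transfer_op M T (\<lambda>x. \<phi> x * f x)) ^^ n) f x) = (LINT x|M. f x * (\<Prod>k<n. \<phi> ((T ^^ k) x)))"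
  using f
proof (induction n arbitrary: f)
  case (Suc n)
  let ?L = "\<lambda>f. transfer_op M T (\<lambda>x. \<phi> x * f x)"
  have \<phi>f: "(\<lambda>x. \<phi> x * f x) \<in> \<F>" by (intro mult_closed \<phi> Suc)
  have mult: "(\<lambda>x. a x * b x) \<in> L_infty M" if ab: "a \<in> L_infty M" "b \<in> L_infty M" for a b
  proof -
    obtain A where A: "AE x in M. cmod (a x) \<le> A" by (rule L_infty_AE_bound[OF ab(1)])
    obtain B where B: "AE x in M. cmod (b x) \<le> B" by (rule L_infty_AE_bound[OF ab(2)])
    have "AE x in M. cmod (a x * b x) \<le> A * B"
      using A B by eventually_elim (simp add: norm_mult, intro mult_mono, auto intro: order_trans[OF norm_ge_zero])
    then show ?thesis using ab by (intro L_infty_bounded) (auto simp: L_infty_def)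
  qed
  have comp: "(\<lambda>x. \<phi> ((T ^^ k) x)) \<in> L_infty M" for k
  proof (induction k)
    case (Suc k)
    then show ?case using L_infty_compose[of "\<lambda>x. \<phi> ((T ^^ k) x)"] by (simp add: funpow_swap1)
  qed (simp add: closed_L_infty[OF \<phi>])
  have prod: "(\<lambda>x. \<Prod>k<n. \<phi> ((T ^^ k) x)) \<in> L_infty M" for n
    by (induction n) (auto intro: one_L_infty mult comp simp: mult.commute)
  have "(LINT x|M. (?L ^^ Suc n) f x) = (LINT x|M. (?L ^^ n) (?L f) x)"
    by (simp only: funpow_Suc_right o_apply)
  also have "\<dots> = (LINT x|M. ?L f x * (\<Prod>k<n. \<phi> ((T ^^ k) x)))"
    by (rule Suc.IH) (intro op_closed \<phi>f)
  also have "\<dots> = (LINT x|M. (\<phi> x * f x) * (\<Prod>k<n. \<phi> ((T ^^ k) (T x))))"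
    using transfer_closed[OF \<phi>f, unfolded is_transfer_def, THEN conjunct2, THEN bspec, OF prod[of n]] .
  also have "\<dots> = (LINT x|M. f x * (\<Prod>k<Suc n. \<phi> ((T ^^ k) x)))"
    by (simp only: prod.lessThan_Suc_shift) (simp add: funpow_swap1 mult_ac)
  finally show ?case .
qed simp

end

section \<open>Exponential bounds for Birkhoff sums\<close>

text \<open>Turns the products that the weighted operator controls into exponentials of Birkhoff
  sums, at the price of a quadratic term.\<close>

lemma exp_le_one_plus:
  fixes y :: real
  assumes "\<bar>y\<bar> \<le> 1/2"
  shows "exp (y - 2 * y\<^sup>2) \<le> 1 + y"
proof -
  have "y - 2 * y\<^sup>2 \<le> ln (1 + y)"
    using abs_ln_one_plus_x_minus_x_bound[OF assms] by (simp add: abs_le_iff)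
  then have "exp (y - 2 * y\<^sup>2) \<le> exp (ln (1 + y))" by simp
  also have "\<dots> = 1 + y" using assms by (intro exp_ln) (auto simp: abs_le_iff)
  finally show ?thesis .
qed

context gap_system
begin

lemma T_pow_measurable [measurable]: "(T ^^ k) \<in> measurable M M"
  by (induction k) (auto simp: o_def id_def measurable_ident intro: measurable_compose[OF _ T_measurable])

lemma T_pow_space: "x \<in> space M \<Longrightarrow> (T ^^ k) x \<in> space M"
  using measurable_space[OF T_pow_measurable] .

text \<open>The weighted operator \<open>f \<mapsto> transfer_op M T ((1 + s X) f)\<close> is iterated on the
  constant 1. Writing the \<open>k\<close>-th iterate as its mean \<open>c k\<close> plus a remainder \<open>g k\<close>,
  the remainder stays of size \<open>O(\<bar>s\<bar>)\<close> relative to the bound for \<open>c k\<close>, since one step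
  contracts it by \<open>r\<close> while the bound shrinks at most by \<open>1 - s0 > r\<close>.
  No perturbation theory of the spectrum is needed.\<close>

lemma birkhoff_product_bound:
  fixes K :: real
  assumes K: "K > 0"
  obtains s0 B where "s0 > 0" "s0 \<le> 1/4" "B > 0"
    "\<And>X s n. (\<lambda>x. complex_of_real (X x)) \<in> \<F> \<Longrightarrow> nrm (\<lambda>x. complex_of_real (X x)) \<le> K \<Longrightarrow>
       (\<And>x. x \<in> space M \<Longrightarrow> 0 \<le> X x \<and> X x \<le> 1) \<Longrightarrow> \<bar>s\<bar> \<le> s0 \<Longrightarrow>
       (LINT x|M. (\<Prod>k<n. 1 + s * X ((T ^^ k) x)))
         \<le> exp (real n * (s * (LINT x|M. X x) + B * s\<^sup>2 * (LINT x|M. X x)))"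
proof -
  obtain N C r where N: "bounded_op M \<F> nrm N"
    and dec: "\<And>f. f \<in> \<F> \<Longrightarrow> ae_eq M (transfer_op M T f) (\<lambda>x. (LINT x|M. f x) + N f x)"
    and N1: "ae_eq M (N (\<lambda>x. 1)) (\<lambda>x. 0)" and r: "0 < r" "r < 1" and C: "0 < C"
    and NC: "\<And>f k. f \<in> \<F> \<Longrightarrow> nrm ((N ^^ k) f) \<le> C * r ^ k * nrm f"
    by (rule transfer_decomposition, rule that)
  interpret N: fun_operator M \<F> nrm N by unfold_locales (rule N)
  \<comment> \<open>(1 - r) B = 2 C K: one half pays for the new remainder that s X creates from the
    mean in each step, the other for the terms of order s0, which the second bound in
    \<open>s0\<close> secures.\<close>
  define B where "B = 2 * C * K / (1 - r)"
  have B: "B > 0" using C K r by (simp add: B_def)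
  define s0 where "s0 = min (1/4) (C * K / (B * (1 + C * K)))"
  have CK: "C * K > 0" using C K by simp
  have s0: "s0 > 0" "s0 \<le> 1/4"
    using B CK unfolding s0_def by (simp add: add_pos_pos, intro min.cobounded1)
  have key: "r * B + C * r * K + C * r * K * B * s0 \<le> B * (1 - s0)"
  proof -
    have "s0 \<le> C * K / (B * (1 + C * K))" by (simp add: s0_def)
    then have "s0 * (B * (1 + C * K)) \<le> C * K"
      using B CK by (simp add: pos_le_divide_eq add_pos_pos)
    moreover have "(1 - r) * B = 2 * C * K" using r by (simp add: B_def)
    moreover have "C * r * K * (1 + B * s0) \<le> C * 1 * K * (1 + B * s0)"
      using C K r B s0 by (intro mult_right_mono mult_left_mono) auto
    ultimately show ?thesis by (simp add: algebra_simps)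
  qed
  show thesis
  proof (rule that[OF s0 B])
    fix X :: "'a \<Rightarrow> real" and s :: real and n :: nat
    assume XF: "(\<lambda>x. complex_of_real (X x)) \<in> \<F>" and XK: "nrm (\<lambda>x. complex_of_real (X x)) \<le> K"
      and X01: "\<And>x. x \<in> space M \<Longrightarrow> 0 \<le> X x \<and> X x \<le> 1" and s: "\<bar>s\<bar> \<le> s0"
    let ?X = "\<lambda>x. complex_of_real (X x)"
    define p where "p = (LINT x|M. X x)"
    have Xint: "integrable M X" using integrable_Re[OF closed_integrable[OF XF]] by simp
    have p: "0 \<le> p" "p \<le> 1"
      unfolding p_def using X01 integral_mono[OF Xint, of "\<lambda>x. 1"]
      by (auto intro!: integral_nonneg_AE simp: prob_space)
    define \<phi> where "\<phi> = (\<lambda>x. 1 + of_real s * ?X x)"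
    have \<phi>: "\<phi> \<in> \<F>" unfolding \<phi>_def by (intro add_closed const_closed scale_closed XF)
    define L where "L = (\<lambda>f. transfer_op M T (\<lambda>x. \<phi> x * f x))"
    define f where "f k = (L ^^ k) (\<lambda>x. 1)" for k
    have f: "f k \<in> \<F>" for k
      by (induction k) (auto simp: f_def L_def intro: const_closed op_closed mult_closed \<phi>)
    have fSuc: "f (Suc k) = transfer_op M T (\<lambda>x. \<phi> x * f k x)" for k
      by (simp add: f_def L_def)
    define c where "c k = (LINT x|M. f k x)" for k
    define g where "g k = (\<lambda>x. f k x - c k)" for k
    have g: "g k \<in> \<F>" for k unfolding g_def by (intro diff_closed f const_closed)
    have fg: "f k = (\<lambda>x. c k + g k x)" for k by (simp add: g_def)
    \<comment> \<open>Growth factor per step of the bound for the mean: 1 + s p from the mean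
      itself, B s^2 p fed back by the remainder.\<close>
    define q where "q = 1 + s * p + B * s\<^sup>2 * p"
    have sp: "\<bar>s * p\<bar> \<le> s0" using s p by (simp add: abs_mult) (metis abs_ge_zero mult_left_le order_trans)
    have "0 \<le> B * s\<^sup>2 * p" using B p by simp
    then have q: "1 - s0 \<le> q" "0 \<le> q" using sp s0 unfolding q_def by linarith+
    have N1': "ae_eq M ((N ^^ Suc i) (\<lambda>x. 1)) (\<lambda>x. 0)" for i
    proof -
      interpret P: fun_operator M \<F> nrm "N ^^ i" by unfold_locales (rule N.bounded_pow)
      have "ae_eq M ((N ^^ i) (N (\<lambda>x. 1))) ((N ^^ i) (\<lambda>x. 0))"
        by (intro P.op_cong N.op_closed const_closed N1)
      with P.op_zero show ?thesis unfolding funpow_Suc_right o_apply by eventually_elim simp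
    qed
    \<comment> \<open>All the N^i (g k) are estimated together, since one application of N is only
      known to be bounded by C r, which need not be below 1. In this form C enters only with the
      terms newly created in a step and does not accumulate.\<close>
    have inv: "cmod (c k) \<le> q ^ k \<and> (\<forall>i. nrm ((N ^^ i) (g k)) \<le> r ^ i * (B * \<bar>s\<bar> * q ^ k))" for k
    proof (induction k)
      case 0
      have "g 0 = (\<lambda>x. 0)" by (simp add: g_def c_def f_def prob_space)
      moreover have "nrm ((N ^^ i) (\<lambda>x. 0)) \<le> r ^ i * (B * \<bar>s\<bar>)" for i
        using NC[OF zero_closed, of i] B r by (simp add: nrm_zero) (metis abs_ge_zero less_imp_le mult_nonneg_nonneg order_trans zero_le_power)
      ultimately show ?case by (simp add: c_def f_def prob_space)
    next
      case (Suc k)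
      then have ck: "cmod (c k) \<le> q ^ k" and gk: "\<And>i. nrm ((N ^^ i) (g k)) \<le> r ^ i * (B * \<bar>s\<bar> * q ^ k)" by auto
      have gk0: "nrm (g k) \<le> B * \<bar>s\<bar> * q ^ k" using gk[of 0] by simp
      have Xg: "(\<lambda>x. ?X x * g k x) \<in> \<F>" by (intro mult_closed XF g)
      have expand: "(\<lambda>x. \<phi> x * f k x) = (\<lambda>x. c k * 1 + (of_real s * c k * ?X x + (g k x + of_real s * (?X x * g k x))))"
        unfolding \<phi>_def by (subst fg) (auto simp: algebra_simps)
      have \<phi>f: "(\<lambda>x. \<phi> x * f k x) \<in> \<F>" by (intro mult_closed \<phi> f)
      have cS: "c (Suc k) = (LINT x|M. \<phi> x * f k x)"
        unfolding c_def fSuc by (rule integral_transfer[OF \<phi>f])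
      also have "\<dots> = (LINT x|M. c k * 1 + (of_real s * c k * ?X x + (g k x + of_real s * (?X x * g k x))))"
        unfolding expand ..
      also have "\<dots> = c k + of_real s * c k * of_real p + of_real s * (LINT x|M. ?X x * g k x)"
      proof -
        have "(LINT x|M. g k x) = 0" using closed_integrable[OF f, of k] by (simp add: g_def c_def prob_space)
        then show ?thesis
          using closed_integrable[OF XF] closed_integrable[OF g, of k] closed_integrable[OF Xg] Xint
          by (simp add: prob_space p_def)
      qed
      also have "\<dots> = c k * of_real (1 + s * p) + of_real s * (LINT x|M. ?X x * g k x)"
        by (simp add: algebra_simps)
      finally have "cmod (c (Suc k)) \<le> cmod (c k) * \<bar>1 + s * p\<bar> + \<bar>s\<bar> * cmod (LINT x|M. ?X x * g k x)"
        using norm_triangle_ineq[of "c k * of_real (1 + s * p)" "of_real s * (LINT x|M. ?X x * g k x)"]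
        by (simp add: norm_mult del: of_real_add of_real_mult)
      also have "cmod (LINT x|M. ?X x * g k x) \<le> (LINT x|M. cmod (?X x * g k x))" by (rule integral_norm_bound)
      \<comment> \<open>Only g k is bounded uniformly; X stays under the integral and contributes
        its mean. This is the origin of the factor p in the quadratic term.\<close>
      also have "(LINT x|M. cmod (?X x * g k x)) \<le> (LINT x|M. X x * nrm (g k))"
      proof (rule integral_mono_AE)
        show "AE x in M. cmod (?X x * g k x) \<le> X x * nrm (g k)"
          using AE_le_nrm[OF g, of k] AE_space
          by eventually_elim (use X01 in \<open>auto simp: norm_mult intro!: mult_left_mono\<close>)
      qed (use Xint closed_integrable[OF Xg] in auto)
      also have "(LINT x|M. X x * nrm (g k)) = p * nrm (g k)" by (simp add: p_def)
      also have "cmod (c k) * \<bar>1 + s * p\<bar> + \<bar>s\<bar> * (p * nrm (g k))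
          \<le> q ^ k * (1 + s * p) + \<bar>s\<bar> * (p * (B * \<bar>s\<bar> * q ^ k))"
        using ck gk0 p sp s0 q(2) nrm_nonneg[OF g, of k] by (intro add_mono mult_mono mult_left_mono) auto
      also have "\<dots> = q ^ k * (1 + s * p + B * (\<bar>s\<bar> * \<bar>s\<bar>) * p)" by (simp add: algebra_simps)
      also have "\<dots> = q ^ Suc k" by (simp add: q_def power2_eq_square)
      finally have c': "cmod (c (Suc k)) \<le> q ^ Suc k" by (simp add: mult_left_mono)
      have gN: "ae_eq M (g (Suc k)) (N (\<lambda>x. \<phi> x * f k x))"
        using dec[OF \<phi>f] by eventually_elim (simp add: g_def cS, simp add: fSuc)
      have "nrm ((N ^^ i) (g (Suc k))) \<le> r ^ i * (B * \<bar>s\<bar> * q ^ Suc k)" for i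
      proof -
        interpret Q: fun_operator M \<F> nrm "N ^^ Suc i" by unfold_locales (rule N.bounded_pow)
        let ?a = "\<lambda>x. of_real s * c k * ?X x" and ?b = "\<lambda>x. of_real s * (?X x * g k x)"
        let ?Q = "N ^^ Suc i"
        have mem: "?a \<in> \<F>" "?b \<in> \<F>" "(\<lambda>x. c k * 1) \<in> \<F>"
          by (intro scale_closed XF Xg const_closed)+
        note mem' = add_closed[OF g[of k] mem(2)] add_closed[OF mem(1) add_closed[OF g[of k] mem(2)]]
        have "ae_eq M ((N ^^ i) (g (Suc k))) ((N ^^ i) (N (\<lambda>x. \<phi> x * f k x)))"
          by (intro N.pow_cong g N.op_closed \<phi>f gN)
        then have e1: "ae_eq M ((N ^^ i) (g (Suc k))) (?Q (\<lambda>x. \<phi> x * f k x))"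
          unfolding funpow_Suc_right o_apply .
        have e2: "ae_eq M (?Q (\<lambda>x. \<phi> x * f k x))
            (\<lambda>x. of_real s * c k * ?Q ?X x + (?Q (g k) x + of_real s * ?Q (\<lambda>x. ?X x * g k x) x))"
          unfolding expand
          using Q.op_add[OF mem(3) mem'(2)] Q.op_add[OF mem(1) mem'(1)] Q.op_add[OF g[of k] mem(2)]
            Q.op_scale[OF const_closed[of 1], of "c k"] N1'[of i] Q.op_scale[OF XF, of "of_real s * c k"]
            Q.op_scale[OF Xg, of "of_real s"]
          by eventually_elim simp
        have QX: "?Q ?X \<in> \<F>" "?Q (g k) \<in> \<F>" "?Q (\<lambda>x. ?X x * g k x) \<in> \<F>"
          by (intro Q.op_closed XF g Xg)+
        have e3: "ae_eq M ((N ^^ i) (g (Suc k)))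
            (\<lambda>x. of_real s * c k * ?Q ?X x + (?Q (g k) x + of_real s * ?Q (\<lambda>x. ?X x * g k x) x))"
          using e1 e2 by eventually_elim (simp only:)
        have "nrm ((N ^^ i) (g (Suc k)))
            = nrm (\<lambda>x. of_real s * c k * ?Q ?X x + (?Q (g k) x + of_real s * ?Q (\<lambda>x. ?X x * g k x) x))"
          by (rule nrm_cong[OF _ _ e3]; intro add_closed scale_closed N.pow_closed g XF Xg)
        also have "\<dots> \<le> nrm (\<lambda>x. of_real s * c k * ?Q ?X x) + (nrm (?Q (g k)) + nrm (\<lambda>x. of_real s * ?Q (\<lambda>x. ?X x * g k x) x))"
          by (intro order_trans[OF nrm_add] add_mono nrm_add order_refl add_closed scale_closed QX)
        also have "\<dots> = \<bar>s\<bar> * cmod (c k) * nrm (?Q ?X) + (nrm (?Q (g k)) + \<bar>s\<bar> * nrm (?Q (\<lambda>x. ?X x * g k x)))"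
          by (simp add: nrm_scale QX norm_mult del: funpow.simps)
        also have "\<dots> \<le> \<bar>s\<bar> * q ^ k * (C * r ^ Suc i * K) + (r ^ Suc i * (B * \<bar>s\<bar> * q ^ k)
            + \<bar>s\<bar> * (C * r ^ Suc i * (K * (B * \<bar>s\<bar> * q ^ k))))"
        proof (intro add_mono mult_mono mult_left_mono ck gk)
          show "nrm (?Q ?X) \<le> C * r ^ Suc i * K"
            using C r by (intro order_trans[OF NC[OF XF] mult_left_mono[OF XK]]) simp
          have "nrm (\<lambda>x. ?X x * g k x) \<le> K * (B * \<bar>s\<bar> * q ^ k)"
            using XK gk0 K nrm_nonneg[OF g] by (intro order_trans[OF nrm_mult] XF g mult_mono) auto
          then show "nrm (?Q (\<lambda>x. ?X x * g k x)) \<le> C * r ^ Suc i * (K * (B * \<bar>s\<bar> * q ^ k))"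
            using C r by (intro order_trans[OF NC[OF Xg] mult_left_mono]) simp_all
        qed (use q nrm_nonneg[OF QX(1)] nrm_nonneg[OF QX(3)] in auto)
        also have "\<dots> = (r ^ i * (\<bar>s\<bar> * q ^ k)) * (r * B + C * r * K + C * r * K * B * \<bar>s\<bar>)"
          by (simp add: algebra_simps)
        also have "\<dots> \<le> (r ^ i * (\<bar>s\<bar> * q ^ k)) * (B * q)"
        proof (rule mult_left_mono)
          have "C * r * K * B * \<bar>s\<bar> \<le> C * r * K * B * s0" using s C r K B by (intro mult_left_mono) auto
          also have "r * B + C * r * K + \<dots> \<le> B * q" by (rule order_trans[OF key mult_left_mono[OF q(1) less_imp_le[OF B]]])
          finally show "r * B + C * r * K + C * r * K * B * \<bar>s\<bar> \<le> B * q" by simp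
        qed (use r q in auto)
        finally show ?thesis by (simp add: algebra_simps)
      qed
      with c' show ?case by blast
    qed
    have "c n = (LINT x|M. 1 * (\<Prod>k<n. \<phi> ((T ^^ k) x)))"
      unfolding c_def f_def L_def by (rule integral_weighted_transfer[OF \<phi> const_closed])
    also have "\<dots> = (LINT x|M. complex_of_real (\<Prod>k<n. 1 + s * X ((T ^^ k) x)))"
      by (simp add: \<phi>_def)
    also have "\<dots> = of_real (LINT x|M. (\<Prod>k<n. 1 + s * X ((T ^^ k) x)))"
      by (rule integral_complex_of_real)
    finally have "\<bar>LINT x|M. (\<Prod>k<n. 1 + s * X ((T ^^ k) x))\<bar> \<le> q ^ n"
      using inv[of n] by simp
    also have "q ^ n \<le> exp (s * p + B * s\<^sup>2 * p) ^ n"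
      using q exp_ge_add_one_self[of "s * p + B * s\<^sup>2 * p"] by (intro power_mono) (auto simp: q_def add.assoc)
    also have "\<dots> = exp (real n * (s * p + B * s\<^sup>2 * p))" by (simp add: exp_of_nat_mult)
    finally show "(LINT x|M. (\<Prod>k<n. 1 + s * X ((T ^^ k) x)))
         \<le> exp (real n * (s * (LINT x|M. X x) + B * s\<^sup>2 * (LINT x|M. X x)))"
      by (simp add: p_def)
  qed
qed

text \<open>Chernoff bound with the parameters s and -s. Passing from 1 + z X to an exponential
  replaces z by z - 2 z^2. This costs 2 s^2 n p, hence the constant B + 2, and up to 2 s^2 t, which
  is at most s t / 2 for s <= 1/4, hence the halved linear term.\<close>

lemma birkhoff_tail:
  fixes K :: real
  assumes K: "K > 0"
  obtains s0 B where "s0 > 0" "B > 0"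
    "\<And>X s n t. (\<lambda>x. complex_of_real (X x)) \<in> \<F> \<Longrightarrow> nrm (\<lambda>x. complex_of_real (X x)) \<le> K \<Longrightarrow>
       (\<And>x. x \<in> space M \<Longrightarrow> 0 \<le> X x \<and> X x \<le> 1) \<Longrightarrow> 0 < s \<Longrightarrow> s \<le> s0 \<Longrightarrow> 0 \<le> t \<Longrightarrow>
       prob {x \<in> space M. \<bar>(\<Sum>k<n. X ((T ^^ k) x)) - real n * (LINT x|M. X x)\<bar> \<ge> t}
         \<le> 2 * exp (B * s\<^sup>2 * (real n * (LINT x|M. X x)) - s * t / 2)"
proof -
  obtain s0 B where s0: "s0 > 0" "s0 \<le> 1/4" and B: "B > 0" and bound:
    "\<And>X s n. (\<lambda>x. complex_of_real (X x)) \<in> \<F> \<Longrightarrow> nrm (\<lambda>x. complex_of_real (X x)) \<le> K \<Longrightarrow>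
       (\<And>x. x \<in> space M \<Longrightarrow> 0 \<le> X x \<and> X x \<le> 1) \<Longrightarrow> \<bar>s\<bar> \<le> s0 \<Longrightarrow>
       (LINT x|M. (\<Prod>k<n. 1 + s * X ((T ^^ k) x)))
         \<le> exp (real n * (s * (LINT x|M. X x) + B * s\<^sup>2 * (LINT x|M. X x)))"
    using birkhoff_product_bound[OF K] by metis
  show thesis
  proof (rule that[of s0 "B + 2"])
    show "s0 > 0" "B + 2 > 0" using s0 B by auto
    fix X :: "'a \<Rightarrow> real" and s t :: real and n :: nat
    assume XF: "(\<lambda>x. complex_of_real (X x)) \<in> \<F>" and XK: "nrm (\<lambda>x. complex_of_real (X x)) \<le> K"
      and X01: "\<And>x. x \<in> space M \<Longrightarrow> 0 \<le> X x \<and> X x \<le> 1" and s: "0 < s" "s \<le> s0" and t: "0 \<le> t"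
    define p where "p = (LINT x|M. X x)"
    define S where "S x = (\<Sum>k<n. X ((T ^^ k) x))" for x
    have [measurable]: "X \<in> borel_measurable M" using borel_measurable_integrable[OF integrable_Re[OF closed_integrable[OF XF]]] by simp
    have tail: "prob {x \<in> space M. a \<le> (z - 2 * z\<^sup>2) * S x} \<le> exp (real n * (z * p + B * z\<^sup>2 * p) - a)"
      if z: "\<bar>z\<bar> \<le> s0" for z a
    proof -
      define Y where "Y x = (\<Prod>k<n. 1 + z * X ((T ^^ k) x))" for x
      have [measurable]: "Y \<in> borel_measurable M" unfolding Y_def by measurable
      have zX: "\<bar>z * X ((T ^^ k) x)\<bar> \<le> 1/4" if "x \<in> space M" for x k
        using X01[OF T_pow_space[OF that, of k]] z s0(2) mult_mono[of "\<bar>z\<bar>" "1/4" "X ((T ^^ k) x)" 1]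
        by (simp add: abs_mult)
      have Y: "0 \<le> Y x" "Y x \<le> 2 ^ n" if "x \<in> space M" for x
      proof -
        have *: "0 \<le> 1 + z * X ((T ^^ k) x) \<and> 1 + z * X ((T ^^ k) x) \<le> 2" for k
          using zX[OF that, of k] by (auto simp: abs_le_iff)
        show "0 \<le> Y x" unfolding Y_def using * by (intro prod_nonneg) auto
        have "Y x \<le> (\<Prod>k<n. 2)" unfolding Y_def using * by (intro prod_mono) auto
        then show "Y x \<le> 2 ^ n" by simp
      qed
      have eY: "exp ((z - 2 * z\<^sup>2) * S x) \<le> Y x" if "x \<in> space M" for x
      proof -
        have "exp ((z - 2 * z\<^sup>2) * S x) = (\<Prod>k<n. exp ((z - 2 * z\<^sup>2) * X ((T ^^ k) x)))"
          by (simp add: S_def exp_sum sum_distrib_left)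
        also have "\<dots> \<le> Y x" unfolding Y_def
        proof (intro prod_mono conjI)
          fix k
          have x: "0 \<le> X ((T ^^ k) x)" "X ((T ^^ k) x) \<le> 1" using X01[OF T_pow_space[OF that]] by auto
          \<comment> \<open>X^2 <= X on [0, 1] keeps the exponent linear in X, so that the factors
            multiply to an exponential of the Birkhoff sum.\<close>
          have "2 * z\<^sup>2 * (X ((T ^^ k) x))\<^sup>2 \<le> 2 * z\<^sup>2 * X ((T ^^ k) x)"
            using x by (intro mult_left_mono) (auto simp: power2_eq_square mult_left_le)
          then have "(z - 2 * z\<^sup>2) * X ((T ^^ k) x) \<le> z * X ((T ^^ k) x) - 2 * (z * X ((T ^^ k) x))\<^sup>2"
            by (simp add: power_mult_distrib algebra_simps)
          then have "exp ((z - 2 * z\<^sup>2) * X ((T ^^ k) x)) \<le> exp (z * X ((T ^^ k) x) - 2 * (z * X ((T ^^ k) x))\<^sup>2)"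
            by simp
          also have "\<dots> \<le> 1 + z * X ((T ^^ k) x)" using zX[OF that, of k] by (intro exp_le_one_plus) simp
          finally show "exp ((z - 2 * z\<^sup>2) * X ((T ^^ k) x)) \<le> 1 + z * X ((T ^^ k) x)" .
        qed simp
        finally show ?thesis .
      qed
      have "prob {x \<in> space M. a \<le> (z - 2 * z\<^sup>2) * S x} \<le> prob {x \<in> space M. Y x \<ge> exp a}"
        using eY by (intro finite_measure_mono) (auto intro: order_trans[rotated])
      also have "\<dots> \<le> (LINT x|M. Y x) / exp a"
      proof (rule integral_Markov_inequality_measure[where A = "{}"])
        show "integrable M Y"
          using Y by (intro integrable_const_bound[of _ "2 ^ n"]) auto
      qed (use Y in auto)
      also have "\<dots> \<le> exp (real n * (z * p + B * z\<^sup>2 * p)) / exp a"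
        using bound[OF XF XK X01 z, of n] by (intro divide_right_mono) (auto simp: Y_def p_def)
      finally show ?thesis by (simp add: exp_diff)
    qed
    let ?E = "exp ((B + 2) * s\<^sup>2 * (real n * p) - s * t / 2)"
    have "{x \<in> space M. \<bar>S x - real n * p\<bar> \<ge> t} \<subseteq>
        {x \<in> space M. (s - 2 * s\<^sup>2) * (real n * p + t) \<le> (s - 2 * s\<^sup>2) * S x} \<union>
        {x \<in> space M. (- s - 2 * (- s)\<^sup>2) * (real n * p - t) \<le> (- s - 2 * (- s)\<^sup>2) * S x}"
    proof safe
      fix x assume x: "t \<le> \<bar>S x - real n * p\<bar>"
        and *: "\<not> (- s - 2 * (- s)\<^sup>2) * (real n * p - t) \<le> (- s - 2 * (- s)\<^sup>2) * S x"
      have ss: "2 * s\<^sup>2 \<le> s" using s s0 by (simp add: power2_eq_square)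
      have neg: "- s - 2 * (- s)\<^sup>2 \<le> 0" using s(1) zero_le_power2[of "- s"] by linarith
      have "\<not> S x \<le> real n * p - t" using * mult_left_mono_neg[OF _ neg] by blast
      then have "real n * p + t \<le> S x" using x by linarith
      then show "(s - 2 * s\<^sup>2) * (real n * p + t) \<le> (s - 2 * s\<^sup>2) * S x"
        using ss by (intro mult_left_mono) auto
    qed
    moreover have [measurable]: "S \<in> borel_measurable M" unfolding S_def by measurable
    ultimately have "prob {x \<in> space M. \<bar>S x - real n * p\<bar> \<ge> t} \<le>
        prob {x \<in> space M. (s - 2 * s\<^sup>2) * (real n * p + t) \<le> (s - 2 * s\<^sup>2) * S x} +
        prob {x \<in> space M. (- s - 2 * (- s)\<^sup>2) * (real n * p - t) \<le> (- s - 2 * (- s)\<^sup>2) * S x}"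
      by (intro order_trans[OF finite_measure_mono measure_Un_le]) auto
    also have "\<dots> \<le> ?E + ?E"
    proof (intro add_mono order_trans[OF tail])
      have "(4 * s) * (s * t) \<le> 1 * (s * t)"
        using s s0 t by (intro mult_right_mono) auto
      then have ss: "2 * s\<^sup>2 * t \<le> s * t / 2" by (simp add: power2_eq_square)
      show "exp (real n * (s * p + B * s\<^sup>2 * p) - (s - 2 * s\<^sup>2) * (real n * p + t)) \<le> ?E"
        using ss by (simp add: algebra_simps)
      have "0 \<le> s * t / 2 + 2 * s\<^sup>2 * t" using s t by simp
      moreover have "0 \<le> s * t" using s t by simp
      ultimately show "exp (real n * (- s * p + B * (- s)\<^sup>2 * p) - (- s - 2 * (- s)\<^sup>2) * (real n * p - t)) \<le> ?E"
        using ss by (simp add: algebra_simps)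
    qed (use s in auto)
    finally show "prob {x \<in> space M. t \<le> \<bar>(\<Sum>k<n. X ((T ^^ k) x)) - real n * (LINT x|M. X x)\<bar>}
         \<le> 2 * exp ((B + 2) * s\<^sup>2 * (real n * (LINT x|M. X x)) - s * t / 2)"
      by (simp add: p_def S_def)
  qed
qed

end

section \<open>Trimmed sums\<close>

lemma ordering_perm_exists: "\<exists>\<sigma>. ordering_perm T chi n x \<sigma>"
proof -
  define f where "f i = - chi ((T ^^ i) x)" for i
  define xs where "xs = sort_key f [0..<n]"
  have xs: "length xs = n" "distinct xs" "set xs = {..<n}" "sorted (map f xs)"
    by (auto simp: xs_def)
  define \<sigma> where "\<sigma> i = (if i < n then xs ! i else i)" for i
  have "bij_betw \<sigma> {..<n} {..<n} \<longleftrightarrow> bij_betw ((!) xs) {..<n} {..<n}"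
    by (intro bij_betw_cong) (auto simp: \<sigma>_def)
  then have "bij_betw \<sigma> {..<n} {..<n}" using bij_betw_nth[OF xs(2), of "{..<n}"] xs by simp
  then have "\<sigma> permutes {..<n}" by (rule bij_imp_permutes) (auto simp: \<sigma>_def)
  moreover have "chi ((T ^^ \<sigma> j) x) \<le> chi ((T ^^ \<sigma> i) x)" if "i \<le> j" "j < n" for i j
    using sorted_nth_mono[OF xs(4), of i j] that xs(1) by (simp add: \<sigma>_def f_def)
  ultimately show ?thesis unfolding ordering_perm_def by blast
qed

text \<open>Sorting puts the N terms above l in front, so the truncated sum runs over the sorted
  positions from N on; trimming at b only removes an initial piece of these, with terms between 0
  and l.\<close>

lemma trimmed_sum_bounds:
  fixes chi :: "'a \<Rightarrow> real" and l :: real and n :: nat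
  assumes nn: "\<And>k. 0 \<le> chi ((T ^^ k) x)" and l: "0 \<le> l"
  defines "N \<equiv> card {k. k < n \<and> l < chi ((T ^^ k) x)}"
  assumes b: "N \<le> b"
  shows "trimmed_sum T chi b n x \<le> (\<Sum>k<n. truncated chi l ((T ^^ k) x))"
    and "(\<Sum>k<n. truncated chi l ((T ^^ k) x)) - real (b - N) * l \<le> trimmed_sum T chi b n x"
proof -
  define \<sigma> where "\<sigma> = (SOME \<sigma>. ordering_perm T chi n x \<sigma>)"
  have "ordering_perm T chi n x \<sigma>"
    unfolding \<sigma>_def by (rule someI_ex[OF ordering_perm_exists])
  then have perm: "\<sigma> permutes {..<n}"
    and mono: "\<And>i j. i \<le> j \<Longrightarrow> j < n \<Longrightarrow> chi ((T ^^ \<sigma> j) x) \<le> chi ((T ^^ \<sigma> i) x)"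
    by (auto simp: ordering_perm_def)
  define w where "w k = chi ((T ^^ \<sigma> k) x)" for k
  have w: "w j \<le> w i" if "i \<le> j" "j < n" for i j using mono[OF that] by (simp add: w_def)
  define A where "A = {k. k < n \<and> l < w k}"
  have "{k. k < n \<and> l < chi ((T ^^ k) x)} = \<sigma> ` A"
  proof (intro equalityI subsetI)
    fix k assume k: "k \<in> {k. k < n \<and> l < chi ((T ^^ k) x)}"
    then obtain j where "j < n" "k = \<sigma> j"
      using permutes_image[OF perm] by (metis (no_types, lifting) imageE lessThan_iff mem_Collect_eq)
    with k show "k \<in> \<sigma> ` A" by (auto simp: A_def w_def)
  next
    fix k assume "k \<in> \<sigma> ` A"
    then show "k \<in> {k. k < n \<and> l < chi ((T ^^ k) x)}"
      using permutes_in_image[OF perm] by (auto simp: A_def w_def)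
  qed
  then have N: "N = card A"
    unfolding N_def by (simp add: card_image[OF inj_on_subset[OF permutes_inj[OF perm]]])
  have fin: "finite A" by (simp add: A_def)
  have A: "k \<in> A \<longleftrightarrow> k < N" if "k < n" for k
  proof
    assume "k \<in> A"
    then have "{..k} \<subseteq> A" using w by (force simp: A_def)
    then have "card {..k} \<le> N" unfolding N by (intro card_mono fin)
    then show "k < N" by simp
  next
    assume k: "k < N"
    show "k \<in> A"
    proof (rule ccontr)
      assume nk: "k \<notin> A"
      have "A \<subseteq> {..<k}"
      proof
        fix j assume j: "j \<in> A"
        then show "j \<in> {..<k}"
          using nk w[of k j] that by (cases "j < k") (auto simp: A_def)
      qed
      then have "N \<le> k" unfolding N using card_mono[of "{..<k}" A] by simp
      with k show False by simp
    qed
  qed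
  have Nn: "N \<le> n" unfolding N using card_mono[of "{..<n}" A] by (auto simp: A_def)
  have "(\<Sum>k<n. truncated chi l ((T ^^ k) x)) = (\<Sum>k<n. truncated chi l ((T ^^ \<sigma> k) x))"
    using sum.permute[OF perm, of "\<lambda>k. truncated chi l ((T ^^ k) x)"] by (simp add: o_def)
  also have "\<dots> = (\<Sum>k<n. if k \<in> {N..<n} then w k else 0)"
    by (intro sum.cong refl) (use A in \<open>auto simp: truncated_def w_def A_def indicator_def not_le not_less[symmetric]\<close>)
  also have "\<dots> = (\<Sum>k\<in>{..<n} \<inter> {N..<n}. w k)" by (rule sum.inter_restrict[symmetric]) simp
  \<comment> \<open>The minimum admits b > n, where every term is trimmed.\<close>
  also have "{..<n} \<inter> {N..<n} = {N..<min b n} \<union> {b..<n}" using b Nn by auto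
  also have "(\<Sum>k\<in>{N..<min b n} \<union> {b..<n}. w k) = (\<Sum>k=N..<min b n. w k) + (\<Sum>k=b..<n. w k)"
    by (rule sum.union_disjoint) auto
  also have "(\<Sum>k=b..<n. w k) = trimmed_sum T chi b n x"
    by (simp add: trimmed_sum_def \<sigma>_def w_def Let_def)
  finally have eq: "(\<Sum>k<n. truncated chi l ((T ^^ k) x)) = (\<Sum>k=N..<min b n. w k) + trimmed_sum T chi b n x" .
  have "0 \<le> (\<Sum>k=N..<min b n. w k)" using nn by (intro sum_nonneg) (simp add: w_def)
  then show "trimmed_sum T chi b n x \<le> (\<Sum>k<n. truncated chi l ((T ^^ k) x))" using eq by simp
  have "(\<Sum>k=N..<min b n. w k) \<le> real (card {N..<min b n}) * l"
    by (rule sum_bounded_above) (use A in \<open>force simp: A_def\<close>)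
  also have "\<dots> \<le> real (b - N) * l" using l by (intro mult_right_mono) auto
  finally show "(\<Sum>k<n. truncated chi l ((T ^^ k) x)) - real (b - N) * l \<le> trimmed_sum T chi b n x"
    using eq by simp
qed

section \<open>The truncated sums\<close>

text \<open>A distribution function determines its measure; this turns the Stieltjes integral in d n
  into an integral against the law of \<open>chi\<close>, hence into a truncated mean.\<close>

lemma (in real_distribution) interval_measure_cdf: "interval_measure (cdf M) = M"
proof -
  have "real_distribution (interval_measure (cdf M))"
    by (intro real_distribution_interval_measure cdf_nondecreasing cdf_is_right_cont cdf_lim_at_bot cdf_lim_at_top_prob)
  moreover have "cdf (interval_measure (cdf M)) = cdf M"
    by (intro cdf_interval_measure cdf_nondecreasing cdf_is_right_cont cdf_lim_at_bot)
  ultimately show ?thesis using cdf_unique real_distribution_axioms by blast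
qed

section \<open>Truncations and exceedances of \<open>chi\<close>\<close>

locale trimmed_system =
  fixes M :: "'a measure" and T :: "'a \<Rightarrow> 'a" and \<F> :: "('a \<Rightarrow> complex) set"
    and nrm :: "('a \<Rightarrow> complex) \<Rightarrow> real" and chi :: "'a \<Rightarrow> real"
  assumes propD: "property_D M T \<F> nrm chi"

sublocale trimmed_system \<subseteq> gap_system M T \<F> nrm
  using propD by unfold_locales (simp add: property_D_def)

context trimmed_system
begin

lemma chi_measurable [measurable]: "chi \<in> borel_measurable M"
  and chi_nonneg: "x \<in> space M \<Longrightarrow> 0 \<le> chi x"
  using propD by (auto simp: property_D_def)

lemma truncated_measurable [measurable]: "truncated chi l \<in> borel_measurable M"
proof -
  have "truncated chi l = (\<lambda>x. if chi x \<le> l then chi x else 0)"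
    by (auto simp: truncated_def fun_eq_iff)
  then show ?thesis by simp
qed

lemma truncated_bounds:
  assumes "x \<in> space M" "0 \<le> l"
  shows "0 \<le> truncated chi l x" "truncated chi l x \<le> l"
  using chi_nonneg[OF assms(1)] assms(2) by (auto simp: truncated_def indicator_def)

abbreviation truncated_mean :: "real \<Rightarrow> real" where
  "truncated_mean l \<equiv> (LINT x|M. truncated chi l x)"

abbreviation exceed_prob :: "real \<Rightarrow> real" where
  "exceed_prob l \<equiv> prob {x \<in> space M. l < chi x}"

lemma truncated_mean_nonneg: "0 \<le> l \<Longrightarrow> 0 \<le> truncated_mean l"
  by (intro integral_nonneg_AE AE_I2 truncated_bounds)

lemma one_minus_dist_fun: "1 - dist_fun M chi l = exceed_prob l"
proof -
  have "dist_fun M chi l = 1 - exceed_prob l"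
    unfolding dist_fun_def by (subst prob_compl[symmetric]) (auto intro!: arg_cong[where f = prob])
  then show ?thesis by simp
qed

lemma interval_measure_dist_fun: "interval_measure (dist_fun M chi) = distr M borel chi"
proof -
  interpret R: real_distribution "distr M borel chi" by simp
  have "dist_fun M chi = cdf (distr M borel chi)"
    by (auto simp: dist_fun_def cdf_def measure_distr fun_eq_iff intro!: arg_cong[where f = prob])
  then show ?thesis using R.interval_measure_cdf by simp
qed

lemma integral_dist_fun:
  "(LINT x:{0..l}|interval_measure (dist_fun M chi). x) = truncated_mean l"
proof -
  have "(LINT x:{0..l}|interval_measure (dist_fun M chi). x) = (LINT x|M. indicator {0..l} (chi x) *\<^sub>R chi x)"
    unfolding interval_measure_dist_fun set_lebesgue_integral_def by (rule integral_distr) auto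
  also have "\<dots> = truncated_mean l"
    by (intro Bochner_Integration.integral_cong refl) (use chi_nonneg in \<open>auto simp: truncated_def indicator_def\<close>)
  finally show ?thesis .
qed

definition exceed_count :: "nat \<Rightarrow> real \<Rightarrow> 'a \<Rightarrow> real" where
  "exceed_count n l x = real (card {k. k < n \<and> l < chi ((T ^^ k) x)})"

lemma exceed_count_eq_sum: "exceed_count n l x = (\<Sum>k<n. indicator {y. l < chi y} ((T ^^ k) x))"
proof -
  have "(\<Sum>k<n. indicator {y. l < chi y} ((T ^^ k) x)) = (\<Sum>k<n. if l < chi ((T ^^ k) x) then 1 else (0::real))"
    by (intro sum.cong) (auto simp: indicator_def)
  also have "\<dots> = real (card {k. k < n \<and> l < chi ((T ^^ k) x)})"
    by (simp add: sum.If_cases Int_def)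
  finally show ?thesis by (simp add: exceed_count_def)
qed

lemma exceed_count_mono:
  "n \<le> n' \<Longrightarrow> l' \<le> l \<Longrightarrow> exceed_count n l x \<le> exceed_count n' l' x"
  unfolding exceed_count_def by (auto intro!: card_mono)

text \<open>Both the indicators and the truncations divided by l take values in [0, 1] and have norm
  at most max K1 K2. The level drops out, so s0 and B serve all levels at once; this is how Property
  D enters.\<close>

lemma birkhoff_tails:
  obtains s0 B where "s0 > 0" "B > 0"
    "\<And>l s t n. 0 < l \<Longrightarrow> 0 < s \<Longrightarrow> s \<le> s0 \<Longrightarrow> 0 \<le> t \<Longrightarrow>
      prob {x \<in> space M. t \<le> \<bar>exceed_count n l x - real n * exceed_prob l\<bar>}
        \<le> 2 * exp (B * s\<^sup>2 * (real n * exceed_prob l) - s * t / 2)"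
    "\<And>l s t n. 0 < l \<Longrightarrow> 0 < s \<Longrightarrow> s \<le> s0 \<Longrightarrow> 0 \<le> t \<Longrightarrow>
      prob {x \<in> space M. t * l \<le> \<bar>(\<Sum>k<n. truncated chi l ((T ^^ k) x)) - real n * truncated_mean l\<bar>}
        \<le> 2 * exp (B * s\<^sup>2 * (real n * truncated_mean l / l) - s * t / 2)"
proof -
  obtain K1 K2 where K: "K1 > 0" "K2 > 0"
    and *: "\<And>l. l > 0 \<Longrightarrow> (\<lambda>x. complex_of_real (truncated chi l x)) \<in> \<F> \<and>
        nrm (\<lambda>x. complex_of_real (truncated chi l x)) \<le> K1 * l \<and>
        (indicator {y. chi y > l} :: 'a \<Rightarrow> complex) \<in> \<F> \<and> nrm (indicator {y. chi y > l}) \<le> K2"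
    using propD unfolding property_D_def by metis
  have Kmax: "max K1 K2 > 0" using K by simp
  obtain s0 B where s0: "s0 > 0" and B: "B > 0" and tail:
    "\<And>X s n t. (\<lambda>x. complex_of_real (X x)) \<in> \<F> \<Longrightarrow> nrm (\<lambda>x. complex_of_real (X x)) \<le> max K1 K2 \<Longrightarrow>
       (\<And>x. x \<in> space M \<Longrightarrow> 0 \<le> X x \<and> X x \<le> 1) \<Longrightarrow> 0 < s \<Longrightarrow> s \<le> s0 \<Longrightarrow> 0 \<le> t \<Longrightarrow>
       prob {x \<in> space M. \<bar>(\<Sum>k<n. X ((T ^^ k) x)) - real n * (LINT x|M. X x)\<bar> \<ge> t}
         \<le> 2 * exp (B * s\<^sup>2 * (real n * (LINT x|M. X x)) - s * t / 2)"
  proof (rule birkhoff_tail[OF Kmax])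
    fix s0 B :: real
    assume "0 < s0" "0 < B" "\<And>X s n t. (\<lambda>x. complex_of_real (X x)) \<in> \<F> \<Longrightarrow> nrm (\<lambda>x. complex_of_real (X x)) \<le> max K1 K2 \<Longrightarrow>
       (\<And>x. x \<in> space M \<Longrightarrow> 0 \<le> X x \<and> X x \<le> 1) \<Longrightarrow> 0 < s \<Longrightarrow> s \<le> s0 \<Longrightarrow> 0 \<le> t \<Longrightarrow>
       prob {x \<in> space M. \<bar>(\<Sum>k<n. X ((T ^^ k) x)) - real n * (LINT x|M. X x)\<bar> \<ge> t}
         \<le> 2 * exp (B * s\<^sup>2 * (real n * (LINT x|M. X x)) - s * t / 2)"
    then show thesis by (rule that)
  qed
  show thesis
  proof (rule that[OF s0 B])
    fix l s t :: real and n :: nat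
    assume l: "0 < l" and s: "0 < s" "s \<le> s0" and t: "0 \<le> t"
    have ind: "(\<lambda>x. complex_of_real (indicator {y. chi y > l} x)) = indicator {y. chi y > l}"
      by (auto simp: indicator_def fun_eq_iff)
    have mean: "(LINT x|M. indicator {y. chi y > l} x) = exceed_prob l"
    proof -
      have "(LINT x|M. indicator {y. chi y > l} x) = (LINT x|M. indicator {x \<in> space M. l < chi x} x)"
        by (intro Bochner_Integration.integral_cong) (auto simp: indicator_def)
      also have "\<dots> = measure M ({x \<in> space M. l < chi x} \<inter> space M)" by simp
      also have "{x \<in> space M. l < chi x} \<inter> space M = {x \<in> space M. l < chi x}" by auto
      finally show ?thesis .
    qed
    show "prob {x \<in> space M. t \<le> \<bar>exceed_count n l x - real n * exceed_prob l\<bar>}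
        \<le> 2 * exp (B * s\<^sup>2 * (real n * exceed_prob l) - s * t / 2)"
      using tail[of "indicator {y. chi y > l}" s t n] *[OF l] s t
      unfolding ind mean exceed_count_eq_sum by (auto simp: indicator_def)
    have sc: "(\<lambda>x. complex_of_real (truncated chi l x / l)) = (\<lambda>x. of_real (1 / l) * complex_of_real (truncated chi l x))"
      by (simp add: fun_eq_iff)
    have F: "(\<lambda>x. complex_of_real (truncated chi l x / l)) \<in> \<F>"
      unfolding sc by (intro scale_closed) (use *[OF l] in blast)
    have "nrm (\<lambda>x. complex_of_real (truncated chi l x / l)) = 1 / l * nrm (\<lambda>x. complex_of_real (truncated chi l x))"
      unfolding sc using *[OF l] l by (subst nrm_scale) (auto simp del: of_real_divide)
    also have "\<dots> \<le> 1 / l * (K1 * l)" using *[OF l] l by (intro mult_left_mono) auto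
    also have "\<dots> = K1" using l by simp
    finally have nF: "nrm (\<lambda>x. complex_of_real (truncated chi l x / l)) \<le> max K1 K2" by simp
    have iff: "(t \<le> \<bar>(\<Sum>k<n. truncated chi l ((T ^^ k) x) / l) - real n * (truncated_mean l / l)\<bar>) \<longleftrightarrow>
       (t * l \<le> \<bar>(\<Sum>k<n. truncated chi l ((T ^^ k) x)) - real n * truncated_mean l\<bar>)" for x
    proof -
      have "(\<Sum>k<n. truncated chi l ((T ^^ k) x) / l) - real n * (truncated_mean l / l)
          = ((\<Sum>k<n. truncated chi l ((T ^^ k) x)) - real n * truncated_mean l) / l"
        by (simp add: sum_divide_distrib diff_divide_distrib)
      then show ?thesis using l by (simp add: abs_divide pos_le_divide_eq)
    qed
    have mean': "(LINT x|M. truncated chi l x / l) = truncated_mean l / l" by simp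
    show "prob {x \<in> space M. t * l \<le> \<bar>(\<Sum>k<n. truncated chi l ((T ^^ k) x)) - real n * truncated_mean l\<bar>}
        \<le> 2 * exp (B * s\<^sup>2 * (real n * truncated_mean l / l) - s * t / 2)"
      using tail[OF F nF _ s t, of n] truncated_bounds[of _ l] l
      unfolding mean' iff by simp
  qed
qed

text \<open>After division by f n the expected sum is D = d n / f n. A deviation of \<eta> D has
  tail exponent at most - s \<eta> D / 4, for a fixed s depending on \<eta>. As D / ln n tends to
  infinity, this makes the tails summable.\<close>

lemma truncated_sum_law:
  fixes f d :: "nat \<Rightarrow> real"
  assumes f: "\<And>n. n \<ge> 1 \<Longrightarrow> 0 < f n"
    and d: "d = (\<lambda>n. real n * truncated_mean (f n))" and d0: "eventually (\<lambda>n. d n \<noteq> 0) sequentially"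
    and lim: "(\<lambda>n. f n / d n * ln (real n)) \<longlonglongrightarrow> 0"
  shows "AE x in M. (\<lambda>n. (\<Sum>k<n. truncated chi (f n) ((T ^^ k) x)) / d n) \<longlonglongrightarrow> 1"
proof -
  obtain s0 B where s0: "s0 > 0" and B: "B > 0" and tail:
    "\<And>l s t n. 0 < l \<Longrightarrow> 0 < s \<Longrightarrow> s \<le> s0 \<Longrightarrow> 0 \<le> t \<Longrightarrow>
      prob {x \<in> space M. t * l \<le> \<bar>(\<Sum>k<n. truncated chi l ((T ^^ k) x)) - real n * truncated_mean l\<bar>}
        \<le> 2 * exp (B * s\<^sup>2 * (real n * truncated_mean l / l) - s * t / 2)"
    by (rule birkhoff_tails, rule that)
  define S where "S n x = (\<Sum>k<n. truncated chi (f n) ((T ^^ k) x))" for n x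
  have [measurable]: "S n \<in> borel_measurable M" for n unfolding S_def by measurable
  \<comment> \<open>The convention x / 0 = 0 would let \<open>lim\<close> hold trivially where d
    vanishes; \<open>d0\<close> turns it into a growth condition.\<close>
  have d_pos: "eventually (\<lambda>n. 0 < d n \<and> n \<ge> 1) sequentially"
    using d0 eventually_ge_at_top[of 1]
  proof eventually_elim
    case (elim n)
    have "0 \<le> d n" unfolding d using truncated_mean_nonneg[of "f n"] f[of n] elim by (auto simp: less_imp_le)
    with elim show ?case by auto
  qed
  have AE_dev: "AE x in M. eventually (\<lambda>n. \<bar>S n x - d n\<bar> < \<eta> * d n) sequentially" if \<eta>: "\<eta> > 0" for \<eta>
  proof -
    \<comment> \<open>Holds the quadratic term B s^2 D to s \<eta> D / 4, half of the linear one;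
      the other half exceeds 2 ln n once f n / d n * ln n < s \<eta> / 8.\<close>
    define s where "s = min s0 (\<eta> / (4 * B))"
    have s: "0 < s" "s \<le> s0" using s0 B \<eta> by (auto simp: s_def)
    have sB: "B * s \<le> \<eta> / 4"
    proof -
      have "B * s \<le> B * (\<eta> / (4 * B))" using B by (intro mult_left_mono) (auto simp: s_def)
      then show ?thesis using B by simp
    qed
    define A where "A n = {x \<in> space M. \<eta> * d n \<le> \<bar>S n x - d n\<bar>}" for n
    have A_bound: "eventually (\<lambda>n. norm (prob (A n)) \<le> 2 * real n powr - 2) sequentially"
    proof -
      have "eventually (\<lambda>n. f n / d n * ln (real n) < s * \<eta> / 8) sequentially"
        using order_tendstoD(2)[OF lim, of "s * \<eta> / 8"] s \<eta> by simp
      then show ?thesis using d_pos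
      proof eventually_elim
        case (elim n)
        have fn: "0 < f n" using f elim by simp
        define D where "D = d n / f n"
        have D: "D > 0" "d n = D * f n" using fn elim by (auto simp: D_def)
        have "ln (real n) / D < s * \<eta> / 8" using elim(1) D fn by (simp add: field_simps)
        then have ln: "8 * ln (real n) < s * \<eta> * D" using D by (simp add: field_simps)
        have "prob (A n) \<le> 2 * exp (B * s\<^sup>2 * (real n * truncated_mean (f n) / f n) - s * (\<eta> * D) / 2)"
          using tail[OF fn s, of "\<eta> * D" n, unfolded mult.assoc D(2)[symmetric]] D(1) \<eta>
          by (simp only: A_def S_def d mult.assoc) simp
        also have "real n * truncated_mean (f n) / f n = D" by (simp add: D_def d)
        also have "B * s\<^sup>2 * D - s * (\<eta> * D) / 2 \<le> - 2 * ln (real n)"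
        proof -
          have "(B * s) * (s * D) \<le> (\<eta> / 4) * (s * D)" using sB s D by (intro mult_right_mono) auto
          then have "B * s\<^sup>2 * D \<le> s * \<eta> * D / 4" by (simp add: power2_eq_square mult_ac)
          then show ?thesis using ln by (simp add: mult_ac)
        qed
        also have "exp (- 2 * ln (real n)) = real n powr - 2" using elim(2) by (simp add: powr_def)
        finally show ?case by simp
      qed
    qed
    have "summable (\<lambda>n. 2 * real n powr - 2)"
      by (intro summable_mult) (simp add: summable_real_powr_iff)
    then have "summable (\<lambda>n. prob (A n))"
      using A_bound by (rule summable_comparison_test_ev[rotated])
    then have "AE x in M. eventually (\<lambda>n. x \<in> space M - A n) sequentially"
      by (intro borel_cantelli_AE1) (auto simp: A_def less_top[symmetric])
    then show ?thesis
      by eventually_elim (auto elim!: eventually_mono simp: A_def)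
  qed
  have "AE x in M. \<forall>i. eventually (\<lambda>n. \<bar>S n x - d n\<bar> < 1 / real (Suc i) * d n) sequentially"
    unfolding AE_all_countable by (intro allI AE_dev) simp
  then show ?thesis
  proof eventually_elim
    case (elim x)
    show ?case unfolding S_def[symmetric]
    proof (rule tendstoI)
      fix e :: real assume "e > 0"
      then obtain i where i: "1 / real (Suc i) < e" using nat_approx_posE by blast
      have "eventually (\<lambda>n. \<bar>S n x - d n\<bar> < 1 / real (Suc i) * d n) sequentially" using elim by blast
      then show "eventually (\<lambda>n. dist (S n x / d n) 1 < e) sequentially" using d_pos
      proof eventually_elim
        case (elim n)
        have "S n x / d n - 1 = (S n x - d n) / d n" using elim by (simp add: diff_divide_distrib)
        then have "dist (S n x / d n) 1 = \<bar>S n x - d n\<bar> / d n" using elim by (simp add: dist_real_def abs_divide)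
        also have "\<dots> < 1 / real (Suc i)" using elim by (simp add: pos_divide_less_eq)
        finally show ?case using i by simp
      qed
    qed
  qed
qed

end

section \<open>Counting large terms\<close>

text \<open>The weight 2 m + 1 counts the values of i for a given m in the classes below. The lemma
  is applied with e = 2 \<epsilon>.\<close>

lemma summable_stretched_exp:
  fixes e :: real
  assumes e: "e > 0"
  shows "summable (\<lambda>m. (2 * real m + 1) * exp (- 2 * max 1 (real m) powr e))"
proof (rule summable_comparison_test_bigo)
  show "summable (\<lambda>m. norm (real m powr - 2))" by (simp add: summable_real_powr_iff)
  have "(\<lambda>x::real. (2 * x + 1) * exp (- 2 * x powr e)) \<in> O(\<lambda>x. x powr - 2)"
    using e by real_asymp
  then have "(\<lambda>m. (2 * real m + 1) * exp (- 2 * real m powr e)) \<in> O(\<lambda>m. real m powr - 2)"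
    by (rule landau_o.big.compose) (rule filterlim_real_sequentially)
  moreover have "eventually (\<lambda>m. (2 * real m + 1) * exp (- 2 * max 1 (real m) powr e)
      = (2 * real m + 1) * exp (- 2 * real m powr e)) sequentially"
    using eventually_ge_at_top[of 1] by eventually_elim (simp add: max_def)
  ultimately show "(\<lambda>m. (2 * real m + 1) * exp (- 2 * max 1 (real m) powr e)) \<in> O(\<lambda>m. real m powr - 2)"
    by (simp only: landau_o.big.in_cong)
qed

text \<open>Indices \<open>n\<close> of one dyadic block are sorted into classes on which both \<open>n\<close> and \<open>n p n\<close>
  are constant up to an error \<open>O(ln j)\<close>.\<close>

definition index_class :: "(nat \<Rightarrow> real) \<Rightarrow> nat \<Rightarrow> nat \<Rightarrow> nat \<Rightarrow> nat set" where
  "index_class p j m i = {n. 2 ^ j \<le> n \<and> n < 2 ^ Suc j \<and>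
     m = nat \<lfloor>2 ^ j * p n / ln (real j)\<rfloor> \<and> i = n * m div 2 ^ j}"

lemma index_class_prob_bounds:
  assumes n: "n \<in> index_class p j m i" and p: "0 \<le> p n" and j: "ln (real j) > 0"
  shows "real m * ln (real j) \<le> 2 ^ j * p n" "2 ^ j * p n \<le> (real m + 1) * ln (real j)"
proof -
  define y where "y = 2 ^ j * p n / ln (real j)"
  have "y \<ge> 0" using p j by (simp add: y_def)
  moreover have "m = nat \<lfloor>y\<rfloor>" using n by (simp add: index_class_def y_def)
  ultimately have "real m \<le> y" "y \<le> real m + 1" by linarith+
  then show "real m * ln (real j) \<le> 2 ^ j * p n" "2 ^ j * p n \<le> (real m + 1) * ln (real j)"
    using j by (simp_all add: y_def field_simps)
qed

text \<open>Fixing i = n m div 2^j pins n down up to 2^j / m. For m = 0 this gives no information,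
  but the block itself has length 2^j; hence the maximum with 1.\<close>

lemma index_class_index_bounds:
  assumes n: "n \<in> index_class p j m i" "n' \<in> index_class p j m i"
  shows "\<bar>real n - real n'\<bar> * max 1 (real m) \<le> 2 ^ j"
proof (cases "m = 0")
  case True
  have "2 ^ j \<le> n" "n < 2 * 2 ^ j" "2 ^ j \<le> n'" "n' < 2 * 2 ^ j" using n by (auto simp: index_class_def)
  then have "real (2 ^ j) \<le> real n" "real n < real (2 * 2 ^ j)" "real (2 ^ j) \<le> real n'" "real n' < real (2 * 2 ^ j)"
    by (simp_all only: of_nat_le_iff of_nat_less_iff)
  then have "\<bar>real n - real n'\<bar> \<le> 2 ^ j"
    unfolding of_nat_mult of_nat_power of_nat_numeral by linarith
  then show ?thesis using True by simp
next
  case False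
  have i: "n * m div 2 ^ j = i" "n' * m div 2 ^ j = i" using n by (auto simp: index_class_def)
  have *: "a * m < b * m + 2 ^ j" if "a * m div 2 ^ j = i" "b * m div 2 ^ j = i" for a b
  proof -
    have "a * m < (Suc i) * 2 ^ j" using that(1) by (metis dividend_less_div_times mult.commute mult_Suc zero_less_numeral zero_less_power add.commute)
    moreover have "i * 2 ^ j \<le> b * m" using that(2) by (metis div_times_less_eq_dividend)
    ultimately show ?thesis by simp
  qed
  have "real (n * m) < real (n' * m + 2 ^ j)" "real (n' * m) < real (n * m + 2 ^ j)"
    using *[OF i] *[OF i(2,1)] by (simp_all only: of_nat_less_iff)
  then have "\<bar>real n * real m - real n' * real m\<bar> \<le> 2 ^ j" by simp
  then show ?thesis using False by (simp add: max_def abs_mult left_diff_distrib[symmetric] del: of_nat_mult)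
qed

text \<open>Moving the index by at most 2^j / max 1 m costs 2 ln j, as p n2 is at most (m + 1) ln j
  / 2^j; moving the probability by at most ln j / 2^j costs another 2 ln j. Index and level may come
  from different members n1 and n2, as the extreme pairs require.\<close>

lemma index_class_mean_diff:
  assumes n: "n \<in> index_class p j m i" "n1 \<in> index_class p j m i" "n2 \<in> index_class p j m i"
    and p: "\<And>k. 0 \<le> p k" and j: "ln (real j) > 0"
  shows "\<bar>real n1 * p n2 - real n * p n\<bar> \<le> 4 * ln (real j)"
proof -
  let ?L = "ln (real j)" and ?\<mu> = "max 1 (real m)"
  note b = index_class_prob_bounds[OF n(1) p j] index_class_prob_bounds[OF n(3) p j]
  have "2 ^ j * (\<bar>real n1 - real n\<bar> * p n2) \<le> \<bar>real n1 - real n\<bar> * ((real m + 1) * ?L)"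
    using mult_left_mono[OF b(4), of "\<bar>real n1 - real n\<bar>"] by (simp add: mult_ac)
  also have "\<dots> \<le> \<bar>real n1 - real n\<bar> * ((2 * ?\<mu>) * ?L)"
    using j by (intro mult_left_mono mult_right_mono) auto
  also have "\<dots> = (\<bar>real n1 - real n\<bar> * ?\<mu>) * (2 * ?L)" by simp
  also have "\<dots> \<le> 2 ^ j * (2 * ?L)"
    using j by (intro mult_right_mono index_class_index_bounds[OF n(2,1)]) auto
  finally have 1: "\<bar>real n1 - real n\<bar> * p n2 \<le> 2 * ?L" by simp
  have "n < 2 * 2 ^ j" using n by (simp add: index_class_def)
  then have "real n < real (2 * 2 ^ j)" by (simp only: of_nat_less_iff)
  then have nj: "real n \<le> 2 * 2 ^ j" by simp
  have "2 ^ j * \<bar>p n2 - p n\<bar> = \<bar>2 ^ j * p n2 - 2 ^ j * p n\<bar>" by (simp add: abs_mult right_diff_distrib[symmetric])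
  also have "\<dots> \<le> ?L" using b by (simp add: algebra_simps abs_le_iff)
  finally have d: "2 ^ j * \<bar>p n2 - p n\<bar> \<le> ?L" .
  have "real n * \<bar>p n2 - p n\<bar> \<le> 2 * 2 ^ j * \<bar>p n2 - p n\<bar>" using nj by (intro mult_right_mono) auto
  also have "\<dots> \<le> 2 * ?L" using d by simp
  finally have 2: "real n * \<bar>p n2 - p n\<bar> \<le> 2 * ?L" .
  have "real n1 * p n2 - real n * p n = (real n1 - real n) * p n2 + real n * (p n2 - p n)"
    by (simp add: algebra_simps)
  then have "\<bar>real n1 * p n2 - real n * p n\<bar> \<le> \<bar>real n1 - real n\<bar> * p n2 + real n * \<bar>p n2 - p n\<bar>"
    using abs_triangle_ineq[of "(real n1 - real n) * p n2" "real n * (p n2 - p n)"] p[of n2]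
    by (simp add: abs_mult)
  with 1 2 show ?thesis by simp
qed

lemma index_class_finite: "finite (index_class p j m i)"
  by (rule finite_subset[of _ "{..<2 ^ Suc j}"]) (auto simp: index_class_def)

lemma index_class_parameters:
  assumes n: "n \<in> index_class p j m i" and p: "0 \<le> p n" "p n \<le> 1" and j: "ln (real j) \<ge> 1"
  shows "m \<le> 2 ^ j" "i \<le> 2 * m"
proof -
  have "real m * 1 \<le> real m * ln (real j)" using j by (intro mult_left_mono) auto
  also have "\<dots> \<le> 2 ^ j * p n" using index_class_prob_bounds[OF n p(1)] j by simp
  also have "\<dots> \<le> 2 ^ j" using p by (simp add: mult_left_le)
  finally have "real m \<le> real (2 ^ j)" by simp
  then show "m \<le> 2 ^ j" by (simp only: of_nat_le_iff)
  have "n \<le> 2 * 2 ^ j" "i = n * m div 2 ^ j" using n by (auto simp: index_class_def)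
  moreover from this(1) have "n * m \<le> (2 * m) * 2 ^ j" using mult_le_mono1[of n "2 * 2 ^ j" m] by (simp add: mult_ac)
  ultimately have "i \<le> (2 * m) * 2 ^ j div 2 ^ j" by (simp only: div_le_mono)
  then show "i \<le> 2 * m" by simp
qed

text \<open>With L = ln j, the left side splits as (m L)^(1/2 + \<epsilon>) L^(1/2 - \<epsilon>) for
  m >= 1; then m L <= a, and L is at most 2 ln ln n. For m = 0 the second entry of the maximum takes
  over.\<close>

lemma deviation_scale_bound:
  fixes \<epsilon> a :: real
  assumes \<epsilon>: "0 < \<epsilon>" "\<epsilon> < 1/4" and j: "j \<ge> 4" and n: "2 ^ j \<le> n" and a: "real m * ln (real j) \<le> a"
  shows "ln (real j) * max 1 (real m) powr (1/2 + \<epsilon>)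
    \<le> 2 * max (a powr (1/2 + \<epsilon>) * ln (ln (real n)) powr (1/2 - \<epsilon>)) (ln (ln (real n)))"
proof -
  let ?L = "ln (real j)"
  have L0: "?L > 0" using j by simp
  have lnn: "real j * ln 2 \<le> ln (real n)"
  proof -
    have "real (2 ^ j) \<le> real n" using n by (simp only: of_nat_le_iff)
    then have "ln (real (2 ^ j)) \<le> ln (real n)"
      by (intro iffD2[OF ln_le_cancel_iff]) (auto intro: less_le_trans[of 0 "2 ^ j"])
    then show ?thesis by (simp add: ln_realpow)
  qed
  have "real j * (1/2) \<le> real j * ln 2" using ln2_ge_two_thirds by (intro mult_left_mono) auto
  then have "real j / 2 \<le> ln (real n)" using lnn by linarith
  then have "ln (real j / 2) \<le> ln (ln (real n))" using j by simp
  moreover have "ln (real j / 2) = ?L - ln 2" using j by (simp add: ln_div)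
  \<comment> \<open>Here j >= 4 is used: ln (j / 2) = ln j - ln 2 is then at least half of ln
    j.\<close>
  moreover have "2 * ln 2 \<le> ?L"
  proof -
    have "2 * ln (2::real) = ln (2 ^ 2)" by (simp only: ln_realpow of_nat_numeral)
    also have "\<dots> \<le> ?L" using j by simp
    finally show ?thesis .
  qed
  ultimately have LL: "?L / 2 \<le> ln (ln (real n))" by linarith
  show ?thesis
  proof (cases "m = 0")
    case True
    then show ?thesis using LL by simp
  next
    case False
    \<comment> \<open>The factor 1/2 is enlarged to its power 1/2 - \<epsilon>, so that it can join
      L to form (L / 2)^(1/2 - \<epsilon>).\<close>
    have "real m powr (1/2 + \<epsilon>) * ?L / 2 = real m powr (1/2 + \<epsilon>) * ?L * (1/2) powr 1" by simp
    also have "\<dots> \<le> real m powr (1/2 + \<epsilon>) * ?L * (1/2) powr (1/2 - \<epsilon>)"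
      using L0 \<epsilon> by (intro mult_left_mono powr_mono') auto
    also have "\<dots> = real m powr (1/2 + \<epsilon>) * (?L powr (1/2 + \<epsilon>) * ?L powr (1/2 - \<epsilon>)) * (1/2) powr (1/2 - \<epsilon>)"
      using L0 by (simp flip: powr_add)
    also have "\<dots>
        = (real m * ?L) powr (1/2 + \<epsilon>) * (?L / 2) powr (1/2 - \<epsilon>)"
      using L0 powr_mult[of ?L "1/2" "1/2 - \<epsilon>"] by (simp add: powr_mult)
    also have "\<dots> \<le> a powr (1/2 + \<epsilon>) * ln (ln (real n)) powr (1/2 - \<epsilon>)"
      using a LL L0 \<epsilon> by (intro mult_mono powr_mono2) auto
    finally have "?L * real m powr (1/2 + \<epsilon>) \<le> 2 * (a powr (1/2 + \<epsilon>) * ln (ln (real n)) powr (1/2 - \<epsilon>))"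
      by (simp add: mult_ac)
    moreover have "max 1 (real m) = real m" using False by simp
    ultimately show ?thesis by (simp only: max_mult_distrib_left) simp
  qed
qed

section \<open>Almost sure bounds for the exceedance counts\<close>

context trimmed_system
begin

text \<open>With \<mu> = max 1 m and L = ln j, the mean count is at most 4 \<mu> L, so s = s0
  \<mu>^(\<epsilon> - 1/2) makes both parts of the exponent multiples of L \<mu>^(2 \<epsilon>). On
  the right, the first exponential is meant for the sum over blocks j, the second for the sum over
  classes.\<close>

lemma exceed_count_class_tail:
  fixes s0 B \<epsilon> :: real and f :: "nat \<Rightarrow> real"
  assumes s0: "s0 > 0" and B: "B > 0" and tail:
    "\<And>l s t n. 0 < l \<Longrightarrow> 0 < s \<Longrightarrow> s \<le> s0 \<Longrightarrow> 0 \<le> t \<Longrightarrow>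
      prob {x \<in> space M. t \<le> \<bar>exceed_count n l x - real n * exceed_prob l\<bar>}
        \<le> 2 * exp (B * s\<^sup>2 * (real n * exceed_prob l) - s * t / 2)"
    and \<epsilon>: "0 < \<epsilon>" "\<epsilon> < 1/4" and j: "ln (real j) \<ge> 1"
    and ab: "a \<in> index_class (\<lambda>n. exceed_prob (f n)) j m i" "b \<in> index_class (\<lambda>n. exceed_prob (f n)) j m i"
    and fb: "0 < f b"
  shows "prob {x \<in> space M. (8 * B * s0\<^sup>2 + 8) / s0 * ln (real j) * max 1 (real m) powr (1/2 + \<epsilon>)
      \<le> \<bar>exceed_count a (f b) x - real a * exceed_prob (f b)\<bar>}
    \<le> 2 * exp (- 2 * ln (real j)) * exp (- 2 * max 1 (real m) powr (2 * \<epsilon>))"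
proof -
  define \<mu> where "\<mu> = max 1 (real m)"
  define L where "L = ln (real j)"
  define W where "W = (8 * B * s0\<^sup>2 + 8) / s0"
  define s where "s = s0 * \<mu> powr (\<epsilon> - 1/2)"
  define t where "t = W * L * \<mu> powr (1/2 + \<epsilon>)"
  have \<mu>: "\<mu> \<ge> 1" by (simp add: \<mu>_def)
  have L: "L \<ge> 1" using j by (simp add: L_def)
  have W: "W > 0" using s0 B by (simp add: W_def add_pos_pos)
  have "\<mu> powr (\<epsilon> - 1/2) \<le> \<mu> powr 0" using \<mu> \<epsilon> by (intro powr_mono) auto
  then have s: "0 < s" "s \<le> s0" using \<mu> s0 by (auto simp: s_def mult_left_le)
  have t: "0 \<le> t" using W L by (simp add: t_def)
  have "a < 2 * 2 ^ j" using ab by (simp add: index_class_def)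
  then have "real a < real (2 * 2 ^ j)" by (simp only: of_nat_less_iff)
  then have "real a * exceed_prob (f b) \<le> 2 * 2 ^ j * exceed_prob (f b)" by (intro mult_right_mono) auto
  also have "\<dots> = 2 * (2 ^ j * exceed_prob (f b))" by simp
  also have "\<dots> \<le> 2 * ((real m + 1) * L)"
    using index_class_prob_bounds(2)[OF ab(2)] L by (intro mult_left_mono) (auto simp: L_def)
  also have "\<dots> \<le> 2 * ((2 * \<mu>) * L)" using L by (intro mult_left_mono mult_right_mono) (auto simp: \<mu>_def)
  finally have mean: "real a * exceed_prob (f b) \<le> 4 * \<mu> * L" by simp
  have "s\<^sup>2 = s0\<^sup>2 * \<mu> powr (2 * \<epsilon> - 1)"
    by (simp add: s_def power_mult_distrib power2_eq_square powr_add[symmetric])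
  also have "\<mu> powr (2 * \<epsilon> - 1) = \<mu> powr (2 * \<epsilon>) / \<mu>" using \<mu> by (simp add: powr_diff)
  finally have s2: "s\<^sup>2 = s0\<^sup>2 * (\<mu> powr (2 * \<epsilon>) / \<mu>)" .
  have "B * s\<^sup>2 * (real a * exceed_prob (f b)) \<le> B * s\<^sup>2 * (4 * \<mu> * L)"
    using B by (intro mult_left_mono mean) auto
  also have "\<dots> = 4 * B * s0\<^sup>2 * (L * \<mu> powr (2 * \<epsilon>))"
    unfolding s2 using \<mu> by simp
  finally have e1: "B * s\<^sup>2 * (real a * exceed_prob (f b)) \<le> 4 * B * s0\<^sup>2 * (L * \<mu> powr (2 * \<epsilon>))" .
  have "s * t = s0 * W * L * (\<mu> powr (\<epsilon> - 1/2) * \<mu> powr (1/2 + \<epsilon>))" by (simp add: s_def t_def)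
  also have "\<mu> powr (\<epsilon> - 1/2) * \<mu> powr (1/2 + \<epsilon>) = \<mu> powr (2 * \<epsilon>)" by (simp add: powr_add[symmetric])
  also have "s0 * W = 8 * B * s0\<^sup>2 + 8" using s0 by (simp add: W_def)
  finally have e2: "s * t / 2 = (4 * B * s0\<^sup>2 + 4) * (L * \<mu> powr (2 * \<epsilon>))" by (simp add: algebra_simps)
  have \<mu>1: "\<mu> powr (2 * \<epsilon>) \<ge> 1" using \<mu> \<epsilon> by (simp add: ge_one_powr_ge_zero)
  have "L * 1 \<le> L * \<mu> powr (2 * \<epsilon>)" "1 * \<mu> powr (2 * \<epsilon>) \<le> L * \<mu> powr (2 * \<epsilon>)"
    using L \<mu>1 by (intro mult_left_mono mult_right_mono; simp)+
  \<comment> \<open>The choice of W leaves -4 L \<mu>^(2 \<epsilon>), shared equally between L and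
    \<mu>^(2 \<epsilon>), both of which are at least 1.\<close>
  then have "B * s\<^sup>2 * (real a * exceed_prob (f b)) - s * t / 2 \<le> - 2 * L + - 2 * \<mu> powr (2 * \<epsilon>)"
    using e1 e2 by (simp add: algebra_simps)
  then have "2 * exp (B * s\<^sup>2 * (real a * exceed_prob (f b)) - s * t / 2) \<le> 2 * (exp (- 2 * L) * exp (- 2 * \<mu> powr (2 * \<epsilon>)))"
    unfolding exp_add[symmetric] by simp
  with tail[OF fb s t, of a] show ?thesis
    by (simp add: t_def W_def L_def \<mu>_def)
qed

text \<open>f need not be monotone, so the counts at time n and level f n cannot be compared along n
  directly. Within a class they lie between the counts at two extreme pairs, whose means differ from
  n p n by at most 4 ln j.\<close>

lemma exceed_count_law:
  obtains W where "W > 0"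
    "\<And>\<epsilon> f. 0 < \<epsilon> \<Longrightarrow> \<epsilon> < 1/4 \<Longrightarrow> (\<And>n. n \<ge> 1 \<Longrightarrow> 0 < f n) \<Longrightarrow>
      AE x in M. eventually (\<lambda>n. \<bar>exceed_count n (f n) x - real n * exceed_prob (f n)\<bar>
        \<le> W * max ((real n * exceed_prob (f n)) powr (1/2 + \<epsilon>) * ln (ln (real n)) powr (1/2 - \<epsilon>)) (ln (ln (real n)))) sequentially"
proof -
  obtain s0 B where s0: "s0 > 0" and B: "B > 0" and tail:
    "\<And>l s t n. 0 < l \<Longrightarrow> 0 < s \<Longrightarrow> s \<le> s0 \<Longrightarrow> 0 \<le> t \<Longrightarrow>
      prob {x \<in> space M. t \<le> \<bar>exceed_count n l x - real n * exceed_prob l\<bar>}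
        \<le> 2 * exp (B * s\<^sup>2 * (real n * exceed_prob l) - s * t / 2)"
    by (rule birkhoff_tails, rule that)
  define W1 where "W1 = (8 * B * s0\<^sup>2 + 8) / s0"
  have W1: "W1 > 0" using s0 B by (simp add: W1_def add_pos_pos)
  show thesis
  \<comment> \<open>4 stems from the change of the mean within a class, \<open>W1\<close> from the
    deviation, and 2 from comparing ln j with ln ln n. None of them involves \<epsilon> or
    f.\<close>
  proof (rule that[of "2 * (4 + W1)"])
    show "2 * (4 + W1) > 0" using W1 by simp
    fix \<epsilon> :: real and f :: "nat \<Rightarrow> real"
    assume \<epsilon>: "0 < \<epsilon>" "\<epsilon> < 1/4" and f: "\<And>n. n \<ge> 1 \<Longrightarrow> 0 < f n"
    define p where "p n = exceed_prob (f n)" for n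
    have p: "0 \<le> p n" "p n \<le> 1" for n by (auto simp: p_def)
    define \<mu> where "\<mu> m = max 1 (real m)" for m :: nat
    define t where "t j m = W1 * ln (real j) * \<mu> m powr (1/2 + \<epsilon>)" for j m :: nat
    define Cl where "Cl = index_class p"
    have Clf: "finite (Cl j m i)" for j m i unfolding Cl_def by (rule index_class_finite)
    have Cl1: "n \<ge> 1" if "n \<in> Cl j m i" for n j m i
    proof -
      have "2 ^ j \<le> n" using that by (simp add: Cl_def index_class_def)
      then show ?thesis using order_trans[OF one_le_power[of "2::nat" j]] by simp
    qed
    \<comment> \<open>The pair n1, n2 (latest time, lowest level) bounds the counts of the class
      from above, the pair n3, n4 (earliest time, highest level) from below.\<close>
    define n1 where "n1 j m i = Max (Cl j m i)" for j m i
    define n2 where "n2 j m i = arg_min_on f (Cl j m i)" for j m i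
    define n3 where "n3 j m i = Min (Cl j m i)" for j m i
    define n4 where "n4 j m i = arg_min_on (\<lambda>n. - f n) (Cl j m i)" for j m i
    have rep: "n1 j m i \<in> Cl j m i" "n2 j m i \<in> Cl j m i" "n3 j m i \<in> Cl j m i" "n4 j m i \<in> Cl j m i"
      if "Cl j m i \<noteq> {}" for j m i
      using Clf[of j m i] that arg_min_if_finite(1)[OF Clf[of j m i] that]
      by (simp_all add: n1_def n2_def n3_def n4_def)
    have ext: "n \<le> n1 j m i" "f (n2 j m i) \<le> f n" "n3 j m i \<le> n" "f n \<le> f (n4 j m i)"
      if n: "n \<in> Cl j m i" for n j m i
    proof -
      have ne: "Cl j m i \<noteq> {}" using n by blast
      show "n \<le> n1 j m i" "n3 j m i \<le> n" using Clf n by (auto simp: n1_def n3_def)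
      show "f (n2 j m i) \<le> f n" unfolding n2_def by (rule arg_min_least[OF Clf ne n])
      show "f n \<le> f (n4 j m i)" unfolding n4_def using arg_min_least[OF Clf ne n, of "\<lambda>n. - f n"] by simp
    qed
    define E where "E j m a b = {x \<in> space M. t j m \<le> \<bar>exceed_count a (f b) x - real a * p b\<bar>}" for j m a b
    have E_meas [measurable]: "E j m a b \<in> sets M" for j m a b
      unfolding E_def exceed_count_eq_sum by measurable
    \<comment> \<open>The empty class is set apart because \<open>Max\<close>, \<open>Min\<close>
      and \<open>arg_min_on\<close> carry no information there.\<close>
    define G where "G j m i = (if Cl j m i = {} then {} else
        E j m (n1 j m i) (n2 j m i) \<union> E j m (n3 j m i) (n4 j m i))" for j m i
    have G_meas [measurable]: "G j m i \<in> sets M" for j m i unfolding G_def by auto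
    define q where "q m = exp (- 2 * \<mu> m powr (2 * \<epsilon>))" for m
    have E_prob: "prob (E j m a b) \<le> 2 * exp (- 2 * ln (real j)) * q m"
      if "ln (real j) \<ge> 1" "a \<in> Cl j m i" "b \<in> Cl j m i" for j m i a b
      using exceed_count_class_tail[OF s0 B tail \<epsilon> that(1), of a f m i b] that(2,3) f[OF Cl1[OF that(3)]]
      unfolding E_def t_def W1_def p_def Cl_def \<mu>_def q_def by simp
    have G_prob: "prob (G j m i) \<le> 4 * exp (- 2 * ln (real j)) * q m" if "ln (real j) \<ge> 1" for j m i
    proof (cases "Cl j m i = {}")
      case True
      then show ?thesis by (simp add: G_def q_def)
    next
      case False
      have "prob (G j m i) \<le> prob (E j m (n1 j m i) (n2 j m i)) + prob (E j m (n3 j m i) (n4 j m i))"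
        using False by (auto simp: G_def intro: measure_Un_le)
      also have "\<dots> \<le> 2 * exp (- 2 * ln (real j)) * q m + 2 * exp (- 2 * ln (real j)) * q m"
        by (rule add_mono[OF E_prob[OF that rep(1,2)[OF False]] E_prob[OF that rep(3,4)[OF False]]])
      finally show ?thesis by (simp add: mult_ac)
    qed
    \<comment> \<open>For j >= 3 these ranges contain all classes of the block. There are about 4^j
      pairs (m, i), but the factor \<open>q m\<close> keeps the total within a constant multiple of
      j^(-2).\<close>
    define U where "U j = (\<Union>m\<in>{..2 ^ j}. \<Union>i\<in>{..2 * m}. G j m i)" for j :: nat
    have U_meas: "U j \<in> sets M" for j unfolding U_def by measurable
    define S where "S = (\<Sum>m. (2 * real m + 1) * q m)"
    have sum_q: "summable (\<lambda>m. (2 * real m + 1) * q m)"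
      unfolding q_def \<mu>_def using \<epsilon> by (intro summable_stretched_exp) simp
    have j3: "ln (real j) \<ge> 1" if "j \<ge> 3" for j
    proof -
      have "exp 1 \<le> real j" using exp_le that by linarith
      then show ?thesis using that by (simp add: ln_ge_iff)
    qed
    have U_prob: "prob (U j) \<le> 4 * S * real j powr - 2" if j: "j \<ge> 3" for j
    proof -
      have "prob (U j) \<le> (\<Sum>m\<le>2 ^ j. prob (\<Union>i\<in>{..2 * m}. G j m i))"
        unfolding U_def by (intro measure_UNION_le) auto
      also have "\<dots> \<le> (\<Sum>m\<le>2 ^ j. \<Sum>i\<le>2 * m. prob (G j m i))"
        by (intro sum_mono measure_UNION_le) auto
      also have "\<dots> \<le> (\<Sum>m\<le>2 ^ j. \<Sum>i\<le>2 * m. 4 * exp (- 2 * ln (real j)) * q m)"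
        by (intro sum_mono G_prob j3 j)
      also have "\<dots> = 4 * exp (- 2 * ln (real j)) * (\<Sum>m\<le>2 ^ j. (2 * real m + 1) * q m)"
        by (simp add: sum_distrib_left mult_ac add.commute)
      also have "\<dots> \<le> 4 * exp (- 2 * ln (real j)) * S"
        unfolding S_def by (intro mult_left_mono sum_le_suminf sum_q) (auto simp: q_def)
      also have "exp (- 2 * ln (real j)) = real j powr - 2" using j by (simp add: powr_def)
      finally show ?thesis by (simp add: mult_ac)
    qed
    have "eventually (\<lambda>j. norm (prob (U j)) \<le> 4 * S * real j powr - 2) sequentially"
      using eventually_ge_at_top[of 3] by eventually_elim (simp add: U_prob)
    moreover have "summable (\<lambda>j. 4 * S * real j powr - 2)"
      by (intro summable_mult) (simp add: summable_real_powr_iff)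
    ultimately have "summable (\<lambda>j. prob (U j))"
      by (rule summable_comparison_test_ev)
    then have "AE x in M. eventually (\<lambda>j. x \<in> space M - U j) sequentially"
      by (intro borel_cantelli_AE1 U_meas) (auto simp: less_top[symmetric])
    then show "AE x in M. eventually (\<lambda>n. \<bar>exceed_count n (f n) x - real n * exceed_prob (f n)\<bar>
        \<le> 2 * (4 + W1) * max ((real n * exceed_prob (f n)) powr (1/2 + \<epsilon>) * ln (ln (real n)) powr (1/2 - \<epsilon>)) (ln (ln (real n)))) sequentially"
    proof eventually_elim
      case (elim x)
      then obtain J where J: "\<And>j. j \<ge> J \<Longrightarrow> x \<in> space M - U j" by (auto simp: eventually_sequentially)
      show ?case
        using eventually_ge_at_top[of "2 ^ max J 4"]
      proof eventually_elim
        case (elim n)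
        let ?N = "\<lambda>a b. exceed_count a (f b) x"
        have "n \<ge> 1" using elim order_trans[OF one_le_power[of "2::nat" "max J 4"]] by simp
        then obtain j where j: "2 ^ j \<le> n" "n < 2 ^ (j + 1)" using ex_power_ivl1[of 2 n] by auto
        have "(2::nat) ^ max J 4 < 2 ^ (j + 1)" using elim j(2) by linarith
        then have "max J 4 < j + 1" by (rule power_less_imp_less_exp[rotated]) simp
        then have jJ: "j \<ge> J" "j \<ge> 4" by auto
        have L1: "ln (real j) \<ge> 1" using jJ by (intro j3) simp
        define m where "m = nat \<lfloor>2 ^ j * p n / ln (real j)\<rfloor>"
        define i where "i = n * m div 2 ^ j"
        have n: "n \<in> Cl j m i" unfolding Cl_def index_class_def using j m_def i_def by simp
        then have ne: "Cl j m i \<noteq> {}" by blast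
        have par: "m \<le> 2 ^ j" "i \<le> 2 * m"
          using index_class_parameters[of n p j m i] n p L1 unfolding Cl_def by auto
        have x: "x \<in> space M" "x \<notin> U j" using J[OF jJ(1)] by auto
        then have "x \<notin> G j m i" using par unfolding U_def by blast
        then have xE: "x \<notin> E j m (n1 j m i) (n2 j m i)" "x \<notin> E j m (n3 j m i) (n4 j m i)"
          using ne by (auto simp: G_def)
        have dev: "\<bar>?N (n1 j m i) (n2 j m i) - real (n1 j m i) * p (n2 j m i)\<bar> < t j m"
          "\<bar>?N (n3 j m i) (n4 j m i) - real (n3 j m i) * p (n4 j m i)\<bar> < t j m"
          using xE x(1) by (auto simp: E_def not_le)
        have up: "?N n n \<le> ?N (n1 j m i) (n2 j m i)" and lo: "?N (n3 j m i) (n4 j m i) \<le> ?N n n"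
          using ext[OF n] by (auto intro: exceed_count_mono)
        have L0: "ln (real j) > 0" using L1 by simp
        note rep' = rep[OF ne, unfolded Cl_def] and n' = n[unfolded Cl_def]
        have md: "\<bar>real (n1 j m i) * p (n2 j m i) - real n * p n\<bar> \<le> 4 * ln (real j)"
          "\<bar>real (n3 j m i) * p (n4 j m i) - real n * p n\<bar> \<le> 4 * ln (real j)"
          by (rule index_class_mean_diff[OF n' rep'(1,2) p(1) L0], rule index_class_mean_diff[OF n' rep'(3,4) p(1) L0])
        have "real m * ln (real j) \<le> 2 ^ j * p n" by (rule index_class_prob_bounds[OF n' p(1) L0])
        also have "\<dots> \<le> real n * p n"
        proof (rule mult_right_mono[OF _ p(1)])
          have "real (2 ^ j) \<le> real n" using j(1) by (simp only: of_nat_le_iff)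
          then show "2 ^ j \<le> real n" by (simp only: of_nat_power of_nat_numeral)
        qed
        finally have scale: "ln (real j) * \<mu> m powr (1/2 + \<epsilon>)
            \<le> 2 * max ((real n * p n) powr (1/2 + \<epsilon>) * ln (ln (real n)) powr (1/2 - \<epsilon>)) (ln (ln (real n)))"
          unfolding \<mu>_def by (intro deviation_scale_bound \<epsilon> jJ j)
        have "ln (real j) * 1 \<le> ln (real j) * \<mu> m powr (1/2 + \<epsilon>)"
          using L0 \<epsilon> by (intro mult_left_mono ge_one_powr_ge_zero) (auto simp: \<mu>_def)
        then have "4 * ln (real j) + t j m \<le> (4 + W1) * (ln (real j) * \<mu> m powr (1/2 + \<epsilon>))"
          by (simp add: t_def distrib_right mult.assoc)
        also have "\<dots> \<le> (4 + W1) * (2 * max ((real n * p n) powr (1/2 + \<epsilon>) * ln (ln (real n)) powr (1/2 - \<epsilon>)) (ln (ln (real n))))"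
          using W1 by (intro mult_left_mono scale) auto
        finally have fin: "4 * ln (real j) + t j m
          \<le> 2 * (4 + W1) * max ((real n * p n) powr (1/2 + \<epsilon>) * ln (ln (real n)) powr (1/2 - \<epsilon>)) (ln (ln (real n)))"
          by (simp only: mult.assoc mult.left_commute[of 2])
        have "\<bar>?N n n - real n * p n\<bar> \<le> 4 * ln (real j) + t j m"
          using dev md up lo by linarith
        from order_trans[OF this fin] show ?case unfolding p_def .
      qed
    qed
  qed
qed

text \<open>Trimming removes at most 2 W \<psi> n + 1 terms beyond the exceedances: W \<psi> n from
  the margin in b n, as much from the fluctuation of the count, and 1 from rounding up. Their total
  relative to d n vanishes by \<open>lim\<close>.\<close>

lemma trimmed_sum_law:
  fixes f a d :: "nat \<Rightarrow> real" and \<epsilon> W :: real and b :: "nat \<Rightarrow> nat"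
  assumes W: "W > 0" and f: "\<And>n. n \<ge> 1 \<Longrightarrow> 0 < f n"
    and a: "a = (\<lambda>n. real n * exceed_prob (f n))" and d: "d = (\<lambda>n. real n * truncated_mean (f n))"
    and d0: "eventually (\<lambda>n. d n \<noteq> 0) sequentially"
    and lim: "(\<lambda>n. f n / d n * max (a n powr (1/2 + \<epsilon>) * ln (ln (real n)) powr (1/2 - \<epsilon>)) (ln (real n)))
      \<longlonglongrightarrow> 0"
    and b: "b = (\<lambda>n. nat \<lceil>a n + W * max (a n powr (1/2 + \<epsilon>) * ln (ln (real n)) powr (1/2 - \<epsilon>)) (ln (ln (real n)))\<rceil>)"
    and count: "AE x in M. eventually (\<lambda>n. \<bar>exceed_count n (f n) x - a n\<bar>
        \<le> W * max (a n powr (1/2 + \<epsilon>) * ln (ln (real n)) powr (1/2 - \<epsilon>)) (ln (ln (real n)))) sequentially"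
  shows "AE x in M. (\<lambda>n. trimmed_sum T chi (b n) n x / d n) \<longlonglongrightarrow> 1"
proof -
  define y where "y n = a n powr (1/2 + \<epsilon>) * ln (ln (real n)) powr (1/2 - \<epsilon>)" for n
  define \<psi> where "\<psi> n = max (y n) (ln (ln (real n)))" for n
  have fd: "eventually (\<lambda>n. 0 < d n \<and> 0 \<le> f n / d n \<and> n \<ge> 3) sequentially"
    using d0 eventually_ge_at_top[of 3]
  proof eventually_elim
    case (elim n)
    have "0 < f n" using f elim by simp
    moreover have "0 \<le> d n" unfolding d using truncated_mean_nonneg[of "f n"] calculation by auto
    ultimately show ?case using elim by auto
  qed
  have ln1: "1 \<le> ln (real n)" if "n \<ge> 3" for n
  proof -
    have "exp 1 \<le> real n" using exp_le that by linarith
    then show ?thesis using that by (simp add: ln_ge_iff)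
  qed
  have lim_ln: "(\<lambda>n. f n / d n * ln (real n)) \<longlonglongrightarrow> 0"
  proof (rule tendsto_sandwich[OF _ _ tendsto_const lim])
    show "eventually (\<lambda>n. 0 \<le> f n / d n * ln (real n)) sequentially"
      using fd
    proof eventually_elim
      case (elim n)
      then show ?case using ln1[of n] by (intro mult_nonneg_nonneg) auto
    qed
    show "eventually (\<lambda>n. f n / d n * ln (real n) \<le> f n / d n * max (a n powr (1/2 + \<epsilon>) * ln (ln (real n)) powr (1/2 - \<epsilon>)) (ln (real n))) sequentially"
      using fd by eventually_elim (intro mult_left_mono, auto)
  qed
  have lim_err: "(\<lambda>n. (2 * W * \<psi> n + 1) * f n / d n) \<longlonglongrightarrow> 0"
  proof (rule tendsto_sandwich[OF _ _ tendsto_const])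
    show "eventually (\<lambda>n. 0 \<le> (2 * W * \<psi> n + 1) * f n / d n) sequentially"
      using fd
    proof eventually_elim
      case (elim n)
      have "0 \<le> \<psi> n" using ln1[of n] elim by (simp add: \<psi>_def le_max_iff_disj)
      then have "0 \<le> (2 * W * \<psi> n + 1) * (f n / d n)"
        using elim W by (intro mult_nonneg_nonneg add_nonneg_nonneg) auto
      then show ?case by simp
    qed
    show "eventually (\<lambda>n. (2 * W * \<psi> n + 1) * f n / d n \<le> (2 * W + 1) * (f n / d n * max (a n powr (1/2 + \<epsilon>) * ln (ln (real n)) powr (1/2 - \<epsilon>)) (ln (real n)))) sequentially"
      using fd
    proof eventually_elim
      case (elim n)
      \<comment> \<open>As ln n >= 1, this dominates both the ln ln n in \<psi> n and the rounding
        term 1.\<close>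
      let ?m = "max (y n) (ln (real n))"
      have l: "1 \<le> ln (real n)" using ln1 elim by simp
      then have "ln (ln (real n)) \<le> ln (real n)" using ln_le_minus_one[of "ln (real n)"] by simp
      then have "\<psi> n \<le> ?m" by (auto simp: \<psi>_def)
      moreover have "1 \<le> ?m" using l by simp
      ultimately have "2 * W * \<psi> n + 1 \<le> 2 * W * ?m + ?m" using W by (intro add_mono mult_left_mono) auto
      then have "(2 * W * \<psi> n + 1) * (f n / d n) \<le> ((2 * W + 1) * ?m) * (f n / d n)"
        using elim by (intro mult_right_mono) (auto simp: distrib_right)
      then show ?case by (simp add: y_def mult_ac)
    qed
    show "(\<lambda>n. (2 * W + 1) * (f n / d n * max (a n powr (1/2 + \<epsilon>) * ln (ln (real n)) powr (1/2 - \<epsilon>)) (ln (real n)))) \<longlonglongrightarrow> 0"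
      using tendsto_mult_right_zero[OF lim] .
  qed
  have law: "AE x in M. (\<lambda>n. (\<Sum>k<n. truncated chi (f n) ((T ^^ k) x)) / d n) \<longlonglongrightarrow> 1"
    by (rule truncated_sum_law[OF f d d0 lim_ln])
  show ?thesis
    using law count AE_space
  proof eventually_elim
    case (elim x)
    let ?S = "\<lambda>n. \<Sum>k<n. truncated chi (f n) ((T ^^ k) x)"
    have bounds: "eventually (\<lambda>n. ?S n / d n - (2 * W * \<psi> n + 1) * f n / d n \<le> trimmed_sum T chi (b n) n x / d n \<and>
        trimmed_sum T chi (b n) n x / d n \<le> ?S n / d n) sequentially"
      using elim(2) fd
    proof eventually_elim
      case (elim n)
      define N where "N = card {k. k < n \<and> f n < chi ((T ^^ k) x)}"
      have dev: "\<bar>real N - a n\<bar> \<le> W * \<psi> n" using elim(1) by (simp add: N_def exceed_count_def \<psi>_def y_def)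
      have bn: "b n = nat \<lceil>a n + W * \<psi> n\<rceil>" by (simp add: b \<psi>_def y_def)
      \<comment> \<open>A count is nonnegative, so the argument of \<open>nat\<close> is too and
        nothing is cut off.\<close>
      have "0 \<le> a n + W * \<psi> n" using dev by linarith
      then have b1: "a n + W * \<psi> n \<le> real (b n)" "real (b n) \<le> a n + W * \<psi> n + 1"
        unfolding bn by linarith+
      have "real N \<le> real (b n)" using dev b1 by linarith
      then have Nb: "N \<le> b n" by simp
      have fn: "0 \<le> f n" using f[of n] elim by simp
      have nn: "0 \<le> chi ((T ^^ k) x)" for k using chi_nonneg T_pow_space \<open>x \<in> space M\<close> by blast
      note tb = trimmed_sum_bounds[where chi = chi and T = T and x = x and n = n and l = "f n" and b = "b n", OF nn fn Nb[unfolded N_def]]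
      have "real (b n - N) * f n \<le> (2 * W * \<psi> n + 1) * f n"
        using dev b1 Nb fn by (intro mult_right_mono) (auto simp: of_nat_diff)
      then have "?S n - (2 * W * \<psi> n + 1) * f n \<le> trimmed_sum T chi (b n) n x"
        using tb(2) unfolding N_def by linarith
      then have "(?S n - (2 * W * \<psi> n + 1) * f n) / d n \<le> trimmed_sum T chi (b n) n x / d n"
        using elim by (intro divide_right_mono) auto
      moreover have "trimmed_sum T chi (b n) n x / d n \<le> ?S n / d n"
        using tb(1) elim by (intro divide_right_mono) auto
      ultimately show ?case by (simp add: diff_divide_distrib)
    qed
    have "(\<lambda>n. ?S n / d n - (2 * W * \<psi> n + 1) * f n / d n) \<longlonglongrightarrow> 1 - 0"
      by (intro tendsto_diff elim lim_err)
    then have l: "(\<lambda>n. ?S n / d n - (2 * W * \<psi> n + 1) * f n / d n) \<longlonglongrightarrow> 1" by simp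
    show ?case
      by (rule tendsto_sandwich[OF _ _ l elim(1)]) (use bounds in \<open>auto elim: eventually_mono\<close>)
  qed
qed

end

theorem theorem1p3:
  fixes M :: "'a measure" and T :: "'a \<Rightarrow> 'a"
    and \<F> :: "('a \<Rightarrow> complex) set" and nrm :: "('a \<Rightarrow> complex) \<Rightarrow> real"
    and chi :: "'a \<Rightarrow> real"
  assumes "property_D M T \<F> nrm chi"
  shows "\<exists>W>0. \<forall>(\<epsilon>::real) (f :: nat \<Rightarrow> real) (a :: nat \<Rightarrow> real) (d :: nat \<Rightarrow> real) (b :: nat \<Rightarrow> nat).
    0 < \<epsilon> \<and> \<epsilon> < 1/4 \<and>
    (\<forall>n\<ge>1. 0 < f n) \<and> filterlim f at_top sequentially \<and>
    a = (\<lambda>n. real n * (1 - dist_fun M chi (f n))) \<and>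
    d = (\<lambda>n. real n * (LINT x:{0..f n}|interval_measure (dist_fun M chi). x)) \<and>
    (\<forall>\<^sub>F n in sequentially. d n \<noteq> 0) \<and>
    (\<lambda>n. f n / d n * max (a n powr (1/2 + \<epsilon>) * ln (ln (real n)) powr (1/2 - \<epsilon>)) (ln (real n)))
      \<longlonglongrightarrow> 0 \<and>
    b = (\<lambda>n. nat \<lceil>a n + W * max (a n powr (1/2 + \<epsilon>) * ln (ln (real n)) powr (1/2 - \<epsilon>))
                                (ln (ln (real n)))\<rceil>)
    \<longrightarrow> (AE x in M. (\<lambda>n. trimmed_sum T chi (b n) n x / d n) \<longlonglongrightarrow> 1)"
proof -
  interpret trimmed_system M T \<F> nrm chi by unfold_locales (rule assms)
  \<comment> \<open>W is fixed here, ahead of \<epsilon> and f.\<close>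
  obtain W where W: "W > 0" and count: "\<And>\<epsilon> f. 0 < \<epsilon> \<Longrightarrow> \<epsilon> < 1/4 \<Longrightarrow> (\<And>n. n \<ge> 1 \<Longrightarrow> 0 < f n) \<Longrightarrow>
      AE x in M. eventually (\<lambda>n. \<bar>exceed_count n (f n) x - real n * exceed_prob (f n)\<bar>
        \<le> W * max ((real n * exceed_prob (f n)) powr (1/2 + \<epsilon>) * ln (ln (real n)) powr (1/2 - \<epsilon>)) (ln (ln (real n)))) sequentially"
  proof (rule exceed_count_law, goal_cases)
    case (1 W)
    show ?case by (rule that[OF 1(2,3)])
  qed
  show ?thesis
  proof (intro exI[of _ W] conjI allI impI W, elim conjE)
    fix \<epsilon> :: real and f a d :: "nat \<Rightarrow> real" and b :: "nat \<Rightarrow> nat"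
    assume \<epsilon>: "0 < \<epsilon>" "\<epsilon> < 1/4" and f: "\<forall>n\<ge>1. 0 < f n"
      and a: "a = (\<lambda>n. real n * (1 - dist_fun M chi (f n)))"
      and d: "d = (\<lambda>n. real n * (LINT x:{0..f n}|interval_measure (dist_fun M chi). x))"
      and d0: "\<forall>\<^sub>F n in sequentially. d n \<noteq> 0"
      and lim: "(\<lambda>n. f n / d n * max (a n powr (1/2 + \<epsilon>) * ln (ln (real n)) powr (1/2 - \<epsilon>)) (ln (real n)))
        \<longlonglongrightarrow> 0"
      and b: "b = (\<lambda>n. nat \<lceil>a n + W * max (a n powr (1/2 + \<epsilon>) * ln (ln (real n)) powr (1/2 - \<epsilon>))
                                (ln (ln (real n)))\<rceil>)"
    have f': "\<And>n. n \<ge> 1 \<Longrightarrow> 0 < f n" using f by blast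
    \<comment> \<open>F is eliminated from a and d, in favour of exceedance probabilities and
      truncated means.\<close>
    note a' = a[unfolded one_minus_dist_fun] and d' = d[unfolded integral_dist_fun]
    have an: "real n * exceed_prob (f n) = a n" for n by (simp add: a')
    show "AE x in M. (\<lambda>n. trimmed_sum T chi (b n) n x / d n) \<longlonglongrightarrow> 1"
      by (rule trimmed_sum_law[OF W f' a' d' d0 lim b count[of \<epsilon> f, OF \<epsilon> f', unfolded an]])
  qed
qed

end
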